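(* Let $L(\partial_t,\partial_x)=\partial_t^m+\sum_{j=0}^{m-1}P_j(\partial_x)\partial_t^j$ on $[0,\infty)\times\mathbb{R}^n$, where $m\ge 1$ is an integer and $P_j(\partial_x)=\sum_{|\alpha|=0}^{d_j}c_{j,\alpha}\partial_x^\alpha$ with $d_j\in\mathbb{N}$, $c_{j,\alpha}\in\mathbb{R}$, and let $\ell\in\{0,\dots,m-1\}$. Let $p_c$ be the exponent associated with $(L,\ell,n)$ defined in the context, and suppose $p_c>1$. Suppose that there exists $r\ge1$ such that for every $q\in[p_c,\infty]$ and every $f\in L^1\cap L^r$ the solution $u^{\mathrm{lin}}$ to the linear Cauchy problem $$L(\partial_t,\partial_x)u=0,\qquad \partial_t^ju(0,x)=0\ \ (j=0,\dots,m-2),\qquad \partial_t^{m-1}u(0,x)=f(x)$$ satisfies $$\|\partial_t^\ell u^{\mathrm{lin}}(t,\cdot)\|_{L^q}\le C(1+t)^{-\frac1{p_c}}\|f\|_{L^1\cap L^r}$$ (for all $t\ge0$, with $C>0$ independent of $f$ and $t$). Let $\mu:[0,\infty)\to[0,\infty)$ and $F(s)=|s|^{p_c}\mu(|s|)$, $s\in\mathbb{R}$, be such that, for some $\bar\varepsilon>0$, (i) $\mu$ is non-decreasing; (ii) $\mu$ is bounded on $[0,\bar\varepsilon]$; (iv) $F(0)=0$ and there is a constant $C>0$ such that $|F(y)-F(z)|\le C|y-z|\,(|y|^{p_c-1}+|z|^{p_c-1})\,\mu(|y|+|z|)$ for all $|y|\le\bar\varepsilon$, $|z|\le\bar\varepsilon$;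 and assume that $$\int_0^{c_0}\frac{\mu(\tau)}{\tau}\,d\tau<\infty\quad\text{for some } c_0>0 .$$ Then there exists $\varepsilon_0\in(0,\bar\varepsilon)$ such that, if $f\in L^1\cap L^r$ satisfies $\|f\|_{L^1\cap L^r}\le\varepsilon_0$, there exists a unique solution $u\in W^{\ell,\infty}_{\mathrm{loc}}([0,\infty),L^{p_c}\cap L^\infty)$ to the Cauchy problem $$L(\partial_t,\partial_x)u=F(\partial_t^\ell u),\qquad \partial_t^ju(0,x)=0\ \ (j=0,\dots,m-2),\qquad \partial_t^{m-1}u(0,x)=f(x).$$
   Context: All Lebesgue spaces are over $\mathbb{R}^n$; $\|f\|_{L^1\cap L^r}=\|f\|_{L^1}+\|f\|_{L^r}$ (and similarly for other intersections). Conventions: $d_m=0$, $P_m(\partial_x)=1$. Exponent $p_c$. Let $J=\{j\in\{0,\dots,m\}:P_j(\partial_x)\ne0\}$ and, for $j\in J$, $r_j=\min\{|\alpha|:c_{j,\alpha}\neq0\}$. For $\eta\in[0,\infty]$ put $$g(\eta)=\min_{j\in J}\{(j-\ell)\eta+r_j\},\qquad h(\eta)=1+\frac{g(\eta)}{(n+\eta-g(\eta))_+},$$ where $a_+=\max(a,0)$ and $1/0=\infty$. Then $p_c:=\max_{\eta\in[0,\infty]}h(\eta)$. Notion of solution. Let $K=K(t,x)$ be the fundamental solution for $L$, so that the solution of the linear Cauchy problem is $u^{\mathrm{lin}}(t,\cdot)=K(t,\cdot)*_{(x)}f$, where $*_{(x)}$ is convolution in $x$. By a solution of the nonlinear Cauchy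 problem is meant a function satisfying the Duhamel identity $$u(t,\cdot)=u^{\mathrm{lin}}(t,\cdot)+\int_0^tK(t-s,\cdot)*_{(x)}F(\partial_t^\ell u(s,\cdot))\,ds .$$ *)

theory Defs
  imports "HOL-Analysis.Analysis" "HOL-Probability.Essential_Supremum"
begin

section \<open>Lebesgue spaces\<close>

text \<open>Exponents are extended reals \<open>q \<in> [1,\<infinity>]\<close>; elements are represented by Borel functions,
  to be identified when they agree almost everywhere.\<close>

definition in_Lp :: "ereal \<Rightarrow> ('a::euclidean_space \<Rightarrow> real) \<Rightarrow> bool" where
  "in_Lp q f \<longleftrightarrow> f \<in> borel_measurable lborel \<and>
     (if q = \<infinity> then esssup lborel (\<lambda>x. ereal \<bar>f x\<bar>) < \<infinity>
      else integrable lborel (\<lambda>x. \<bar>f x\<bar> powr real_of_ereal q))"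

definition Lp_norm :: "ereal \<Rightarrow> ('a::euclidean_space \<Rightarrow> real) \<Rightarrow> real" where
  "Lp_norm q f =
     (if q = \<infinity> then real_of_ereal (esssup lborel (\<lambda>x. ereal \<bar>f x\<bar>))
      else (LINT x|lborel. \<bar>f x\<bar> powr real_of_ereal q) powr (1 / real_of_ereal q))"

definition in_Lcap :: "ereal \<Rightarrow> ereal \<Rightarrow> ('a::euclidean_space \<Rightarrow> real) \<Rightarrow> bool" where
  "in_Lcap a b f \<longleftrightarrow> in_Lp a f \<and> in_Lp b f"

definition Lcap_norm :: "ereal \<Rightarrow> ereal \<Rightarrow> ('a::euclidean_space \<Rightarrow> real) \<Rightarrow> real" where
  "Lcap_norm a b f = Lp_norm a f + Lp_norm b f"


section \<open>Partial derivatives and the operator\<close>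

text \<open>A multi-index is a function \<open>'n \<Rightarrow> nat\<close>. The order in which \<^term>\<open>mi_deriv\<close> runs through the
  coordinates is an arbitrary but fixed enumeration; it is irrelevant for smooth functions, the
  only ones to which it is applied.\<close>

definition mi_abs :: "('n::finite \<Rightarrow> nat) \<Rightarrow> nat" where
  "mi_abs \<alpha> = (\<Sum>i\<in>UNIV. \<alpha> i)"

definition partial :: "'n::finite \<Rightarrow> (real^'n \<Rightarrow> real) \<Rightarrow> real^'n \<Rightarrow> real" where
  "partial i \<phi> x = frechet_derivative \<phi> (at x) (axis i 1)"

definition coords :: "'n::finite list" where
  "coords = (SOME xs. distinct xs \<and> set xs = UNIV)"

definition mi_deriv :: "('n::finite \<Rightarrow> nat) \<Rightarrow> (real^'n \<Rightarrow> real) \<Rightarrow> real^'n \<Rightarrow> real" where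
  "mi_deriv \<alpha> = foldr (\<lambda>i. partial i ^^ \<alpha> i) coords"

text \<open>The operator is given by \<open>m\<close>, the degree bounds \<open>d j\<close> and the coefficients \<open>c j \<alpha>\<close>:
  \<open>P\<^sub>j = \<Sum>\<^bsub>|\<alpha>| \<le> d j\<^esub> c j \<alpha> \<partial>\<^sup>\<alpha>\<close> and \<open>L = \<Sum>\<^bsub>j \<le> m\<^esub> P\<^sub>j \<partial>\<^sub>t\<^sup>j\<close>, where \<open>P\<^sub>m = 1\<close> is to be
  arranged by \<open>d m = 0\<close> and \<open>c m 0 = 1\<close>. Only the formal transpose of \<open>P\<^sub>j\<close>, acting on test
  functions, is needed.\<close>

definition P_transpose ::
  "(nat \<Rightarrow> nat) \<Rightarrow> (nat \<Rightarrow> ('n::finite \<Rightarrow> nat) \<Rightarrow> real) \<Rightarrow> nat \<Rightarrow> (real^'n \<Rightarrow> real) \<Rightarrow> real^'n \<Rightarrow> real"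
where
  "P_transpose d c j \<phi> x =
     (\<Sum>\<alpha> | mi_abs \<alpha> \<le> d j. c j \<alpha> * (-1) ^ mi_abs \<alpha> * mi_deriv \<alpha> \<phi> x)"


section \<open>The exponent \<open>p\<^sub>c\<close>\<close>

definition J_set :: "nat \<Rightarrow> (nat \<Rightarrow> nat) \<Rightarrow> (nat \<Rightarrow> ('n::finite \<Rightarrow> nat) \<Rightarrow> real) \<Rightarrow> nat set" where
  "J_set m d c = {j \<in> {0..m}. \<exists>\<alpha>. mi_abs \<alpha> \<le> d j \<and> c j \<alpha> \<noteq> 0}"

definition r_min :: "(nat \<Rightarrow> nat) \<Rightarrow> (nat \<Rightarrow> ('n::finite \<Rightarrow> nat) \<Rightarrow> real) \<Rightarrow> nat \<Rightarrow> nat" where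
  "r_min d c j = Min {mi_abs \<alpha> | \<alpha>. mi_abs \<alpha> \<le> d j \<and> c j \<alpha> \<noteq> 0}"

definition g_fun ::
  "nat \<Rightarrow> (nat \<Rightarrow> nat) \<Rightarrow> (nat \<Rightarrow> ('n::finite \<Rightarrow> nat) \<Rightarrow> real) \<Rightarrow> nat \<Rightarrow> real \<Rightarrow> real" where
  "g_fun m d c l \<eta> =
     Min ((\<lambda>j. (real j - real l) * \<eta> + real (r_min d c j)) ` J_set m d c)"

text \<open>The convention \<open>1/0 = \<infinity>\<close> is that of \<^typ>\<open>ereal\<close>. The denominator vanishes only if
  \<open>g(\<eta>) \<ge> n + \<eta> > 0\<close>, so \<open>0/0\<close> does not occur.\<close>

definition h_fin ::
  "nat \<Rightarrow> (nat \<Rightarrow> nat) \<Rightarrow> (nat \<Rightarrow> ('n::finite \<Rightarrow> nat) \<Rightarrow> real) \<Rightarrow> nat \<Rightarrow> real \<Rightarrow> ereal" where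
  "h_fin m d c l \<eta> =
     1 + ereal (g_fun m d c l \<eta>) / ereal (max (real CARD('n) + \<eta> - g_fun m d c l \<eta>) 0)"

text \<open>At \<open>\<eta> = \<infinity>\<close> the formula is an indeterminate form and is read as the limit. With this,
  \<open>h\<close> is continuous on \<open>[0,\<infinity>]\<close>, so that the supremum below is a maximum.\<close>

definition h_fun ::
  "nat \<Rightarrow> (nat \<Rightarrow> nat) \<Rightarrow> (nat \<Rightarrow> ('n::finite \<Rightarrow> nat) \<Rightarrow> real) \<Rightarrow> nat \<Rightarrow> ereal \<Rightarrow> ereal" where
  "h_fun m d c l \<eta> =
     (if \<eta> = \<infinity> then Lim at_top (h_fin m d c l) else h_fin m d c l (real_of_ereal \<eta>))"

definition p_crit ::
  "nat \<Rightarrow> (nat \<Rightarrow> nat) \<Rightarrow> (nat \<Rightarrow> ('n::finite \<Rightarrow> nat) \<Rightarrow> real) \<Rightarrow> nat \<Rightarrow> ereal" where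
  "p_crit m d c l = (SUP \<eta>\<in>{0..\<infinity>}. h_fun m d c l \<eta>)"


section \<open>Tempered distributions\<close>

text \<open>All coefficients and data are real, so real test functions suffice.\<close>

definition schwartz :: "(real^'n::finite \<Rightarrow> real) \<Rightarrow> bool" where
  "schwartz \<phi> \<longleftrightarrow>
     (\<forall>is. (\<forall>x. foldr partial is \<phi> differentiable (at x)) \<and>
           (\<forall>N. bounded (range (\<lambda>x. (1 + norm x) ^ N * foldr partial is \<phi> x))))"

type_synonym 'n dist = "(real^'n \<Rightarrow> real) \<Rightarrow> real"

text \<open>Continuity: \<open>|T \<phi>|\<close> is bounded by a constant times a Schwartz seminorm of \<open>\<phi>\<close>; every upper
  bound \<open>B\<close> of the expression defining the seminorm stands for the seminorm itself.\<close>

definition tempered :: "('n::finite) dist \<Rightarrow> bool" where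
  "tempered T \<longleftrightarrow>
     (\<forall>\<phi> \<psi> a b. schwartz \<phi> \<longrightarrow> schwartz \<psi> \<longrightarrow>
        T (\<lambda>x. a * \<phi> x + b * \<psi> x) = a * T \<phi> + b * T \<psi>) \<and>
     (\<exists>C N. \<forall>\<phi> B. schwartz \<phi> \<longrightarrow>
        (\<forall>is x. length is \<le> N \<longrightarrow> (1 + norm x) ^ N * \<bar>foldr partial is \<phi> x\<bar> \<le> B) \<longrightarrow>
        \<bar>T \<phi>\<bar> \<le> C * B)"

definition dist_of :: "(real^'n::finite \<Rightarrow> real) \<Rightarrow> 'n dist" where
  "dist_of f \<phi> = (LINT x|lborel. f x * \<phi> x)"

definition dirac :: "('n::finite) dist" where
  "dirac \<phi> = \<phi> 0"

text \<open>Convolution in \<open>x\<close>: \<open>\<langle>T * f, \<phi>\<rangle> = \<langle>T \<otimes> f, \<phi>(x + y)\<rangle> = \<integral> f(y) \<langle>T, \<phi>(\<cdot> + y)\<rangle> dy\<close>, provided that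
  these integrals converge.\<close>

definition conv_exists :: "('n::finite) dist \<Rightarrow> (real^'n \<Rightarrow> real) \<Rightarrow> bool" where
  "conv_exists T f \<longleftrightarrow>
     (\<forall>\<phi>. schwartz \<phi> \<longrightarrow> integrable lborel (\<lambda>y. f y * T (\<lambda>x. \<phi> (x + y))))"

definition conv :: "('n::finite) dist \<Rightarrow> (real^'n \<Rightarrow> real) \<Rightarrow> 'n dist" where
  "conv T f \<phi> = (LINT y|lborel. f y * T (\<lambda>x. \<phi> (x + y)))"

text \<open>Derivative of order \<open>k\<close> in \<open>t \<in> [0,\<infinity>)\<close> of a family of distributions, one-sided at \<open>t = 0\<close>.\<close>

definition t_deriv :: "nat \<Rightarrow> (real \<Rightarrow> ('n::finite) dist) \<Rightarrow> real \<Rightarrow> 'n dist" where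
  "t_deriv k U t \<phi> =
     ((\<lambda>w s. vector_derivative w (at s within {0..})) ^^ k) (\<lambda>s. U s \<phi>) t"

text \<open>\<open>U\<close> solves \<open>L U = 0\<close>, \<open>\<partial>\<^sub>t\<^sup>j U(0) = 0\<close> for \<open>j \<le> m - 2\<close>, \<open>\<partial>\<^sub>t\<^bsup>m-1\<^esup> U(0) = T\<close>, as a function of
  \<open>t \<in> [0,\<infinity>)\<close> with values in the tempered distributions. Such a solution is unique.\<close>

definition linear_cauchy ::
  "nat \<Rightarrow> (nat \<Rightarrow> nat) \<Rightarrow> (nat \<Rightarrow> ('n::finite \<Rightarrow> nat) \<Rightarrow> real) \<Rightarrow> 'n dist \<Rightarrow> (real \<Rightarrow> 'n dist) \<Rightarrow> bool"
where
  "linear_cauchy m d c T U \<longleftrightarrow>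
     (\<forall>t\<ge>0. tempered (U t)) \<and>
     (\<forall>\<phi>. schwartz \<phi> \<longrightarrow>
        (\<forall>k<m. \<forall>t\<ge>0. (\<lambda>s. t_deriv k U s \<phi>) differentiable (at t within {0..})) \<and>
        (\<forall>t\<ge>0. (\<Sum>j\<le>m. t_deriv j U t (P_transpose d c j \<phi>)) = 0) \<and>
        (\<forall>j<m-1. t_deriv j U 0 \<phi> = 0) \<and>
        t_deriv (m-1) U 0 \<phi> = T \<phi>)"

definition fundamental_solution ::
  "nat \<Rightarrow> (nat \<Rightarrow> nat) \<Rightarrow> (nat \<Rightarrow> ('n::finite \<Rightarrow> nat) \<Rightarrow> real) \<Rightarrow> (real \<Rightarrow> 'n dist) \<Rightarrow> bool" where
  "fundamental_solution m d c K \<longleftrightarrow> linear_cauchy m d c dirac K"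


section \<open>The space \<open>W\<^sup>l\<^sup>,\<^sup>\<infinity>\<^sub>l\<^sub>o\<^sub>c([0,\<infinity>), L\<^sup>p \<inter> L\<^sup>\<infinity>)\<close>\<close>

text \<open>As usual for the non-separable space \<open>L\<^sup>\<infinity>\<close>, measurability is joint measurability in \<open>(t,x)\<close>.
  Strong (Bochner) measurability with values in \<open>L\<^sup>\<infinity>\<close> would be too much to ask: it already fails for
  the linear damped wave equation in three dimensions with suitable data in \<open>L\<^sup>1 \<inter> L\<^sup>\<infinity>\<close>.
  Values at \<open>t < 0\<close> play no role.\<close>

definition Linf_loc :: "real \<Rightarrow> (real \<Rightarrow> real^'n::finite \<Rightarrow> real) \<Rightarrow> bool" where
  "Linf_loc p u \<longleftrightarrow>
     set_borel_measurable borel ({0..} \<times> UNIV) (\<lambda>(t, x). u t x) \<and>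
     (\<forall>R\<ge>0. \<exists>B. AE t in lborel. t \<in> {0..R} \<longrightarrow>
        in_Lcap (ereal p) \<infinity> (u t) \<and> Lcap_norm (ereal p) \<infinity> (u t) \<le> B)"

definition time_test :: "(real \<Rightarrow> real) \<Rightarrow> bool" where
  "time_test \<psi> \<longleftrightarrow>
     (\<forall>k t. (deriv ^^ k) \<psi> differentiable (at t)) \<and>
     (\<exists>a b. 0 < a \<and> (\<forall>t. t \<notin> {a..b} \<longrightarrow> \<psi> t = 0))"

text \<open>\<open>v\<close> is the weak derivative \<open>\<partial>\<^sub>t\<^sup>k u\<close> on \<open>(0,\<infinity>)\<close>: the vector-valued integrals of
  \<open>\<psi>\<^sup>(\<^sup>k\<^sup>) u\<close> and \<open>(-1)\<^sup>k \<psi> v\<close> are the same element of \<open>L\<^sup>p \<inter> L\<^sup>\<infinity>\<close>.\<close>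

definition weak_t_deriv ::
  "nat \<Rightarrow> (real \<Rightarrow> real^'n::finite \<Rightarrow> real) \<Rightarrow> (real \<Rightarrow> real^'n \<Rightarrow> real) \<Rightarrow> bool" where
  "weak_t_deriv k u v \<longleftrightarrow>
     (\<forall>\<psi>. time_test \<psi> \<longrightarrow> (AE x in lborel.
        (LINT t:{0..}|lborel. (deriv ^^ k) \<psi> t * u t x) =
        (-1) ^ k * (LINT t:{0..}|lborel. \<psi> t * v t x)))"

definition W_loc :: "nat \<Rightarrow> real \<Rightarrow> (real \<Rightarrow> real^'n::finite \<Rightarrow> real) \<Rightarrow> bool" where
  "W_loc l p u \<longleftrightarrow>
     Linf_loc p u \<and> (\<forall>k\<le>l. \<exists>v. Linf_loc p v \<and> weak_t_deriv k u v)"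


section \<open>Solutions of the nonlinear problem\<close>

text \<open>The Duhamel identity at time \<open>t\<close>, with \<open>v\<close> in place of \<open>\<partial>\<^sub>t\<^sup>l u\<close>. Since \<open>K(t)\<close> is in general a
  distribution, the identity and the time integral in it are those of distributions in \<open>x\<close>;
  existence of the convolutions and of the time integral is part of the identity.\<close>

definition duhamel ::
  "(real \<Rightarrow> ('n::finite) dist) \<Rightarrow> (real \<Rightarrow> real) \<Rightarrow> (real^'n \<Rightarrow> real) \<Rightarrow>
   (real \<Rightarrow> real^'n \<Rightarrow> real) \<Rightarrow> (real \<Rightarrow> real^'n \<Rightarrow> real) \<Rightarrow> real \<Rightarrow> bool" where
  "duhamel K F f u v t \<longleftrightarrow>
     conv_exists (K t) f \<and>
     (AE s in lborel. s \<in> {0..t} \<longrightarrow> conv_exists (K (t - s)) (\<lambda>x. F (v s x))) \<and>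
     (\<forall>\<phi>. schwartz \<phi> \<longrightarrow>
        set_integrable lborel {0..t} (\<lambda>s. conv (K (t - s)) (\<lambda>x. F (v s x)) \<phi>) \<and>
        dist_of (u t) \<phi> =
          conv (K t) f \<phi> + (LINT s:{0..t}|lborel. conv (K (t - s)) (\<lambda>x. F (v s x)) \<phi>))"

definition nonlinear_solution ::
  "nat \<Rightarrow> real \<Rightarrow> (real \<Rightarrow> ('n::finite) dist) \<Rightarrow> (real \<Rightarrow> real) \<Rightarrow> (real^'n \<Rightarrow> real) \<Rightarrow>
   (real \<Rightarrow> real^'n \<Rightarrow> real) \<Rightarrow> bool" where
  "nonlinear_solution l p K F f u \<longleftrightarrow>
     W_loc l p u \<and>
     (\<exists>v. Linf_loc p v \<and> weak_t_deriv l u v \<and>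
          (AE t in lborel. 0 \<le> t \<longrightarrow> duhamel K F f u v t))"

end

theory Submission
  imports Defs
begin

text \<open>Differentiating the Duhamel identity \<open>l\<close> times turns it into a fixed point equation for
  \<open>v = \<partial>\<^sub>t\<^sup>l u\<close>: \<open>v(t) = \<partial>\<^sub>t\<^sup>l K(t) * f + \<integral>\<^sub>0\<^sup>t \<partial>\<^sub>t\<^sup>l K(t - s) * F(v(s)) ds\<close>, since the lower time derivatives of
  \<open>K\<close> vanish at \<open>t = 0\<close>. It is solved in the ball \<open>\<parallel>v(t)\<parallel> \<le> M (1 + t)\<^bsup>-1/p\<^esup>\<close> of \<open>L\<^sup>p \<inter> L\<^sup>\<infinity>\<close>, on which
  \<open>\<parallel>F(v(s)) - F(w(s))\<parallel>\<close> in \<open>L\<^sup>1 \<inter> L\<^sup>r\<close> is at most a multiple of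
  \<open>M\<^bsup>p-1\<^esup> (1 + s)\<^bsup>-1\<^esup> \<mu>(2M (1 + s)\<^bsup>-1/p\<^esup>)\<close> times the distance of \<open>v\<close> and \<open>w\<close>. The substitution
  \<open>\<tau> = 2M (1 + s)\<^bsup>-1/p\<^esup>\<close> turns the integral of this weight into the Dini integral of \<open>\<mu>\<close>; as \<open>p > 1\<close>, its
  convolution with \<open>(1 + t)\<^bsup>-1/p\<^esup>\<close> decays like \<open>(1 + t)\<^bsup>-1/p\<^esup>\<close> again, and for small \<open>M\<close> the equation is a
  contraction. Then \<open>u\<close> is the \<open>l\<close>-fold primitive of \<open>v\<close> in time. Any other solution satisfies the same
  fixed point equation almost everywhere, by testing with smooth functions of time.\<close>

section \<open>Measurable representatives and Minkowski's inequality\<close>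

text \<open>Two obstacles shape the development. The linear estimate yields, for each time and each
  exponent separately, some function that represents a distribution; it does not say how this
  function depends on time, while the Duhamel integral needs an integrand measurable in all
  variables. Measurability is recovered from the pairings with test functions: these determine the
  integrals over boxes, and averages over small cubes determine the function. Secondly, functions of
  time with values in \<open>L^\<infinity>\<close> need not be strongly measurable, so Bochner
  integrals are avoided: time integrals are taken at fixed \<open>x\<close> and estimated
  afterwards, one number \<open>B\<close> in \<open>Lbd p w B\<close> bounding both norms. The
  Duhamel identity is never differentiated. The fixed point equation is posed directly with the
  differentiated kernel, and integrating it \<open>l\<close> times gives the identity back. The
  decay rate fits the power exactly: \<open>(1 + s)^(-1/p)\<close> from the difference of two
  functions and \<open>(1 + s)^(-(p-1)/p)\<close> from the Lipschitz bound multiply to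
  \<open>1 / (1 + s)\<close>, the logarithmic measure in which the Dini condition is
  formulated.\<close>

lemma caratheodory_measurable:
  fixes f :: "'a \<Rightarrow> 'b::{metric_space, second_countable_topology} \<Rightarrow> real"
  assumes meas: "\<And>x. (\<lambda>a. f a x) \<in> borel_measurable M"
    and cont: "\<And>a. a \<in> space M \<Longrightarrow> continuous_on UNIV (f a)"
  shows "(\<lambda>(a, x). f a x) \<in> borel_measurable (M \<Otimes>\<^sub>M borel)"
proof -
  obtain D :: "'b set" where D: "countable D" "\<And>X. open X \<Longrightarrow> X \<noteq> {} \<Longrightarrow> \<exists>d\<in>D. d \<in> X"
    using countable_dense_setE by blast
  have "D \<noteq> {}" using D(2)[of UNIV] by auto
  define e where "e = from_nat_into D"
  \<comment> \<open>\<open>q k x\<close> is the first index of a point of the dense sequence within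
    \<open>1/(k+1)\<close> of \<open>x\<close>. It takes countably many values, so replacing
    \<open>x\<close> by \<open>e (q k x)\<close> leaves a measurable function of the pair, and
    continuity of \<open>f a\<close> removes the replacement in the limit.\<close>
  define q where "q k x = (LEAST j. dist x (e j) < 1 / Suc k)" for k :: nat and x
  have ex: "dist x (e (q k x)) < 1 / Suc k" for k x
  proof -
    obtain d where "d \<in> D" "d \<in> ball x (1 / Suc k)"
      using D(2)[of "ball x (1 / Suc k)"] by auto
    then obtain j where "dist x (e j) < 1 / Suc k"
      using from_nat_into_surj[OF D(1)] unfolding e_def by (metis mem_ball)
    then show ?thesis unfolding q_def by (rule LeastI)
  qed
  have conv: "(\<lambda>k. e (q k x)) \<longlonglongrightarrow> x" for x
  proof (rule metric_LIMSEQ_I)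
    fix r :: real assume "r > 0"
    then obtain N where N: "1 / Suc N < r" using nat_approx_posE by blast
    have "dist (e (q k x)) x < r" if "k \<ge> N" for k
    proof -
      have "1 / Suc k \<le> 1 / real (Suc N)" using that by (simp add: frac_le)
      then show ?thesis using ex[of x k] N by (simp add: dist_commute)
    qed
    then show "\<exists>N. \<forall>k\<ge>N. dist (e (q k x)) x < r" by blast
  qed
  have qm[measurable]: "q k \<in> borel \<rightarrow>\<^sub>M count_space UNIV" for k
    unfolding q_def by measurable
  have step: "(\<lambda>(a, x). f a (e (q k x))) \<in> borel_measurable (M \<Otimes>\<^sub>M borel)" for k
  proof -
    have "(\<lambda>z. (\<lambda>j z. f (fst z) (e j)) (q k (snd z)) z) \<in> borel_measurable (M \<Otimes>\<^sub>M borel)"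
    proof (rule measurable_compose_countable)
      show "(\<lambda>z. f (fst z) (e j)) \<in> borel_measurable (M \<Otimes>\<^sub>M borel)" for j
        by (rule measurable_compose[OF measurable_fst meas])
    qed measurable
    then show ?thesis by (simp add: split_beta')
  qed
  show ?thesis
  proof (rule borel_measurable_LIMSEQ_real[OF _ step])
    fix z assume "z \<in> space (M \<Otimes>\<^sub>M (borel :: 'b measure))"
    then have "fst z \<in> space M" by (auto simp: space_pair_measure)
    from cont[OF this] have "isCont (f (fst z)) (snd z)"
      by (simp add: continuous_on_eq_continuous_at)
    from isCont_tendsto_compose[OF this conv]
    show "(\<lambda>k. case z of (a, x) \<Rightarrow> f a (e (q k x))) \<longlonglongrightarrow> (case z of (a, x) \<Rightarrow> f a x)"
      by (simp add: split_beta')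
  qed
qed

text \<open>The cubes have \<open>x\<close> as a corner and the side lengths \<open>1/(k+1)\<close>
  only: with a sequence the limit stays measurable in parameters. The exceptional set is negligible,
  and \<open>AE_completion_iff\<close> leads from the completed measure back to
  \<open>lborel\<close>.\<close>

lemma lebesgue_differentiation_cubes:
  fixes w :: "'a::euclidean_space \<Rightarrow> real"
  assumes int: "\<And>a b. set_integrable lborel (cbox a b) w"
  shows "AE x in lborel. (\<lambda>k. (LINT y:cbox x (x + (1 / Suc k) *\<^sub>R One)|lborel. w y) * real (Suc k) ^ DIM('a))
           \<longlonglongrightarrow> w x"
proof -
  have "w integrable_on cbox a b" for a b
    using int[of a b] by (rule set_borel_integral_eq_integral)
  then obtain N where N: "negligible N" "\<And>x e. x \<notin> N \<Longrightarrow> 0 < e \<Longrightarrow>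
     \<exists>d>0. \<forall>h. 0 < h \<and> h < d \<longrightarrow>
       norm (integral (cbox x (x + h *\<^sub>R One)) w /\<^sub>R h ^ DIM('a) - w x) < e"
    using integrable_ccontinuous_explicit by blast
  have "(\<lambda>k. (LINT y:cbox x (x + (1 / Suc k) *\<^sub>R One)|lborel. w y) * real (Suc k) ^ DIM('a)) \<longlonglongrightarrow> w x"
    if "x \<notin> N" for x
  proof (rule metric_LIMSEQ_I)
    fix e :: real assume "e > 0"
    then obtain d where "d > 0" and d: "\<And>h. 0 < h \<Longrightarrow> h < d \<Longrightarrow>
      norm (integral (cbox x (x + h *\<^sub>R One)) w /\<^sub>R h ^ DIM('a) - w x) < e"
      using N(2)[OF \<open>x \<notin> N\<close>] by blast
    obtain M where M: "1 / Suc M < d" using nat_approx_posE[OF \<open>d > 0\<close>] by blast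
    have "dist ((LINT y:cbox x (x + (1 / Suc k) *\<^sub>R One)|lborel. w y) * real (Suc k) ^ DIM('a)) (w x) < e"
      if "k \<ge> M" for k
    proof -
      have "1 / Suc k \<le> 1 / real (Suc M)" using that by (simp add: frac_le)
      then have "1 / Suc k < d" using M by linarith
      from d[OF _ this] show ?thesis
        by (simp add: dist_norm set_borel_integral_eq_integral(2)[OF int] field_simps)
    qed
    then show "\<exists>M. \<forall>k\<ge>M. dist ((LINT y:cbox x (x + (1 / Suc k) *\<^sub>R One)|lborel. w y) *
         real (Suc k) ^ DIM('a)) (w x) < e" by blast
  qed
  then have "AE x in lebesgue. (\<lambda>k. (LINT y:cbox x (x + (1 / Suc k) *\<^sub>R One)|lborel. w y) *
       real (Suc k) ^ DIM('a)) \<longlonglongrightarrow> w x"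
    unfolding eventually_ae_filter_negligible using N(1) by blast
  then show ?thesis by (simp add: AE_completion_iff)
qed

lemma AE_zero_if_cbox_integrals_zero:
  fixes w :: "'a::euclidean_space \<Rightarrow> real"
  assumes int: "\<And>a b. set_integrable lborel (cbox a b) w"
    and zero: "\<And>a b. (LINT y:cbox a b|lborel. w y) = 0"
  shows "AE x in lborel. w x = 0"
  using lebesgue_differentiation_cubes[OF int]
  by eventually_elim (auto simp: zero dest: LIMSEQ_unique[OF tendsto_const])

text \<open>The representative is the limit of the averages over small cubes.\<close>

lemma jointly_measurable_representative:
  fixes w :: "'a \<Rightarrow> 'b::euclidean_space \<Rightarrow> real"
  assumes int: "\<And>a b c. a \<in> space M \<Longrightarrow> set_integrable lborel (cbox b c) (w a)"
    and meas: "\<And>b c. (\<lambda>a. LINT y:cbox b c|lborel. w a y) \<in> borel_measurable M"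
  obtains \<sigma> where "(\<lambda>(a, x). \<sigma> a x) \<in> borel_measurable (M \<Otimes>\<^sub>M borel)"
    and "\<And>a. a \<in> space M \<Longrightarrow> AE x in lborel. \<sigma> a x = w a x"
proof -
  define W where "W k a x = (LINT y:cbox x (x + (1 / Suc k) *\<^sub>R One)|lborel. w a y) * real (Suc k) ^ DIM('b)"
    for k :: nat and a x
  have cont: "continuous_on UNIV (W k a)" if a: "a \<in> space M" for k a
  proof -
    have wi: "w a integrable_on cbox b c" for b c
      using int[OF a] by (rule set_borel_integral_eq_integral)
    have "isCont (\<lambda>x. integral (cbox x (x + (1 / Suc k) *\<^sub>R One)) (w a)) x" for x
      unfolding continuous_at_eps_delta dist_norm
    proof (intro allI impI)
      fix e :: real assume "e > 0"
      have r: "1 / (1 + real k) \<le> 1" by simp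
      \<comment> \<open>Side lengths are at most 1 and the corner moves by less than 1 per
        coordinate, so this box contains every cube that occurs; on it the integral is continuous in
        both corners.\<close>
      have "x \<in> cbox (x - 2 *\<^sub>R One) (x + 2 *\<^sub>R One)"
        "x + (1 / Suc k) *\<^sub>R One \<in> cbox (x - 2 *\<^sub>R One) (x + 2 *\<^sub>R One)"
        using r by (auto simp: mem_box algebra_simps intro: order_trans[OF r] add_nonneg_nonneg)
      then obtain \<delta> where "\<delta> > 0" and \<delta>:
        "\<And>c d. c \<in> cbox (x - 2 *\<^sub>R One) (x + 2 *\<^sub>R One) \<Longrightarrow> d \<in> cbox (x - 2 *\<^sub>R One) (x + 2 *\<^sub>R One) \<Longrightarrow>
          norm (c - x) \<le> \<delta> \<Longrightarrow> norm (d - (x + (1 / Suc k) *\<^sub>R One)) \<le> \<delta> \<Longrightarrow>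
          norm (integral (cbox c d) (w a) - integral (cbox x (x + (1 / Suc k) *\<^sub>R One)) (w a)) < e"
        using indefinite_integral_continuous[OF wi _ _ \<open>e > 0\<close>] by metis
      show "\<exists>d>0. \<forall>x'. norm (x' - x) < d \<longrightarrow> norm (integral (cbox x' (x' + (1 / Suc k) *\<^sub>R One)) (w a) -
            integral (cbox x (x + (1 / Suc k) *\<^sub>R One)) (w a)) < e"
      proof (intro exI[of _ "min \<delta> 1"] conjI allI impI)
        fix x' assume x': "norm (x' - x) < min \<delta> 1"
        have b: "\<bar>x' \<bullet> i - x \<bullet> i\<bar> < 1" if "i \<in> Basis" for i
          using norm_bound_Basis_lt[OF that, of "x' - x" 1] x' by (simp add: inner_diff_left)
        show "norm (integral (cbox x' (x' + (1 / Suc k) *\<^sub>R One)) (w a) -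
            integral (cbox x (x + (1 / Suc k) *\<^sub>R One)) (w a)) < e"
        proof (rule \<delta>)
          show "x' \<in> cbox (x - 2 *\<^sub>R One) (x + 2 *\<^sub>R One)"
            unfolding mem_box
          proof
            fix i :: 'b assume "i \<in> Basis"
            with b[OF this] show "(x - 2 *\<^sub>R One) \<bullet> i \<le> x' \<bullet> i \<and> x' \<bullet> i \<le> (x + 2 *\<^sub>R One) \<bullet> i"
              by (simp add: inner_diff_left inner_add_left) linarith
          qed
          show "x' + (1 / Suc k) *\<^sub>R One \<in> cbox (x - 2 *\<^sub>R One) (x + 2 *\<^sub>R One)"
            unfolding mem_box
          proof
            fix i :: 'b assume "i \<in> Basis"
            then have e: "(x - 2 *\<^sub>R One) \<bullet> i = x \<bullet> i - 2" "(x + 2 *\<^sub>R One) \<bullet> i = x \<bullet> i + 2"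
              "(x' + (1 / Suc k) *\<^sub>R One) \<bullet> i = x' \<bullet> i + 1 / (1 + real k)"
              by (simp_all add: inner_diff_left inner_add_left)
            have "0 \<le> 1 / (1 + real k)" by simp
            with b[OF \<open>i \<in> Basis\<close>] r
            show "(x - 2 *\<^sub>R One) \<bullet> i \<le> (x' + (1 / Suc k) *\<^sub>R One) \<bullet> i \<and>
                (x' + (1 / Suc k) *\<^sub>R One) \<bullet> i \<le> (x + 2 *\<^sub>R One) \<bullet> i"
              unfolding e by linarith
          qed
        qed (use x' in auto)
      qed (use \<open>\<delta> > 0\<close> in auto)
    qed
    then show ?thesis
      unfolding W_def set_borel_integral_eq_integral(2)[OF int[OF a]]
      by (intro continuous_intros) (auto simp: continuous_on_eq_continuous_at)
  qed
  have measW[measurable]: "(\<lambda>(a, x). W k a x) \<in> borel_measurable (M \<Otimes>\<^sub>M borel)" for k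
  proof (rule caratheodory_measurable[OF _ cont])
    show "(\<lambda>a. W k a x) \<in> borel_measurable M" for x
      unfolding W_def using meas by simp
  qed
  \<comment> \<open>\<open>lim\<close> is total. Where the averages diverge its value is arbitrary,
    which concerns only a null set of \<open>x\<close> for each \<open>a\<close>.\<close>
  show ?thesis
  proof (rule that[of "\<lambda>a x. lim (\<lambda>k. W k a x)"])
    show "(\<lambda>(a, x). lim (\<lambda>k. W k a x)) \<in> borel_measurable (M \<Otimes>\<^sub>M borel)"
    proof -
      have "(\<lambda>z. lim (\<lambda>k. (\<lambda>(a, x). W k a x) z)) \<in> borel_measurable (M \<Otimes>\<^sub>M borel)"
        by (rule borel_measurable_lim_metric) measurable
      then show ?thesis by (simp add: split_beta')
    qed
    fix a assume "a \<in> space M"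
    from lebesgue_differentiation_cubes[OF int[OF this]]
    show "AE x in lborel. lim (\<lambda>k. W k a x) = w a x"
      unfolding W_def by eventually_elim (rule limI)
  qed
qed

section \<open>Minkowski's integral inequality in \<open>L^p\<close>\<close>

lemma Young_scaled:
  fixes y c p :: real
  assumes "p > 1" "y \<ge> 0" "c > 0"
  shows "y \<le> c powr (1 - p) * y powr p / p + c * (p - 1) / p"
proof -
  have q: "1 / p + 1 / (p / (p - 1)) = 1" "p / (p - 1) > 1"
    using assms by (auto simp: field_simps)
  have "c powr ((1 - p) / p) * y * c powr ((p - 1) / p) \<le>
     (c powr ((1 - p) / p) * y) powr p / p + (c powr ((p - 1) / p)) powr (p / (p - 1)) / (p / (p - 1))"
    using assms q by (intro Youngs_inequality) auto
  moreover have "c powr ((1 - p) / p) * y * c powr ((p - 1) / p) = y"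
  proof -
    have "c powr ((1 - p) / p) * c powr ((p - 1) / p) = 1"
      using assms by (simp add: powr_add[symmetric] add_divide_distrib[symmetric])
    then show ?thesis by (metis mult.commute mult.left_commute mult.right_neutral)
  qed
  moreover have "(c powr ((1 - p) / p) * y) powr p = c powr (1 - p) * y powr p"
    using assms by (simp add: powr_mult powr_powr)
  moreover have "(c powr ((p - 1) / p)) powr (p / (p - 1)) = c"
    using assms by (simp add: powr_powr)
  ultimately have "y \<le> c powr (1 - p) * y powr p / p + c / (p / (p - 1))" by simp
  then show ?thesis by simp
qed

text \<open>Jensen's inequality for the measure \<open>b ds\<close> of mass at most
  \<open>B\<close>, applied to \<open>|h| / b\<close>. It comes from integrating
  \<open>Young_scaled\<close> with a free scale \<open>c\<close>: that bound says that
  \<open>y^p\<close> lies above its tangent at \<open>c\<close>, and \<open>c\<close> is optimised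
  after the integration.\<close>

lemma weighted_Jensen:
  fixes h b :: "real \<Rightarrow> real"
  assumes p: "p > 1" and [measurable]: "S \<in> sets lborel" "h \<in> borel_measurable lborel"
    and b: "set_integrable lborel S b" "\<And>s. s \<in> S \<Longrightarrow> b s > 0" and B: "(LINT s:S|lborel. b s) \<le> B" "B > 0"
    and Q: "set_integrable lborel S (\<lambda>s. b s powr (1 - p) * \<bar>h s\<bar> powr p)"
  shows "set_integrable lborel S h"
    and "\<bar>LINT s:S|lborel. h s\<bar> powr p \<le> B powr (p - 1) * (LINT s:S|lborel. b s powr (1 - p) * \<bar>h s\<bar> powr p)"
proof -
  let ?Q = "LINT s:S|lborel. b s powr (1 - p) * \<bar>h s\<bar> powr p"
  have pt: "\<bar>h s\<bar> \<le> c powr (1 - p) / p * (b s powr (1 - p) * \<bar>h s\<bar> powr p) + c * (p - 1) / p * b s"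
    if "s \<in> S" "c > 0" for s c
  proof -
    have bs: "b s > 0" using b(2) that by simp
    have "b s * (\<bar>h s\<bar> / b s) \<le> b s * (c powr (1 - p) * (\<bar>h s\<bar> / b s) powr p / p + c * (p - 1) / p)"
      using bs by (intro mult_left_mono Young_scaled) (use p that in auto)
    moreover have "b s * (\<bar>h s\<bar> / b s) powr p = b s powr (1 - p) * \<bar>h s\<bar> powr p"
      using bs by (simp add: powr_divide powr_diff)
    moreover have "b s * (c powr (1 - p) * (\<bar>h s\<bar> / b s) powr p / p + c * (p - 1) / p) =
      c powr (1 - p) / p * (b s * (\<bar>h s\<bar> / b s) powr p) + c * (p - 1) / p * b s"
      using p by (simp add: field_simps)
    ultimately show ?thesis using bs by simp
  qed
  show hi: "set_integrable lborel S h"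
    unfolding set_integrable_def
  proof (rule Bochner_Integration.integrable_bound)
    show "integrable lborel (\<lambda>s. 1 powr (1 - p) / p * (indicator S s *\<^sub>R (b s powr (1 - p) * \<bar>h s\<bar> powr p)) +
       1 * (p - 1) / p * (indicator S s *\<^sub>R b s))"
      using b(1) Q unfolding set_integrable_def by (intro Bochner_Integration.integrable_add integrable_mult_right) auto
    show "AE s in lborel. norm (indicat_real S s *\<^sub>R h s) \<le> norm (1 powr (1 - p) / p *
         (indicator S s *\<^sub>R (b s powr (1 - p) * \<bar>h s\<bar> powr p)) + 1 * (p - 1) / p * (indicator S s *\<^sub>R b s))"
    proof (rule AE_I2)
      fix s
      show "norm (indicat_real S s *\<^sub>R h s) \<le> norm (1 powr (1 - p) / p *
         (indicator S s *\<^sub>R (b s powr (1 - p) * \<bar>h s\<bar> powr p)) + 1 * (p - 1) / p * (indicator S s *\<^sub>R b s))"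
        using pt[of s 1] by (auto simp: indicator_def)
    qed
  qed simp
  have le: "\<bar>LINT s:S|lborel. h s\<bar> \<le> c powr (1 - p) / p * ?Q + c * (p - 1) / p * B" if c: "c > 0" for c
  proof -
    have "\<bar>LINT s:S|lborel. h s\<bar> \<le> (LINT s:S|lborel. \<bar>h s\<bar>)"
      using set_integral_norm_bound[OF hi] by simp
    also have "\<dots> \<le> (LINT s:S|lborel. c powr (1 - p) / p * (b s powr (1 - p) * \<bar>h s\<bar> powr p) + c * (p - 1) / p * b s)"
      using b(1) Q c by (intro set_integral_mono set_integral_add set_integrable_mult_right set_integrable_abs hi pt) auto
    also have "\<dots> = c powr (1 - p) / p * ?Q + c * (p - 1) / p * (LINT s:S|lborel. b s)"
      using b(1) Q by (subst set_integral_add) auto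
    also have "\<dots> \<le> c powr (1 - p) / p * ?Q + c * (p - 1) / p * B"
      using B c p by (intro add_left_mono mult_left_mono) auto
    finally show ?thesis .
  qed
  have Q0: "?Q \<ge> 0"
    unfolding set_lebesgue_integral_def by (intro integral_nonneg_AE) (auto simp: indicator_def)
  show "\<bar>LINT s:S|lborel. h s\<bar> powr p \<le> B powr (p - 1) * ?Q"
  \<comment> \<open>The optimal scale is \<open>(?Q / B) powr (1 / p)\<close>. It vanishes for
    \<open>?Q = 0\<close>, where \<open>c\<close> is sent to 0 instead.\<close>
  proof (cases "?Q = 0")
    case True
    have "\<bar>LINT s:S|lborel. h s\<bar> \<le> 0 + e" if "e > 0" for e
    proof -
      have "\<bar>LINT s:S|lborel. h s\<bar> \<le> (e * p / ((p - 1) * B)) * (p - 1) / p * B"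
        using le[of "e * p / ((p - 1) * B)"] that p B True by simp
      also have "\<dots> = 0 + e" using p B by (simp add: field_simps)
      finally show ?thesis .
    qed
    then have "\<bar>LINT s:S|lborel. h s\<bar> \<le> 0" by (rule field_le_epsilon)
    then show ?thesis using True p by simp
  next
    case False
    define c where "c = (?Q / B) powr (1 / p)"
    have Qp: "?Q > 0" using False Q0 by simp
    have c: "c > 0" unfolding c_def using Qp B by simp
    have cp: "c powr p = ?Q / B" unfolding c_def using Qp B p by (simp add: powr_powr)
    have "c powr (1 - p) * ?Q = c * B"
      using c cp B Qp by (simp add: powr_diff field_simps)
    then have "c powr (1 - p) / p * ?Q + c * (p - 1) / p * B = c * B"
      using p by (simp add: field_simps)
    with le[OF c] have "\<bar>LINT s:S|lborel. h s\<bar> \<le> c * B" by simp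
    then have "\<bar>LINT s:S|lborel. h s\<bar> powr p \<le> (c * B) powr p"
      using p by (intro powr_mono2) auto
    also have "\<dots> = B powr (p - 1) * ?Q"
      using c B cp by (simp add: powr_mult powr_diff field_simps)
    finally show ?thesis .
  qed
qed

text \<open>The weight \<open>b\<close> has to be positive because Jensen's inequality is applied to the measure \<open>b ds\<close>.\<close>

lemma Minkowski_integral:
  fixes \<sigma> :: "real \<Rightarrow> 'a::euclidean_space \<Rightarrow> real"
  assumes p: "p > 1" and [measurable]: "S \<in> sets lborel" "(\<lambda>(s, x). \<sigma> s x) \<in> borel_measurable (borel \<Otimes>\<^sub>M borel)"
    and b: "set_integrable lborel S b" "\<And>s. s \<in> S \<Longrightarrow> b s > 0"
    and B: "(LINT s:S|lborel. b s) \<le> B" "B > 0"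
    and \<sigma>: "\<And>s. s \<in> S \<Longrightarrow> (\<integral>\<^sup>+x. ennreal (\<bar>\<sigma> s x\<bar> powr p) \<partial>lborel) \<le> ennreal (b s powr p)"
  shows "AE x in lborel. set_integrable lborel S (\<lambda>s. \<sigma> s x)"
    and "(\<integral>\<^sup>+x. ennreal (\<bar>LINT s:S|lborel. \<sigma> s x\<bar> powr p) \<partial>lborel) \<le> ennreal (B powr p)"
proof -
  \<comment> \<open>\<open>b\<close> is known to be measurable on \<open>S\<close> only; cutting it
    off makes the Tonelli integrand measurable.\<close>
  define b' where "b' s = indicator S s * b s" for s
  have [measurable]: "b' \<in> borel_measurable lborel"
    using b(1) unfolding b'_def set_integrable_def by (auto dest: borel_measurable_integrable)
  have b': "b' s = b s" if "s \<in> S" for s using that by (simp add: b'_def)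
  have bI: "set_integrable lborel S b'" "(LINT s:S|lborel. b' s) \<le> B"
  proof -
    have "(\<lambda>s. indicat_real S s *\<^sub>R b' s) = (\<lambda>s. indicator S s *\<^sub>R b s)"
      by (rule ext) (simp add: b'_def indicator_def)
    then show "set_integrable lborel S b'" "(LINT s:S|lborel. b' s) \<le> B"
      using b(1) B(1) unfolding set_integrable_def set_lebesgue_integral_def by metis+
  qed
  have [measurable]: "(\<lambda>s. \<sigma> s x) \<in> borel_measurable borel" for x
    using measurable_compose[OF measurable_Pair2' , of x borel "\<lambda>(s, x). \<sigma> s x" borel borel] by simp
  \<comment> \<open>By Tonelli, integrating over \<open>x\<close> first, the weight
    \<open>b powr (1 - p)\<close> meets \<open>b powr p\<close> and leaves \<open>b\<close>, so the
    integral of \<open>G\<close> is at most \<open>B\<close>; Jensen contributes the remaining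
    \<open>B powr (p - 1)\<close>.\<close>
  define G where "G x = (\<integral>\<^sup>+s. indicator S s * ennreal (b' s powr (1 - p) * \<bar>\<sigma> s x\<bar> powr p) \<partial>lborel)" for x
  have [measurable]: "G \<in> borel_measurable borel"
    unfolding G_def by measurable
  have "(\<integral>\<^sup>+x. G x \<partial>lborel) =
     (\<integral>\<^sup>+s. (\<integral>\<^sup>+x. indicator S s * ennreal (b' s powr (1 - p) * \<bar>\<sigma> s x\<bar> powr p) \<partial>lborel) \<partial>lborel)"
    unfolding G_def by (subst lborel_pair.Fubini') auto
  also have "\<dots> \<le> (\<integral>\<^sup>+s. ennreal (indicator S s * b' s) \<partial>lborel)"
  proof (rule nn_integral_mono)
    fix s
    show "(\<integral>\<^sup>+x. indicator S s * ennreal (b' s powr (1 - p) * \<bar>\<sigma> s x\<bar> powr p) \<partial>lborel) \<le> ennreal (indicator S s * b' s)"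
    proof (cases "s \<in> S")
      case True
      have "(\<integral>\<^sup>+x. indicator S s * ennreal (b' s powr (1 - p) * \<bar>\<sigma> s x\<bar> powr p) \<partial>lborel) =
         ennreal (b' s powr (1 - p)) * (\<integral>\<^sup>+x. ennreal (\<bar>\<sigma> s x\<bar> powr p) \<partial>lborel)"
        using True by (subst nn_integral_cmult[symmetric]) (auto simp: ennreal_mult)
      also have "\<dots> \<le> ennreal (b' s powr (1 - p)) * ennreal (b s powr p)"
        by (intro mult_left_mono \<sigma> True) simp
      also have "\<dots> = ennreal (b s)"
        using b(2)[OF True] b'[OF True] by (simp add: ennreal_mult[symmetric] powr_add[symmetric])
      finally show ?thesis using True b' by simp
    qed simp
  qed
  also have "\<dots> = ennreal (LINT s:S|lborel. b' s)"
    using bI(1) b(2) unfolding set_lebesgue_integral_def set_integrable_def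
    by (subst nn_integral_eq_integral) (auto simp: b'_def indicator_def intro: less_imp_le)
  also have "\<dots> \<le> ennreal B" using bI(2) by (rule ennreal_leI)
  finally have GB: "(\<integral>\<^sup>+x. G x \<partial>lborel) \<le> ennreal B" .
  then have "(\<integral>\<^sup>+x. G x \<partial>lborel) < \<infinity>"
    by (rule order_le_less_trans) simp
  then have fin: "AE x in lborel. G x < \<infinity>"
    using nn_integral_PInf_AE[of G lborel] by (auto simp: less_top)
  have J: "set_integrable lborel S (\<lambda>s. \<sigma> s x) \<and>
     ennreal (\<bar>LINT s:S|lborel. \<sigma> s x\<bar> powr p) \<le> ennreal (B powr (p - 1)) * G x" if "G x < \<infinity>" for x
  proof -
    have eq: "indicator S s * ennreal (b' s powr (1 - p) * \<bar>\<sigma> s x\<bar> powr p) =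
       ennreal (indicator S s *\<^sub>R (b' s powr (1 - p) * \<bar>\<sigma> s x\<bar> powr p))" for s
      by (simp add: indicator_def)
    have Q: "set_integrable lborel S (\<lambda>s. b' s powr (1 - p) * \<bar>\<sigma> s x\<bar> powr p)"
      unfolding set_integrable_def using that
      by (intro integrableI_nonneg) (auto simp: G_def eq)
    have GQ: "G x = ennreal (LINT s:S|lborel. b' s powr (1 - p) * \<bar>\<sigma> s x\<bar> powr p)"
      using Q unfolding G_def eq set_lebesgue_integral_def set_integrable_def
      by (intro nn_integral_eq_integral) auto
    have "\<And>s. s \<in> S \<Longrightarrow> b' s > 0" using b' b(2) by simp
    note wJ = weighted_Jensen[OF p _ _ bI(1) this bI(2) B(2) Q]
    have "(LINT s:S|lborel. b' s powr (1 - p) * \<bar>\<sigma> s x\<bar> powr p) \<ge> 0"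
      unfolding set_lebesgue_integral_def by (rule integral_nonneg_AE) (rule AE_I2, simp)
    then show ?thesis
      unfolding GQ using wJ(1) ennreal_leI[OF wJ(2)] assms(2) by (simp add: ennreal_mult)
  qed
  show "AE x in lborel. set_integrable lborel S (\<lambda>s. \<sigma> s x)"
    using fin by eventually_elim (use J in blast)
  have "(\<integral>\<^sup>+x. ennreal (\<bar>LINT s:S|lborel. \<sigma> s x\<bar> powr p) \<partial>lborel) \<le> (\<integral>\<^sup>+x. ennreal (B powr (p - 1)) * G x \<partial>lborel)"
  proof (rule nn_integral_mono_AE)
    from fin show "AE x in lborel. ennreal (\<bar>LINT s:S|lborel. \<sigma> s x\<bar> powr p) \<le> ennreal (B powr (p - 1)) * G x"
      by eventually_elim (use J in blast)
  qed
  also have "\<dots> = ennreal (B powr (p - 1)) * (\<integral>\<^sup>+x. G x \<partial>lborel)"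
    by (rule nn_integral_cmult) simp
  also have "\<dots> \<le> ennreal (B powr (p - 1)) * ennreal B"
    by (intro mult_left_mono GB) simp
  also have "\<dots> = ennreal (B powr p)"
    using B(2) by (simp add: ennreal_mult[symmetric] powr_mult_base powr_diff)
  finally show "(\<integral>\<^sup>+x. ennreal (\<bar>LINT s:S|lborel. \<sigma> s x\<bar> powr p) \<partial>lborel) \<le> ennreal (B powr p)" .
qed

section \<open>Bump functions and Schwartz functions\<close>

text \<open>The powers of \<open>1/y\<close> are part of the family so that derivatives are linear
  combinations of its members; smoothness of \<open>exp (- 1 / y)\<close> at 0 then reduces to one
  limit for every \<open>j\<close>.\<close>

definition flat :: "nat \<Rightarrow> real \<Rightarrow> real" where
  "flat j y = (if y > 0 then exp (- (1 / y)) / y ^ j else 0)"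

lemma flat_tendsto_0: "(flat j \<longlongrightarrow> 0) (at 0)"
proof (rule filterlim_split_at)
  have "eventually (\<lambda>y. 0 = flat j y) (at_left 0)"
    unfolding eventually_at_left_field by (intro exI[of _ "-1"]) (auto simp: flat_def)
  then show "(flat j \<longlongrightarrow> 0) (at_left 0)"
    by (rule Lim_transform_eventually[OF tendsto_const])
  have "((\<lambda>y. inverse y ^ j / exp (inverse y)) \<longlongrightarrow> (0::real)) (at_right 0)"
    by (rule filterlim_compose[OF tendsto_power_div_exp_0 filterlim_inverse_at_top_right])
  moreover have "eventually (\<lambda>y. inverse y ^ j / exp (inverse y) = flat j y) (at_right 0)"
    unfolding eventually_at_right_field
    by (intro exI[of _ 1]) (auto simp: flat_def exp_minus field_simps)
  ultimately show "(flat j \<longlongrightarrow> 0) (at_right 0)"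
    by (rule Lim_transform_eventually)
qed

lemma flat_has_derivative:
  "(flat j has_real_derivative (flat (j + 2) y - real j * flat (Suc j) y)) (at y)"
proof -
  consider "y > 0" | "y < 0" | "y = 0" by linarith
  then show ?thesis
  proof cases
    case 1
    have "((\<lambda>y. exp (- (1 / y)) / y ^ j) has_real_derivative (flat (j + 2) y - real j * flat (Suc j) y)) (at y)"
    proof (cases j)
      case 0
      then show ?thesis
        using 1 by (auto intro!: derivative_eq_intros simp: flat_def field_simps power2_eq_square)
    next
      case (Suc i)
      then show ?thesis
        using 1 by (auto intro!: derivative_eq_intros simp: flat_def field_simps power2_eq_square)
          (cases i; simp)
    qed
    then show ?thesis
      by (rule has_field_derivative_transform_within_open[where S = "{0<..}"]) (use 1 in \<open>auto simp: flat_def\<close>)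
  next
    case 2
    have "((\<lambda>y. 0) has_real_derivative (flat (j + 2) y - real j * flat (Suc j) y)) (at y)"
      using 2 by (simp add: flat_def)
    then show ?thesis
      by (rule has_field_derivative_transform_within_open[where S = "{..<0}"]) (use 2 in \<open>auto simp: flat_def\<close>)
  next
    case 3
    \<comment> \<open>The difference quotient of \<open>flat j\<close> at 0 is
      \<open>flat (Suc j)\<close>, which tends to 0.\<close>
    have "((\<lambda>h. (flat j (0 + h) - flat j 0) / h) \<longlongrightarrow> 0) (at 0)"
      by (rule Lim_transform_eventually[OF flat_tendsto_0[of "Suc j"]])
         (auto simp: flat_def eventually_at_filter intro!: always_eventually)
    then show ?thesis using 3 by (simp add: DERIV_def flat_def)
  qed
qed

text \<open>Sums of polynomial multiples of \<open>flat j\<close> along a fixed polynomial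
  \<open>Y\<close>. One derivative stays in the class, so membership alone gives all derivatives and
  their vanishing where \<open>Y\<close> is not positive.\<close>

inductive bumpy :: "real poly \<Rightarrow> (real \<Rightarrow> real) \<Rightarrow> bool" for Y where
  base: "bumpy Y (\<lambda>t. poly Q t * flat j (poly Y t))"
| add: "bumpy Y f \<Longrightarrow> bumpy Y g \<Longrightarrow> bumpy Y (\<lambda>t. f t + g t)"

lemma bumpy_has_derivative:
  assumes "bumpy Y f"
  shows "\<exists>f'. bumpy Y f' \<and> (\<forall>t. (f has_real_derivative f' t) (at t))"
  using assms
proof induction
  case (base Q j)
  let ?R = "Q * pderiv Y"
  let ?f' = "\<lambda>t. poly (pderiv Q) t * flat j (poly Y t) +
     (poly ?R t * flat (j + 2) (poly Y t) + poly (smult (- real j) ?R) t * flat (Suc j) (poly Y t))"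
  have "((\<lambda>t. poly Q t * flat j (poly Y t)) has_real_derivative ?f' t) (at t)" for t
    by (auto intro!: derivative_eq_intros DERIV_chain'[OF _ flat_has_derivative] poly_DERIV simp: algebra_simps)
  moreover have "bumpy Y ?f'" by (intro bumpy.intros)
  ultimately show ?case by blast
next
  case (add f g)
  then obtain f' g' where "bumpy Y f'" "\<And>t. (f has_real_derivative f' t) (at t)"
    "bumpy Y g'" "\<And>t. (g has_real_derivative g' t) (at t)" by blast
  then show ?case
    by (intro exI[of _ "\<lambda>t. f' t + g' t"] conjI allI bumpy.add DERIV_add) auto
qed

lemma bumpy_deriv: "bumpy Y f \<Longrightarrow> bumpy Y ((deriv ^^ k) f)"
proof (induction k)
  case (Suc k)
  then obtain f' where "bumpy Y f'" "\<And>t. ((deriv ^^ k) f has_real_derivative f' t) (at t)"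
    using bumpy_has_derivative by blast
  moreover from this have "deriv ((deriv ^^ k) f) = f'" by (auto intro: DERIV_imp_deriv)
  ultimately show ?case by simp
qed simp

lemma bumpy_differentiable: "bumpy Y f \<Longrightarrow> f differentiable (at t)"
  using bumpy_has_derivative by (meson real_differentiable_def)

lemma bumpy_eq_0: "bumpy Y f \<Longrightarrow> poly Y t \<le> 0 \<Longrightarrow> f t = 0"
  by (induction rule: bumpy.induct) (auto simp: flat_def)

text \<open>Inside the interval the exponent is \<open>- 1 / (k (t - a) (b - t))\<close>, which
  tends to 0 as \<open>k\<close> grows: the bumps tend to the indicator of \<open>(a, b)\<close>
  while their support stays in \<open>[a, b]\<close>.\<close>

definition bump :: "real \<Rightarrow> real \<Rightarrow> nat \<Rightarrow> real \<Rightarrow> real" where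
  "bump a b k t = flat 0 (real k * ((t - a) * (b - t)))"

lemma bumpy_bump: "bumpy (smult (real k) ([:-a, 1:] * [:b, -1:])) (bump a b k)"
proof -
  have "bump a b k = (\<lambda>t. poly 1 t * flat 0 (poly (smult (real k) ([:-a, 1:] * [:b, -1:])) t))"
    by (rule ext) (simp add: bump_def algebra_simps)
  then show ?thesis using bumpy.base by metis
qed

lemma bump_deriv_differentiable: "(deriv ^^ j) (bump a b k) differentiable (at t)"
  by (rule bumpy_differentiable[OF bumpy_deriv[OF bumpy_bump]])

lemma bump_deriv_eq_0:
  assumes "a < b" "t \<notin> {a<..<b}"
  shows "(deriv ^^ j) (bump a b k) t = 0"
proof (rule bumpy_eq_0[OF bumpy_deriv[OF bumpy_bump]])
  have "(t - a) * (b - t) \<le> 0"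
    using assms by (cases "t \<le> a") (auto simp: mult_le_0_iff)
  then have "real k * ((t - a) * (b - t)) \<le> 0" by (rule mult_nonneg_nonpos[rotated]) simp
  moreover have "poly (smult (real k) ([:-a, 1:] * [:b, -1:])) t = real k * ((t - a) * (b - t))"
    by (simp add: algebra_simps)
  ultimately show "poly (smult (real k) ([:-a, 1:] * [:b, -1:])) t \<le> 0" by linarith
qed

lemma bump_bounds: "0 \<le> bump a b k t" "bump a b k t \<le> 1"
  by (auto simp: bump_def flat_def)

lemma bump_tendsto_indicator:
  assumes "a < b"
  shows "(\<lambda>k. bump a b k t) \<longlonglongrightarrow> indicator {a<..<b} t"
proof (cases "t \<in> {a<..<b}")
  case True
  then have p: "(t - a) * (b - t) > 0" by simp
  have "(\<lambda>k. exp (- ((1 / ((t - a) * (b - t))) * (1 / real k)))) \<longlonglongrightarrow> exp (- ((1 / ((t - a) * (b - t))) * 0))"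
    by (intro tendsto_intros lim_1_over_n)
  moreover have "eventually (\<lambda>k. exp (- ((1 / ((t - a) * (b - t))) * (1 / real k))) = bump a b k t) sequentially"
    using eventually_gt_at_top[of 0]
    by eventually_elim (use p in \<open>auto simp: bump_def flat_def mult_ac zero_less_mult_iff\<close>)
  ultimately show ?thesis using True by (auto intro: Lim_transform_eventually)
next
  case False
  then have "bump a b k t = 0" for k using bump_deriv_eq_0[OF assms, of t 0 k] by simp
  then show ?thesis using False by simp
qed

lemma time_test_bump:
  assumes "0 < a" "a < b"
  shows "time_test (bump a b k)"
proof -
  have "bump a b k t = 0" if "t \<notin> {a..b}" for t
  proof -
    have "t \<notin> {a<..<b}" using that by auto
    from bump_deriv_eq_0[where j = 0, OF assms(2) this] show ?thesis by simp
  qed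
  then show ?thesis
    unfolding time_test_def using assms(1) bump_deriv_differentiable by blast
qed

section \<open>Test functions of several variables as products\<close>

definition tensor :: "('n::finite \<Rightarrow> real \<Rightarrow> real) \<Rightarrow> real^'n \<Rightarrow> real" where
  "tensor \<psi> x = (\<Prod>i\<in>UNIV. \<psi> i (x $ i))"

lemma tensor_has_derivative:
  fixes \<psi> :: "'n::finite \<Rightarrow> real \<Rightarrow> real"
  assumes "\<And>i t. \<psi> i differentiable (at t)"
  shows "(tensor \<psi> has_derivative (\<lambda>h. \<Sum>i\<in>UNIV. (h $ i * deriv (\<psi> i) (x $ i)) * (\<Prod>j\<in>UNIV - {i}. \<psi> j (x $ j)))) (at x)"
  unfolding tensor_def
proof (rule has_derivative_prod)
  fix i :: 'n
  have "(\<psi> i has_real_derivative deriv (\<psi> i) (x $ i)) (at (x $ i))"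
    using assms by (simp add: DERIV_deriv_iff_real_differentiable)
  then have "(\<psi> i has_derivative (\<lambda>h. h * deriv (\<psi> i) (x $ i))) (at (x $ i))"
    unfolding has_field_derivative_def by (rule has_derivative_eq_rhs) (simp add: fun_eq_iff)
  moreover have "((\<lambda>x :: real^'n. x $ i) has_derivative (\<lambda>h. h $ i)) (at x)"
    by (rule bounded_linear_imp_has_derivative[OF bounded_linear_vec_nth])
  ultimately show "((\<lambda>x. \<psi> i (x $ i)) has_derivative (\<lambda>h. h $ i * deriv (\<psi> i) (x $ i))) (at x)"
    by (rule has_derivative_compose[rotated])
qed

lemma partial_tensor:
  fixes \<psi> :: "'n::finite \<Rightarrow> real \<Rightarrow> real"
  assumes "\<And>i t. \<psi> i differentiable (at t)"
  shows "partial i (tensor \<psi>) = tensor (\<psi>(i := deriv (\<psi> i)))"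
proof
  fix x :: "real^'n"
  have "partial i (tensor \<psi>) x = (\<Sum>j\<in>UNIV. (axis i 1 $ j * deriv (\<psi> j) (x $ j)) * (\<Prod>k\<in>UNIV - {j}. \<psi> k (x $ k)))"
    unfolding partial_def frechet_derivative_at[OF tensor_has_derivative[OF assms], symmetric] ..
  also have "\<dots> = (\<Sum>j\<in>UNIV. if j = i then deriv (\<psi> j) (x $ j) * (\<Prod>k\<in>UNIV - {j}. \<psi> k (x $ k)) else 0)"
    by (intro sum.cong) (auto simp: axis_def)
  also have "\<dots> = deriv (\<psi> i) (x $ i) * (\<Prod>k\<in>UNIV - {i}. \<psi> k (x $ k))"
    by simp
  also have "\<dots> = tensor (\<psi>(i := deriv (\<psi> i))) x"
    unfolding tensor_def by (subst prod.remove[of UNIV i]) (auto intro!: prod.cong)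
  finally show "partial i (tensor \<psi>) x = tensor (\<psi>(i := deriv (\<psi> i))) x" .
qed

text \<open>A partial derivative acts on a single factor, so only the number of occurrences of each
  coordinate in the list matters.\<close>

lemma foldr_partial_tensor:
  fixes \<psi> :: "'n::finite \<Rightarrow> real \<Rightarrow> real"
  assumes "\<And>i k t. (deriv ^^ k) (\<psi> i) differentiable (at t)"
  shows "foldr partial is (tensor \<psi>) = tensor (\<lambda>i. (deriv ^^ count_list is i) (\<psi> i))"
proof (induction "is")
  case (Cons i "is")
  have "(\<lambda>i. (deriv ^^ count_list is i) (\<psi> i))(i := deriv ((deriv ^^ count_list is i) (\<psi> i))) =
    (\<lambda>j. (deriv ^^ count_list (i # is) j) (\<psi> j))" by auto
  then show ?case using Cons partial_tensor[of "\<lambda>i. (deriv ^^ count_list is i) (\<psi> i)" i] assms by simp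
qed simp

lemma schwartz_tensor:
  fixes \<psi> :: "'n::finite \<Rightarrow> real \<Rightarrow> real"
  assumes diff: "\<And>i k t. (deriv ^^ k) (\<psi> i) differentiable (at t)"
    and supp: "\<And>i k t. t \<notin> {a $ i<..<b $ i} \<Longrightarrow> (deriv ^^ k) (\<psi> i) t = 0"
  shows "schwartz (tensor \<psi>)"
  unfolding schwartz_def foldr_partial_tensor[OF diff]
proof (intro allI conjI)
  fix "is" :: "'n list" and x :: "real^'n" and N :: nat
  let ?\<psi> = "\<lambda>i. (deriv ^^ count_list is i) (\<psi> i)"
  show d: "tensor ?\<psi> differentiable (at x)" for x
    using tensor_has_derivative[of ?\<psi> x] diff by (auto simp: differentiable_def)
  have z: "tensor ?\<psi> x = 0" if "x \<notin> cbox a b" for x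
  proof -
    from that obtain i where "\<not> (a $ i \<le> x $ i \<and> x $ i \<le> b $ i)" unfolding mem_box_cart by blast
    then have "x $ i \<notin> {a $ i<..<b $ i}" by auto
    then have "?\<psi> i (x $ i) = 0" by (rule supp)
    then show ?thesis unfolding tensor_def by (intro prod_zero) auto
  qed
  have "continuous_on UNIV (tensor ?\<psi>)"
    using d by (intro differentiable_imp_continuous_on) (auto simp: differentiable_on_def differentiable_at_withinI)
  then have "continuous_on (cbox a b) (\<lambda>x. (1 + norm x) ^ N * tensor ?\<psi> x)"
    by (intro continuous_intros) (auto intro: continuous_on_subset)
  then have "bounded ((\<lambda>x. (1 + norm x) ^ N * tensor ?\<psi> x) ` cbox a b)"
    by (intro compact_imp_bounded compact_continuous_image compact_cbox)
  then have "bounded (insert 0 ((\<lambda>x. (1 + norm x) ^ N * tensor ?\<psi> x) ` cbox a b))" by simp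
  then show "bounded (range (\<lambda>x. (1 + norm x) ^ N * tensor ?\<psi> x))"
    by (rule bounded_subset) (use z in force)
qed

section \<open>Decay, translation and integrability of Schwartz functions\<close>

lemma schwartz_differentiable: "schwartz \<phi> \<Longrightarrow> \<phi> differentiable (at x)"
  unfolding schwartz_def by (metis foldr_Nil id_apply)

lemma schwartz_continuous: "schwartz \<phi> \<Longrightarrow> continuous_on UNIV \<phi>"
  using schwartz_differentiable
  by (intro differentiable_imp_continuous_on) (auto simp: differentiable_on_def differentiable_at_withinI)

lemma schwartz_measurable[measurable_dest]: "schwartz \<phi> \<Longrightarrow> \<phi> \<in> borel_measurable borel"
  by (intro borel_measurable_continuous_onI schwartz_continuous)

lemma abs_weight_mult: "\<bar>(1 + norm x) ^ N * a\<bar> = (1 + norm x) ^ N * \<bar>a :: real\<bar>"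
  unfolding abs_mult by (subst abs_of_nonneg) auto

lemma schwartz_decay:
  assumes "schwartz \<phi>"
  obtains C where "\<And>x. (1 + norm x) ^ N * \<bar>\<phi> x\<bar> \<le> C" "C \<ge> 0"
proof -
  have "bounded (range (\<lambda>x. (1 + norm x) ^ N * \<phi> x))"
  proof -
    have "bounded (range (\<lambda>x. (1 + norm x) ^ N * foldr partial [] \<phi> x))"
      using assms unfolding schwartz_def by blast
    then show ?thesis by simp
  qed
  then obtain C where "\<And>x. \<bar>(1 + norm x) ^ N * \<phi> x\<bar> \<le> C"
    unfolding bounded_iff real_norm_def by blast
  then have C: "(1 + norm x) ^ N * \<bar>\<phi> x\<bar> \<le> C" for x unfolding abs_weight_mult .
  have "0 \<le> (1 + norm (0::real^'a)) ^ N * \<bar>\<phi> 0\<bar>" by simp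
  also have "\<dots> \<le> C" by (rule C)
  finally show ?thesis using that C by blast
qed

lemma schwartz_translate:
  fixes \<phi> :: "real^'n::finite \<Rightarrow> real"
  assumes \<phi>: "schwartz \<phi>"
  shows "schwartz (\<lambda>x. \<phi> (x + y))"
proof -
  have partial: "partial i (\<lambda>x. \<psi> (x + y)) x = partial i \<psi> (x + y) \<and> (\<lambda>x. \<psi> (x + y)) differentiable (at x)"
    if "\<And>x. \<psi> differentiable (at x)" for \<psi> :: "real^'n \<Rightarrow> real" and i x
  proof -
    have "(\<psi> has_derivative frechet_derivative \<psi> (at (x + y))) (at (x + y))"
      using that frechet_derivative_works by blast
    moreover have "((\<lambda>x. x + y) has_derivative (\<lambda>h. h)) (at x)" by (auto intro!: derivative_eq_intros)
    ultimately have *: "((\<lambda>x. \<psi> (x + y)) has_derivative frechet_derivative \<psi> (at (x + y))) (at x)"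
      using has_derivative_compose[of "\<lambda>x. x + y" "\<lambda>h. h" x UNIV \<psi>] by simp
    then show ?thesis
      unfolding partial_def frechet_derivative_at[OF *, symmetric] by (auto simp: differentiable_def)
  qed
  have d: "foldr partial is \<phi> differentiable (at x)" for "is" x
    using \<phi> by (auto simp: schwartz_def)
  have eq: "foldr partial is (\<lambda>x. \<phi> (x + y)) = (\<lambda>x. foldr partial is \<phi> (x + y))" for "is"
  proof (induction "is")
    case (Cons i "is")
    then show ?case using partial[OF d] by auto
  qed simp
  show ?thesis
    unfolding schwartz_def eq
  proof (intro allI conjI)
    fix "is" :: "'n list" and x :: "real^'n" and N :: nat
    show "(\<lambda>x. foldr partial is \<phi> (x + y)) differentiable (at x)" using partial[OF d] by blast
    obtain C where C: "\<And>x. \<bar>(1 + norm x) ^ N * foldr partial is \<phi> x\<bar> \<le> C"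
    proof -
      have "bounded (range (\<lambda>x. (1 + norm x) ^ N * foldr partial is \<phi> x))"
        using \<phi> by (auto simp: schwartz_def)
      then show ?thesis using that unfolding bounded_iff real_norm_def by blast
    qed
    have "\<bar>(1 + norm x) ^ N * foldr partial is \<phi> (x + y)\<bar> \<le> (1 + norm y) ^ N * C" for x
    proof -
      have "norm x \<le> norm (x + y) + norm y" using norm_triangle_ineq[of "x + y" "- y"] by simp
      \<comment> \<open>The weight at \<open>x\<close> is at most the weight at \<open>x + y\<close>
        times a factor that depends on \<open>y\<close> only.\<close>
      then have "1 + norm x \<le> (1 + norm y) * (1 + norm (x + y))"
      proof -
        have "0 \<le> norm y * norm (x + y)" by simp
        moreover have "(1 + norm y) * (1 + norm (x + y)) = 1 + norm y + norm (x + y) + norm y * norm (x + y)"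
          by (simp add: algebra_simps)
        ultimately show ?thesis using \<open>norm x \<le> norm (x + y) + norm y\<close> by linarith
      qed
      then have "(1 + norm x) ^ N \<le> (1 + norm y) ^ N * (1 + norm (x + y)) ^ N"
        unfolding power_mult_distrib[symmetric] by (intro power_mono) auto
      then have "(1 + norm x) ^ N * \<bar>foldr partial is \<phi> (x + y)\<bar> \<le>
          (1 + norm y) ^ N * (1 + norm (x + y)) ^ N * \<bar>foldr partial is \<phi> (x + y)\<bar>"
        by (rule mult_right_mono) simp
      also have "\<dots> = (1 + norm y) ^ N * \<bar>(1 + norm (x + y)) ^ N * foldr partial is \<phi> (x + y)\<bar>"
        unfolding abs_weight_mult by simp
      also have "\<dots> \<le> (1 + norm y) ^ N * C" by (intro mult_left_mono C) simp
      finally show ?thesis unfolding abs_weight_mult .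
    qed
    then show "bounded (range (\<lambda>x. (1 + norm x) ^ N * foldr partial is \<phi> (x + y)))"
      unfolding bounded_iff real_norm_def by blast
  qed
qed

text \<open>A point with \<open>k \<le> |x| \<le> k + 1\<close> lies in a cube of volume
  \<open>(2 (k + 1))^n\<close>, and there the integrand is at most \<open>(k + 1)^(-n-2)\<close>.
  The exponent leaves the convergent series of \<open>1 / (k + 1)^2\<close>. Nested cubes replace
  shells because their volume is explicit.\<close>

lemma nn_integral_inverse_power_finite:
  "(\<integral>\<^sup>+x. ennreal (inverse ((1 + norm (x :: 'a::euclidean_space)) ^ (DIM('a) + 2))) \<partial>lborel) < \<infinity>"
proof -
  let ?N = "DIM('a) + 2"
  let ?c = "\<lambda>k. (2 * real (Suc k)) ^ DIM('a)"
  have "(\<integral>\<^sup>+x. ennreal (inverse ((1 + norm (x :: 'a)) ^ ?N)) \<partial>lborel) \<le>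
     (\<integral>\<^sup>+x. (\<Sum>k. ennreal (inverse (real (Suc k) ^ ?N)) *
        indicator (cbox (- real (Suc k) *\<^sub>R One) (real (Suc k) *\<^sub>R One) :: 'a set) x) \<partial>lborel)"
  proof (rule nn_integral_mono)
    fix x :: 'a
    define k where "k = nat \<lfloor>norm x\<rfloor>"
    have k: "real k \<le> norm x" "norm x \<le> real (Suc k)" unfolding k_def by (simp_all, linarith+)
    have "x \<in> cbox (- real (Suc k) *\<^sub>R One) (real (Suc k) *\<^sub>R One)"
      unfolding mem_box
    proof
      fix i :: 'a assume i: "i \<in> Basis"
      have "\<bar>x \<bullet> i\<bar> \<le> real (Suc k)" using Basis_le_norm[OF i, of x] k(2) by linarith
      then show "(- real (Suc k) *\<^sub>R One) \<bullet> i \<le> x \<bullet> i \<and> x \<bullet> i \<le> (real (Suc k) *\<^sub>R One) \<bullet> i"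
        using i by (auto simp: inner_sum_left inner_Basis)
    qed
    moreover have "ennreal (inverse ((1 + norm x) ^ ?N)) \<le> ennreal (inverse (real (Suc k) ^ ?N))"
      using k(1) by (intro ennreal_leI le_imp_inverse_le power_mono) auto
    ultimately have "ennreal (inverse ((1 + norm x) ^ ?N)) \<le> ennreal (inverse (real (Suc k) ^ ?N)) *
        indicator (cbox (- real (Suc k) *\<^sub>R One) (real (Suc k) *\<^sub>R One) :: 'a set) x"
      by simp
    also have "\<dots> \<le> (\<Sum>k. ennreal (inverse (real (Suc k) ^ ?N)) *
        indicator (cbox (- real (Suc k) *\<^sub>R One) (real (Suc k) *\<^sub>R One) :: 'a set) x)"
      (is "?G k \<le> suminf ?G")
    proof -
      have "G k \<le> suminf G" for G :: "nat \<Rightarrow> ennreal" using sum_le_suminf[of G "{k}"] by simp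
      then show ?thesis .
    qed
    finally show "ennreal (inverse ((1 + norm x) ^ ?N)) \<le> (\<Sum>k. ennreal (inverse (real (Suc k) ^ ?N)) *
        indicator (cbox (- real (Suc k) *\<^sub>R One) (real (Suc k) *\<^sub>R One) :: 'a set) x)" .
  qed
  also have "\<dots> = (\<Sum>k. ennreal (inverse (real (Suc k) ^ ?N)) *
      emeasure lborel (cbox (- real (Suc k) *\<^sub>R One) (real (Suc k) *\<^sub>R One) :: 'a set))"
    by (subst nn_integral_suminf) (auto simp: nn_integral_cmult_indicator)
  also have "\<dots> = (\<Sum>k. ennreal (2 ^ DIM('a) * (1 / (real (Suc k))\<^sup>2)))"
  proof (rule suminf_cong)
    fix k
    have "emeasure lborel (cbox (- real (Suc k) *\<^sub>R One) (real (Suc k) *\<^sub>R One) :: 'a set) = ennreal (?c k)"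
      by (subst emeasure_lborel_cbox) (auto simp: inner_sum_left inner_Basis inner_diff_left)
    moreover have "inverse (real (Suc k) ^ ?N) * ?c k = 2 ^ DIM('a) * (1 / (real (Suc k))\<^sup>2)"
      by (simp add: power_mult_distrib power_add field_simps power2_eq_square del: of_nat_Suc)
    ultimately show "ennreal (inverse (real (Suc k) ^ ?N)) *
      emeasure lborel (cbox (- real (Suc k) *\<^sub>R One) (real (Suc k) *\<^sub>R One) :: 'a set) =
      ennreal (2 ^ DIM('a) * (1 / (real (Suc k))\<^sup>2))"
      by (metis ennreal_mult' inverse_nonnegative_iff_nonnegative of_nat_0_le_iff zero_le_power)
  qed
  also have "\<dots> < \<infinity>"
  proof -
    have "summable (\<lambda>k. 1 / (real (Suc k))\<^sup>2)"
      using inverse_power_summable[of 2, where 'a=real] by (subst summable_Suc_iff) (simp add: inverse_eq_divide)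
    then have "summable (\<lambda>k. 2 ^ DIM('a) * (1 / (real (Suc k))\<^sup>2))" by (rule summable_mult)
    then show ?thesis by (subst suminf_ennreal2) auto
  qed
  finally show ?thesis .
qed

lemma schwartz_integrable:
  assumes \<phi>: "schwartz (\<phi> :: real^'n::finite \<Rightarrow> real)"
  shows "integrable lborel \<phi>"
proof -
  let ?N = "DIM(real^'n) + 2"
  obtain C where C: "\<And>x. (1 + norm x) ^ ?N * \<bar>\<phi> x\<bar> \<le> C" "C \<ge> 0" using schwartz_decay[OF \<phi>] by blast
  have [measurable]: "\<phi> \<in> borel_measurable borel" using \<phi> by measurable
  show ?thesis
  proof (rule Bochner_Integration.integrable_bound)
    have "integrable lborel (\<lambda>x::real^'n. inverse ((1 + norm x) ^ ?N))"
      using nn_integral_inverse_power_finite[where 'a = "real^'n"] by (intro integrableI_nonneg) auto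
    then show "integrable lborel (\<lambda>x::real^'n. C * inverse ((1 + norm x) ^ ?N))" by simp
    show "AE x in lborel. norm (\<phi> x) \<le> norm (C * inverse ((1 + norm x) ^ ?N))"
    proof (rule AE_I2)
      fix x :: "real^'n"
      have pos: "(1 + norm x) ^ ?N > 0" by (intro zero_less_power add_pos_nonneg) auto
      have "\<bar>\<phi> x\<bar> \<le> C * inverse ((1 + norm x) ^ ?N)"
        using C(1)[of x] pos by (simp add: inverse_eq_divide pos_le_divide_eq mult.commute)
      then show "norm (\<phi> x) \<le> norm (C * inverse ((1 + norm x) ^ ?N))" by simp
    qed
  qed simp
qed

section \<open>Functions determined by their pairings with test functions\<close>

definition box_bump :: "real^'n::finite \<Rightarrow> real^'n \<Rightarrow> nat \<Rightarrow> real^'n \<Rightarrow> real" where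
  "box_bump a b k = tensor (\<lambda>i. bump (a $ i) (b $ i) k)"

lemma schwartz_box_bump:
  assumes "\<And>i. a $ i < b $ i"
  shows "schwartz (box_bump a b k)"
  unfolding box_bump_def
proof (rule schwartz_tensor[where a = a and b = b])
  show "(deriv ^^ j) (bump (a $ i) (b $ i) k) t = 0" if "t \<notin> {a $ i<..<b $ i}" for i j t
    by (rule bump_deriv_eq_0[OF assms that])
qed (rule bump_deriv_differentiable)

lemma box_bump_bounds: "0 \<le> box_bump a b k x" "box_bump a b k x \<le> 1"
  unfolding box_bump_def tensor_def by (auto intro!: prod_nonneg prod_le_1 simp: bump_bounds)

lemma box_bump_tendsto_indicator:
  assumes "\<And>i. a $ i < b $ i"
  shows "(\<lambda>k. box_bump a b k x) \<longlonglongrightarrow> indicator (box a b) x"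
proof -
  have "(\<lambda>k. box_bump a b k x) \<longlonglongrightarrow> (\<Prod>i\<in>UNIV. indicator {a $ i<..<b $ i} (x $ i))"
    unfolding box_bump_def tensor_def by (intro tendsto_prod bump_tendsto_indicator assms)
  also have "(\<Prod>i\<in>UNIV. indicator {a $ i<..<b $ i} (x $ i)) = (indicator (box a b) x :: real)"
    by (auto simp: indicator_def mem_box_cart)
  finally show ?thesis .
qed

lemma box_bump_eq_0:
  assumes "\<And>i. a $ i < b $ i" "x \<notin> cbox a b"
  shows "box_bump a b k x = 0"
proof -
  from assms(2) obtain i where "\<not> (a $ i \<le> x $ i \<and> x $ i \<le> b $ i)" unfolding mem_box_cart by blast
  then have "x $ i \<notin> {a $ i<..<b $ i}" by auto
  from bump_deriv_eq_0[where j = 0, OF assms(1) this] show ?thesis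
    unfolding box_bump_def tensor_def by (intro prod_zero) auto
qed

lemma dist_of_box_bump_tendsto:
  fixes w :: "real^'n::finite \<Rightarrow> real"
  assumes w: "set_integrable lborel (cbox a b) w" and [measurable]: "w \<in> borel_measurable lborel"
    and ab: "\<And>i. a $ i < b $ i"
  shows "(\<lambda>k. dist_of w (box_bump a b k)) \<longlonglongrightarrow> (LINT x:cbox a b|lborel. w x)"
proof -
  have [measurable]: "box_bump a b k \<in> borel_measurable borel" for k
    by (rule schwartz_measurable[OF schwartz_box_bump[OF ab]])
  have "(\<lambda>k. LINT x|lborel. w x * box_bump a b k x) \<longlonglongrightarrow> (LINT x|lborel. w x * indicator (box a b) x)"
  proof (rule integral_dominated_convergence)
    show "integrable lborel (\<lambda>x. \<bar>indicator (cbox a b) x * w x\<bar>)"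
      using w unfolding set_integrable_def by (intro integrable_abs) simp
    show "AE x in lborel. (\<lambda>k. w x * box_bump a b k x) \<longlonglongrightarrow> w x * indicator (box a b) x"
      by (intro AE_I2 tendsto_mult tendsto_const box_bump_tendsto_indicator ab)
    show "AE x in lborel. norm (w x * box_bump a b k x) \<le> \<bar>indicator (cbox a b) x * w x\<bar>" for k
    proof (rule AE_I2)
      fix x
      show "norm (w x * box_bump a b k x) \<le> \<bar>indicator (cbox a b) x * w x\<bar>"
        using box_bump_bounds[of a b k x] box_bump_eq_0[OF ab, of x k]
        by (cases "x \<in> cbox a b") (auto simp: abs_mult mult_left_le)
    qed
  qed auto
  \<comment> \<open>The bumps converge to the indicator of the open box; the frontier is a null
    set.\<close>
  also have "(LINT x|lborel. w x * indicator (box a b) x) = (LINT x:cbox a b|lborel. w x)"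
    unfolding set_lebesgue_integral_def
  proof (rule integral_cong_AE)
    have "negligible (cbox a b - box a b)" by (rule negligible_frontier_interval)
    then have "AE x in lborel. x \<notin> cbox a b - box a b"
      by (intro AE_not_in) (simp add: negligible_iff_null_sets null_sets_completion_iff)
    then show "AE x in lborel. w x * indicator (box a b) x = indicat_real (cbox a b) x *\<^sub>R w x"
      by eventually_elim (use box_subset_cbox[of a b] in \<open>auto simp: indicator_def\<close>)
  qed auto
  finally show ?thesis unfolding dist_of_def .
qed

text \<open>A box with some \<open>a $ i \<ge> b $ i\<close> admits no approximating bumps, but it
  is a null set.\<close>

lemma cbox_integral_degenerate:
  fixes w :: "real^'n::finite \<Rightarrow> real"
  assumes "\<not> (\<forall>i. a $ i < b $ i)"
  shows "(LINT x:cbox a b|lborel. w x) = 0"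
proof -
  have "box a b = {}" using assms by (auto simp: interval_eq_empty_cart not_less)
  then have "cbox a b \<in> null_sets lborel"
    using negligible_interval(1)[of a b] by (simp add: negligible_iff_null_sets null_sets_completion_iff)
  then have "AE x in lborel. x \<notin> cbox a b" by (rule AE_not_in)
  then have "AE x in lborel. indicat_real (cbox a b) x *\<^sub>R w x = 0" by eventually_elim simp
  then show ?thesis unfolding set_lebesgue_integral_def by (rule integral_eq_zero_AE)
qed

lemma AE_zero_if_dist_of_zero:
  fixes w :: "real^'n::finite \<Rightarrow> real"
  assumes int: "\<And>a b. set_integrable lborel (cbox a b) w" and meas: "w \<in> borel_measurable lborel"
    and zero: "\<And>\<phi>. schwartz \<phi> \<Longrightarrow> dist_of w \<phi> = 0"
  shows "AE x in lborel. w x = 0"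
proof (rule AE_zero_if_cbox_integrals_zero[OF int])
  show "(LINT x:cbox a b|lborel. w x) = 0" for a b
  proof (cases "\<forall>i. a $ i < b $ i")
    case True
    then have "(\<lambda>k. 0 :: real) \<longlonglongrightarrow> (LINT x:cbox a b|lborel. w x)"
      using dist_of_box_bump_tendsto[OF int meas, of a b] zero[OF schwartz_box_bump[of a b]] by simp
    then show ?thesis by (simp add: LIMSEQ_const_iff)
  qed (rule cbox_integral_degenerate)
qed

text \<open>Pairings with test functions are all that is known to be measurable in the parameter.
  The box integrals that \<open>jointly_measurable_representative\<close> asks for are limits of
  them.\<close>

lemma cbox_integral_measurable:
  fixes w :: "'a \<Rightarrow> real^'n::finite \<Rightarrow> real"
  assumes int: "\<And>a. a \<in> space M \<Longrightarrow> set_integrable lborel (cbox b c) (w a)"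
    and meas: "\<And>a. a \<in> space M \<Longrightarrow> w a \<in> borel_measurable lborel"
    and M: "\<And>\<phi>. schwartz \<phi> \<Longrightarrow> (\<lambda>a. dist_of (w a) \<phi>) \<in> borel_measurable M"
  shows "(\<lambda>a. LINT y:cbox b c|lborel. w a y) \<in> borel_measurable M"
proof (cases "\<forall>i. b $ i < c $ i")
  case True
  show ?thesis
    by (rule borel_measurable_LIMSEQ_real[OF dist_of_box_bump_tendsto])
       (use True int meas in \<open>auto intro!: M schwartz_box_bump\<close>)
next
  case False
  then show ?thesis by (simp add: cbox_integral_degenerate)
qed

section \<open>Bounds in Lebesgue spaces\<close>

text \<open>Convexity of the power with the weights \<open>A / (A + B)\<close> and
  \<open>B / (A + B)\<close>. They are chosen so that integration, with \<open>|a|^p\<close> and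
  \<open>|b|^p\<close> contributing at most \<open>A^p\<close> and \<open>B^p\<close>, returns
  exactly \<open>(A + B)^p\<close>: Minkowski's inequality for prescribed bounds.\<close>

lemma powr_add_weighted_le:
  fixes a b A B p :: real
  assumes p: "p \<ge> 1" and A: "A > 0" and B: "B > 0"
  shows "\<bar>a + b\<bar> powr p \<le> (A + B) powr (p - 1) * (A powr (1 - p) * \<bar>a\<bar> powr p + B powr (1 - p) * \<bar>b\<bar> powr p)"
proof -
  have AB: "A + B > 0" using assms by simp
  have one: "1 \<le> (A + B) powr (p - 1) * E powr (1 - p)" if "E > 0" "E \<le> A + B" for E
  proof -
    have "E powr (p - 1) \<le> (A + B) powr (p - 1)" using that p by (intro powr_mono2) auto
    then have "E powr (p - 1) * E powr (1 - p) \<le> (A + B) powr (p - 1) * E powr (1 - p)"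
      by (rule mult_right_mono) simp
    then show ?thesis using that by (simp add: powr_add[symmetric])
  qed
  consider "a = 0" | "b = 0" | "a \<noteq> 0" "b \<noteq> 0" by blast
  then show ?thesis
  proof cases
    case 1
    have "\<bar>b\<bar> powr p \<le> ((A + B) powr (p - 1) * B powr (1 - p)) * \<bar>b\<bar> powr p"
      using mult_right_mono[OF one[of B], of "\<bar>b\<bar> powr p"] A B by simp
    then show ?thesis using 1 p by (simp add: mult.assoc)
  next
    case 2
    have "\<bar>a\<bar> powr p \<le> ((A + B) powr (p - 1) * A powr (1 - p)) * \<bar>a\<bar> powr p"
      using mult_right_mono[OF one[of A], of "\<bar>a\<bar> powr p"] A B by simp
    then show ?thesis using 2 p by (simp add: mult.assoc)
  next
    case 3
    have "\<bar>a + b\<bar> powr p \<le> (\<bar>a\<bar> + \<bar>b\<bar>) powr p" using assms by (intro powr_mono2) auto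
    also have "\<bar>a\<bar> + \<bar>b\<bar> = (A + B) * ((A / (A + B)) *\<^sub>R (\<bar>a\<bar> / A) + (B / (A + B)) *\<^sub>R (\<bar>b\<bar> / B))"
      using assms AB by (simp add: distrib_left)
    also have "\<dots> powr p = (A + B) powr p * ((A / (A + B)) *\<^sub>R (\<bar>a\<bar> / A) + (B / (A + B)) *\<^sub>R (\<bar>b\<bar> / B)) powr p"
      by (rule powr_mult)
    also have "\<dots> \<le> (A + B) powr p * ((A / (A + B)) * (\<bar>a\<bar> / A) powr p + (B / (A + B)) * (\<bar>b\<bar> / B) powr p)"
    proof (rule mult_left_mono)
      have e: "A / (A + B) = 1 - B / (A + B)" using AB by (simp add: field_simps)
      show "((A / (A + B)) *\<^sub>R (\<bar>a\<bar> / A) + (B / (A + B)) *\<^sub>R (\<bar>b\<bar> / B)) powr p \<le>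
          (A / (A + B)) * (\<bar>a\<bar> / A) powr p + (B / (A + B)) * (\<bar>b\<bar> / B) powr p"
        unfolding e by (rule convex_onD[OF powr_convex[OF p]]) (use 3 A B in auto)
    qed simp
    also have "\<dots> = (A + B) powr (p - 1) * (A powr (1 - p) * \<bar>a\<bar> powr p + B powr (1 - p) * \<bar>b\<bar> powr p)"
    proof -
      have "A / (A + B) * (\<bar>a\<bar> / A) powr p = A powr (1 - p) * \<bar>a\<bar> powr p / (A + B)"
        "B / (A + B) * (\<bar>b\<bar> / B) powr p = B powr (1 - p) * \<bar>b\<bar> powr p / (A + B)"
        using assms by (simp_all add: powr_divide powr_diff)
      moreover have "(A + B) powr p = (A + B) powr (p - 1) * (A + B)"
        using AB by (simp add: powr_diff)
      moreover have "c * (A + B) * (X / (A + B) + Y / (A + B)) = c * (X + Y)" for c X Y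
        using AB by (simp add: add_divide_distrib[symmetric])
      ultimately show ?thesis by metis
    qed
    finally show ?thesis .
  qed
qed

text \<open>For \<open>p = 1\<close> this bounds the norms in all \<open>L\<^sup>r\<close> at once, so that the nonlinear
  estimates do not depend on \<open>r\<close>.\<close>

definition Lbd :: "real \<Rightarrow> ('a::euclidean_space \<Rightarrow> real) \<Rightarrow> real \<Rightarrow> bool" where
  "Lbd p w B \<longleftrightarrow> w \<in> borel_measurable borel \<and> 0 \<le> B \<and> (AE x in lborel. \<bar>w x\<bar> \<le> B) \<and>
     (\<integral>\<^sup>+x. ennreal (\<bar>w x\<bar> powr p) \<partial>lborel) \<le> ennreal (B powr p)"

lemma Lbd_zero[simp]: "Lbd p (\<lambda>_. 0) 0"
  by (simp add: Lbd_def)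

lemma Lbd_mono:
  assumes "Lbd p w A" "A \<le> B" "p \<ge> 0"
  shows "Lbd p w B"
proof -
  have "ennreal (A powr p) \<le> ennreal (B powr p)"
    using assms by (intro ennreal_leI powr_mono2) (auto simp: Lbd_def)
  moreover have "AE x in lborel. \<bar>w x\<bar> \<le> B" if "AE x in lborel. \<bar>w x\<bar> \<le> A"
    using that by eventually_elim (use assms in linarith)
  ultimately show ?thesis using assms by (auto simp: Lbd_def intro: order_trans)
qed

lemma Lbd_AE_dominated:
  assumes "Lbd p w A" "v \<in> borel_measurable borel" "AE x in lborel. \<bar>v x\<bar> \<le> \<bar>w x\<bar>" "p \<ge> 0"
  shows "Lbd p v A"
proof -
  have "(\<integral>\<^sup>+x. ennreal (\<bar>v x\<bar> powr p) \<partial>lborel) \<le> (\<integral>\<^sup>+x. ennreal (\<bar>w x\<bar> powr p) \<partial>lborel)"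
  proof (rule nn_integral_mono_AE)
    from assms(3) show "AE x in lborel. ennreal (\<bar>v x\<bar> powr p) \<le> ennreal (\<bar>w x\<bar> powr p)"
      by eventually_elim (use assms(4) in \<open>auto intro!: ennreal_leI powr_mono2\<close>)
  qed
  moreover have "AE x in lborel. \<bar>v x\<bar> \<le> A"
    using assms(3) assms(1)[unfolded Lbd_def] by (auto elim!: eventually_elim2)
  ultimately show ?thesis using assms by (auto simp: Lbd_def)
qed

lemma Lbd_AE_cong:
  assumes "Lbd p w A" "v \<in> borel_measurable borel" "AE x in lborel. v x = w x" "p \<ge> 0"
  shows "Lbd p v A"
proof (rule Lbd_AE_dominated[OF assms(1,2) _ assms(4)])
  from assms(3) show "AE x in lborel. \<bar>v x\<bar> \<le> \<bar>w x\<bar>" by eventually_elim simp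
qed

lemma Lbd_uminus: "Lbd p w A \<Longrightarrow> Lbd p (\<lambda>x. - w x) A"
  by (simp add: Lbd_def)

lemma Lbd_add_pos:
  assumes v: "Lbd p v A" and w: "Lbd p w B" and p: "p \<ge> 1" and pos: "A > 0" "B > 0"
  shows "Lbd p (\<lambda>x. v x + w x) (A + B)"
proof -
  have [measurable]: "v \<in> borel_measurable borel" "w \<in> borel_measurable borel"
    using v w by (auto simp: Lbd_def)
  have "AE x in lborel. \<bar>v x\<bar> \<le> A" "AE x in lborel. \<bar>w x\<bar> \<le> B" using v w by (auto simp: Lbd_def)
  then have "AE x in lborel. \<bar>v x + w x\<bar> \<le> A + B" by eventually_elim linarith
  moreover have "(\<integral>\<^sup>+x. ennreal (\<bar>v x + w x\<bar> powr p) \<partial>lborel) \<le> ennreal ((A + B) powr p)"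
  proof -
    let ?c = "(A + B) powr (p - 1)"
    have "(\<integral>\<^sup>+x. ennreal (\<bar>v x + w x\<bar> powr p) \<partial>lborel) \<le>
      (\<integral>\<^sup>+x. ennreal (?c * A powr (1 - p)) * ennreal (\<bar>v x\<bar> powr p) + ennreal (?c * B powr (1 - p)) * ennreal (\<bar>w x\<bar> powr p) \<partial>lborel)"
    proof (rule nn_integral_mono)
      fix x
      have "\<bar>v x + w x\<bar> powr p \<le> ?c * A powr (1 - p) * \<bar>v x\<bar> powr p + ?c * B powr (1 - p) * \<bar>w x\<bar> powr p"
        using powr_add_weighted_le[OF p pos, of "v x" "w x"] by (simp add: algebra_simps)
      then show "ennreal (\<bar>v x + w x\<bar> powr p) \<le> ennreal (?c * A powr (1 - p)) * ennreal (\<bar>v x\<bar> powr p) +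
          ennreal (?c * B powr (1 - p)) * ennreal (\<bar>w x\<bar> powr p)"
        by (simp add: ennreal_leI flip: ennreal_mult ennreal_plus)
    qed
    also have "\<dots> = ennreal (?c * A powr (1 - p)) * (\<integral>\<^sup>+x. ennreal (\<bar>v x\<bar> powr p) \<partial>lborel) +
        ennreal (?c * B powr (1 - p)) * (\<integral>\<^sup>+x. ennreal (\<bar>w x\<bar> powr p) \<partial>lborel)"
      by (subst nn_integral_add) (auto simp: nn_integral_cmult)
    also have "\<dots> \<le> ennreal (?c * A powr (1 - p)) * ennreal (A powr p) + ennreal (?c * B powr (1 - p)) * ennreal (B powr p)"
      using v w by (intro add_mono mult_left_mono) (auto simp: Lbd_def)
    also have "\<dots> = ennreal (?c * (A powr (1 - p) * A powr p) + ?c * (B powr (1 - p) * B powr p))"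
      by (simp add: mult.assoc flip: ennreal_mult ennreal_plus)
    also have "?c * (A powr (1 - p) * A powr p) + ?c * (B powr (1 - p) * B powr p) = (A + B) powr p"
    proof -
      have "A powr (1 - p) * A powr p = A" "B powr (1 - p) * B powr p = B" "?c * (A + B) = (A + B) powr p"
        using pos by (simp_all add: powr_add[symmetric] powr_diff)
      then show ?thesis by (simp add: distrib_left)
    qed
    finally show ?thesis .
  qed
  ultimately show ?thesis using pos by (simp add: Lbd_def)
qed

lemma Lbd_0_AE: "Lbd p w 0 \<Longrightarrow> AE x in lborel. w x = 0"
  by (simp add: Lbd_def)

text \<open>A bound 0 forces its function to vanish a.e., which removes the positivity from
  \<open>Lbd_add_pos\<close>.\<close>

lemma Lbd_add:
  assumes v: "Lbd p v A" and w: "Lbd p w B" and p: "p \<ge> 1"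
  shows "Lbd p (\<lambda>x. v x + w x) (A + B)"
proof -
  have [measurable]: "v \<in> borel_measurable borel" "w \<in> borel_measurable borel"
    using v w by (auto simp: Lbd_def)
  consider "A > 0" "B > 0" | "A = 0" | "B = 0" using v w unfolding Lbd_def by linarith
  then show ?thesis
  proof cases
    case 2
    then have "AE x in lborel. v x + w x = w x" using Lbd_0_AE[of p v] v by simp
    with 2 w p show ?thesis by (auto intro!: Lbd_AE_cong[of p w])
  next
    case 3
    then have "AE x in lborel. v x + w x = v x" using Lbd_0_AE[of p w] w by simp
    with 3 v p show ?thesis by (auto intro!: Lbd_AE_cong[of p v])
  qed (rule Lbd_add_pos[OF assms])
qed

lemma Lbd_diff:
  assumes "Lbd p v A" "Lbd p w B" "p \<ge> 1"
  shows "Lbd p (\<lambda>x. v x - w x) (A + B)"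
  using Lbd_add[OF assms(1) Lbd_uminus[OF assms(2)] assms(3)] by simp

text \<open>Fatou's lemma. It stands in for completeness when the iterates of
  \<open>fixed_point\<close> pass to the limit.\<close>

lemma Lbd_limit:
  assumes v: "\<And>k. Lbd p (v k) B" and w: "w \<in> borel_measurable borel"
    and lim: "AE x in lborel. (\<lambda>k. v k x) \<longlonglongrightarrow> w x" and p: "p > 0"
  shows "Lbd p w B"
proof -
  have [measurable]: "v k \<in> borel_measurable borel" for k using v by (auto simp: Lbd_def)
  have "AE x in lborel. \<forall>k. \<bar>v k x\<bar> \<le> B" using v by (auto simp: Lbd_def AE_all_countable)
  then have "AE x in lborel. \<bar>w x\<bar> \<le> B"
    using lim by eventually_elim (rule LIMSEQ_le_const2[OF tendsto_rabs], auto)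
  moreover have "(\<integral>\<^sup>+x. ennreal (\<bar>w x\<bar> powr p) \<partial>lborel) \<le> ennreal (B powr p)"
  proof -
    have "(\<integral>\<^sup>+x. ennreal (\<bar>w x\<bar> powr p) \<partial>lborel) = (\<integral>\<^sup>+x. liminf (\<lambda>k. ennreal (\<bar>v k x\<bar> powr p)) \<partial>lborel)"
    proof (rule nn_integral_cong_AE)
      show "AE x in lborel. ennreal (\<bar>w x\<bar> powr p) = liminf (\<lambda>k. ennreal (\<bar>v k x\<bar> powr p))"
        using lim
      proof eventually_elim
        case (elim x)
        have "(\<lambda>k. ennreal (\<bar>v k x\<bar> powr p)) \<longlonglongrightarrow> ennreal (\<bar>w x\<bar> powr p)"
          using p by (intro tendsto_ennrealI tendsto_powr2 tendsto_rabs elim tendsto_const) auto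
        then show ?case by (metis lim_imp_Liminf sequentially_bot)
      qed
    qed
    also have "\<dots> \<le> liminf (\<lambda>k. \<integral>\<^sup>+x. ennreal (\<bar>v k x\<bar> powr p) \<partial>lborel)"
      by (rule nn_integral_liminf) simp
    also have "\<dots> \<le> liminf (\<lambda>k. ennreal (B powr p))"
      using v by (intro Liminf_mono always_eventually) (auto simp: Lbd_def)
    finally show ?thesis by (simp add: Liminf_const)
  qed
  ultimately show ?thesis using w v[of 0] by (simp add: Lbd_def)
qed

lemma Lbd_set_integrable:
  assumes "Lbd p w B"
  shows "set_integrable lborel (cbox a b) w"
  unfolding set_integrable_def
proof (rule Bochner_Integration.integrable_bound)
  show "integrable lborel (\<lambda>x. B * indicator (cbox a b) x :: real)"
    by (intro integrable_mult_right integrable_real_indicator) (auto simp: emeasure_lborel_cbox_finite[unfolded infinity_ennreal_def])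
  have [measurable]: "w \<in> borel_measurable borel" using assms by (auto simp: Lbd_def)
  show "(\<lambda>x. indicat_real (cbox a b) x *\<^sub>R w x) \<in> borel_measurable lborel" by simp
  have "AE x in lborel. \<bar>w x\<bar> \<le> B" using assms by (auto simp: Lbd_def)
  then show "AE x in lborel. norm (indicat_real (cbox a b) x *\<^sub>R w x) \<le> norm (B * indicator (cbox a b) x :: real)"
    by eventually_elim (auto simp: indicator_def)
qed

lemma Lbd_schwartz_integrable:
  assumes "Lbd p w B" "schwartz \<phi>"
  shows "integrable lborel (\<lambda>x. w x * \<phi> x)"
proof (rule Bochner_Integration.integrable_bound)
  show "integrable lborel (\<lambda>x. B * \<bar>\<phi> x\<bar>)"
    by (intro integrable_mult_right integrable_abs schwartz_integrable assms)
  have [measurable]: "w \<in> borel_measurable borel" "\<phi> \<in> borel_measurable borel"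
    using assms by (auto simp: Lbd_def intro: schwartz_measurable)
  show "(\<lambda>x. w x * \<phi> x) \<in> borel_measurable lborel" by simp
  have "AE x in lborel. \<bar>w x\<bar> \<le> B" using assms by (auto simp: Lbd_def)
  then show "AE x in lborel. norm (w x * \<phi> x) \<le> norm (B * \<bar>\<phi> x\<bar>)"
    by eventually_elim (auto simp: abs_mult intro!: mult_right_mono)
qed

lemma AE_eq_if_dist_of_eq:
  assumes v: "Lbd p v A" and w: "Lbd q w B" and eq: "\<And>\<phi>. schwartz \<phi> \<Longrightarrow> dist_of v \<phi> = dist_of w \<phi>"
  shows "AE x in lborel. v x = w x"
proof -
  have [measurable]: "v \<in> borel_measurable borel" "w \<in> borel_measurable borel"
    using v w by (auto simp: Lbd_def)
  have "AE x in lborel. v x - w x = 0"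
  proof (rule AE_zero_if_dist_of_zero)
    show "set_integrable lborel (cbox a b) (\<lambda>x. v x - w x)" for a b
      by (intro set_integral_diff Lbd_set_integrable[OF v] Lbd_set_integrable[OF w])
    show "dist_of (\<lambda>x. v x - w x) \<phi> = 0" if "schwartz \<phi>" for \<phi>
      using eq[OF that] unfolding dist_of_def left_diff_distrib
      by (subst Bochner_Integration.integral_diff[OF Lbd_schwartz_integrable[OF v that] Lbd_schwartz_integrable[OF w that]]) simp
  qed simp
  then show ?thesis by simp
qed

section \<open>Comparison of \<open>Lbd\<close> with the norms\<close>

lemma in_Lp_infinity:
  assumes "in_Lp \<infinity> w"
  shows "AE x in lborel. \<bar>w x\<bar> \<le> Lp_norm \<infinity> w" "Lp_norm \<infinity> w \<ge> 0"
proof -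
  let ?e = "esssup lborel (\<lambda>x. ereal \<bar>w x\<bar>)"
  have fin: "?e < \<infinity>" using assms by (simp add: in_Lp_def)
  have AE: "AE x in lborel. ereal \<bar>w x\<bar> \<le> ?e" by (rule esssup_AE)
  \<comment> \<open>A negative essential supremum would make a false statement hold a.e., which is
    impossible as Lebesgue measure is not zero.\<close>
  have "?e \<ge> 0"
  proof (rule ccontr)
    assume "\<not> ?e \<ge> 0"
    have "\<not> ereal \<bar>w x\<bar> \<le> ?e" for x
    proof
      assume "ereal \<bar>w x\<bar> \<le> ?e"
      moreover have "(0::ereal) \<le> ereal \<bar>w x\<bar>" by simp
      ultimately show False using \<open>\<not> ?e \<ge> 0\<close> by (meson order_trans)
    qed
    with AE have "ae_filter (lborel :: 'a measure) = bot" by (simp add: trivial_limit_def)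
    then show False by (simp add: ae_filter_eq_bot_iff)
  qed
  then have e: "?e = ereal (Lp_norm \<infinity> w)" using fin unfolding Lp_norm_def by (cases ?e) auto
  show "AE x in lborel. \<bar>w x\<bar> \<le> Lp_norm \<infinity> w" using AE unfolding e by simp
  show "Lp_norm \<infinity> w \<ge> 0" using \<open>?e \<ge> 0\<close> unfolding e by simp
qed

lemma in_Lp_finite:
  assumes "in_Lp (ereal p) w" "p \<ge> 1"
  shows "(\<integral>\<^sup>+x. ennreal (\<bar>w x\<bar> powr p) \<partial>lborel) = ennreal (Lp_norm (ereal p) w powr p)"
    and "Lp_norm (ereal p) w \<ge> 0"
proof -
  have i: "integrable lborel (\<lambda>x. \<bar>w x\<bar> powr p)" using assms by (simp add: in_Lp_def)
  have "(LINT x|lborel. \<bar>w x\<bar> powr p) \<ge> 0" by simp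
  then have "Lp_norm (ereal p) w powr p = (LINT x|lborel. \<bar>w x\<bar> powr p)"
    using assms by (simp add: Lp_norm_def powr_powr)
  with nn_integral_eq_integral[OF i] show "(\<integral>\<^sup>+x. ennreal (\<bar>w x\<bar> powr p) \<partial>lborel) = ennreal (Lp_norm (ereal p) w powr p)"
    by simp
  show "Lp_norm (ereal p) w \<ge> 0" by (simp add: Lp_norm_def)
qed

lemma Lbd_if_in_Lp:
  assumes "in_Lp (ereal p) w" "in_Lp \<infinity> w" "Lp_norm (ereal p) w \<le> B" "Lp_norm \<infinity> w \<le> B" "p \<ge> 1"
  shows "Lbd p w B"
  unfolding Lbd_def
proof (intro conjI)
  note fin = in_Lp_finite[OF assms(1,5)] and inf = in_Lp_infinity[OF assms(2)]
  show "w \<in> borel_measurable borel" using assms(1) by (simp add: in_Lp_def)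
  show "0 \<le> B" using inf(2) assms(4) by linarith
  show "AE x in lborel. \<bar>w x\<bar> \<le> B" using inf(1) by eventually_elim (use assms(4) in linarith)
  show "(\<integral>\<^sup>+x. ennreal (\<bar>w x\<bar> powr p) \<partial>lborel) \<le> ennreal (B powr p)"
    unfolding fin(1) using fin(2) assms by (intro ennreal_leI powr_mono2) auto
qed

lemma Lbd_in_Lp_finite:
  assumes "Lbd p w B" "p \<ge> 1"
  shows "in_Lp (ereal p) w" "Lp_norm (ereal p) w \<le> B"
proof -
  have [measurable]: "w \<in> borel_measurable borel" using assms by (auto simp: Lbd_def)
  have le: "(\<integral>\<^sup>+x. ennreal (\<bar>w x\<bar> powr p) \<partial>lborel) \<le> ennreal (B powr p)" "B \<ge> 0" using assms by (auto simp: Lbd_def)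
  then have i: "integrable lborel (\<lambda>x. \<bar>w x\<bar> powr p)"
    by (intro integrableI_nonneg) (auto intro: order_le_less_trans)
  then show "in_Lp (ereal p) w" by (simp add: in_Lp_def)
  have "ennreal (LINT x|lborel. \<bar>w x\<bar> powr p) \<le> ennreal (B powr p)"
    using le(1) nn_integral_eq_integral[OF i] by simp
  then have "(LINT x|lborel. \<bar>w x\<bar> powr p) \<le> B powr p" by simp
  then have "(LINT x|lborel. \<bar>w x\<bar> powr p) powr (1 / p) \<le> (B powr p) powr (1 / p)"
    using assms by (intro powr_mono2) auto
  then show "Lp_norm (ereal p) w \<le> B" using assms le(2) by (simp add: Lp_norm_def powr_powr)
qed

lemma Lbd_in_Lp_infinity:
  assumes "Lbd p w B"
  shows "in_Lp \<infinity> w" "Lp_norm \<infinity> w \<le> B"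
proof -
  have [measurable]: "w \<in> borel_measurable borel" using assms by (auto simp: Lbd_def)
  have "esssup lborel (\<lambda>x. ereal \<bar>w x\<bar>) \<le> ereal B"
    by (rule esssup_I) (use assms in \<open>auto simp: Lbd_def\<close>)
  then have le: "esssup lborel (\<lambda>x. ereal \<bar>w x\<bar>) < \<infinity>" "esssup lborel (\<lambda>x. ereal \<bar>w x\<bar>) \<le> ereal B"
    by (auto intro: order_le_less_trans)
  then show i: "in_Lp \<infinity> w" by (simp add: in_Lp_def)
  have "B \<ge> 0" using assms by (simp add: Lbd_def)
  then show "Lp_norm \<infinity> w \<le> B" using le by (cases "esssup lborel (\<lambda>x. ereal \<bar>w x\<bar>)") (auto simp: Lp_norm_def)
qed

text \<open>Interpolation: \<open>|g|^q \<le> H^(q-1) |g|\<close> wherever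
  \<open>|g| \<le> H\<close>.\<close>

lemma Lbd_exponent:
  assumes g: "Lbd 1 g H" and q: "q \<ge> 1"
  shows "Lbd q g H"
proof -
  have H: "H \<ge> 0" using g by (simp add: Lbd_def)
  have [measurable]: "g \<in> borel_measurable borel" using g by (auto simp: Lbd_def)
  have "(\<integral>\<^sup>+x. ennreal (\<bar>g x\<bar> powr q) \<partial>lborel) \<le> (\<integral>\<^sup>+x. ennreal (H powr (q - 1)) * ennreal (\<bar>g x\<bar> powr 1) \<partial>lborel)"
  proof (rule nn_integral_mono_AE)
    have "AE x in lborel. \<bar>g x\<bar> \<le> H" using g by (simp add: Lbd_def)
    then show "AE x in lborel. ennreal (\<bar>g x\<bar> powr q) \<le> ennreal (H powr (q - 1)) * ennreal (\<bar>g x\<bar> powr 1)"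
    proof eventually_elim
      case (elim x)
      have "\<bar>g x\<bar> powr q = \<bar>g x\<bar> powr (q - 1) * \<bar>g x\<bar> powr 1"
        by (simp only: powr_add[symmetric]) simp
      also have "\<dots> \<le> H powr (q - 1) * \<bar>g x\<bar> powr 1"
        using elim q by (intro mult_right_mono powr_mono2) auto
      finally show ?case by (simp add: ennreal_leI flip: ennreal_mult)
    qed
  qed
  also have "\<dots> = ennreal (H powr (q - 1)) * (\<integral>\<^sup>+x. ennreal (\<bar>g x\<bar> powr 1) \<partial>lborel)"
    by (rule nn_integral_cmult) simp
  also have "\<dots> \<le> ennreal (H powr (q - 1)) * ennreal (H powr 1)"
    using g by (intro mult_left_mono) (auto simp: Lbd_def)
  also have "\<dots> = ennreal (H powr q)"
    by (simp only: ennreal_mult[symmetric] powr_ge_zero powr_add[symmetric]) simp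
  finally show ?thesis using g by (simp add: Lbd_def)
qed

text \<open>The 2 stems from the sum of two norms in \<open>Lcap_norm\<close>; it is the 2 in the
  later constants \<open>2 * C\<close>.\<close>

lemma Lbd_in_Lcap:
  assumes g: "Lbd 1 g H" and r: "r \<ge> 1"
  shows "in_Lcap 1 r g" "Lcap_norm 1 r g \<le> 2 * H"
proof -
  have 1: "in_Lp 1 g" "Lp_norm 1 g \<le> H"
    using Lbd_in_Lp_finite[OF g] by (auto simp: one_ereal_def)
  have 2: "in_Lp r g \<and> Lp_norm r g \<le> H"
  proof (cases r)
    case (real q)
    then have "q \<ge> 1" using r by (simp add: one_ereal_def)
    from Lbd_in_Lp_finite[OF Lbd_exponent[OF g this] this] show ?thesis using real by simp
  next
    case PInf
    with Lbd_in_Lp_infinity[OF g] show ?thesis by simp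
  qed (use r in simp)
  show "in_Lcap 1 r g" "Lcap_norm 1 r g \<le> 2 * H"
    using 1 2 by (auto simp: in_Lcap_def Lcap_norm_def)
qed

lemma Lbd_Lcap_norm:
  assumes "Lbd p w B" "p \<ge> 1"
  shows "in_Lcap (ereal p) \<infinity> w" "Lcap_norm (ereal p) \<infinity> w \<le> 2 * B"
  using Lbd_in_Lp_finite[OF assms] Lbd_in_Lp_infinity[OF assms(1)]
  by (auto simp: in_Lcap_def Lcap_norm_def)

lemma in_Lcap_Lbd:
  assumes "in_Lcap (ereal p) \<infinity> w" "Lcap_norm (ereal p) \<infinity> w \<le> B" "p \<ge> 1"
  shows "Lbd p w B"
  using assms in_Lp_finite(2)[of p w] in_Lp_infinity(2)[of w]
  by (intro Lbd_if_in_Lp) (auto simp: in_Lcap_def Lcap_norm_def)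

section \<open>Integration in time\<close>

text \<open>\<open>Minkowski_integral\<close> wants its bound at every time; setting the integrand
  to 0 on the exceptional null set of times provides this without changing any integral. The
  supremum bound comes from integrating \<open>b\<close> at fixed \<open>x\<close>.\<close>

lemma time_integral_Lbd:
  fixes \<sigma> :: "real \<Rightarrow> 'a::euclidean_space \<Rightarrow> real"
  assumes p: "p > 1" and S[measurable]: "S \<in> sets borel" and m[measurable]: "(\<lambda>(s, x). \<sigma> s x) \<in> borel_measurable (borel \<Otimes>\<^sub>M borel)"
    and b: "set_integrable lborel S b" "\<And>s. s \<in> S \<Longrightarrow> b s > 0"
    and B: "(LINT s:S|lborel. b s) \<le> B" "B > 0"
    and \<sigma>: "AE s in lborel. s \<in> S \<longrightarrow> Lbd p (\<sigma> s) (b s)"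
  shows "AE x in lborel. set_integrable lborel S (\<lambda>s. \<sigma> s x)"
    and "Lbd p (\<lambda>x. LINT s:S|lborel. \<sigma> s x) B"
proof -
  obtain N where N: "N \<in> null_sets lborel" "\<And>s. s \<notin> N \<Longrightarrow> s \<in> S \<Longrightarrow> Lbd p (\<sigma> s) (b s)"
    using \<sigma> by (auto elim!: AE_E3)
  have [measurable]: "N \<in> sets borel" using N(1) by auto
  define \<tau> where "\<tau> s x = (if s \<in> N then 0 else \<sigma> s x)" for s x
  have \<tau>m[measurable]: "(\<lambda>(s, x). \<tau> s x) \<in> borel_measurable (borel \<Otimes>\<^sub>M borel)"
    unfolding \<tau>_def by measurable
  have \<tau>b: "Lbd p (\<tau> s) (b s)" if "s \<in> S" for s
  proof (cases "s \<in> N")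
    case True
    have "Lbd p (\<tau> s) 0" using True by (simp add: \<tau>_def[abs_def])
    then show ?thesis by (rule Lbd_mono) (use b(2)[OF that] p in auto)
  next
    case False
    then show ?thesis using N(2)[OF False that] by (simp add: \<tau>_def[abs_def])
  qed
  have [measurable]: "(\<lambda>s. \<sigma> s x) \<in> borel_measurable borel" "(\<lambda>s. \<tau> s x) \<in> borel_measurable borel" for x
    using measurable_compose[OF measurable_Pair2', of x borel "\<lambda>(s, x). \<sigma> s x" borel borel]
      measurable_compose[OF measurable_Pair2', of x borel "\<lambda>(s, x). \<tau> s x" borel borel] by simp_all
  have AEN: "AE s in lborel. s \<notin> N" using N(1) by (rule AE_not_in)
  have eq: "AE s in lborel. indicat_real S s *\<^sub>R \<sigma> s x = indicat_real S s *\<^sub>R \<tau> s x" for x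
    using AEN by eventually_elim (simp add: \<tau>_def)
  have int_eq: "(LINT s:S|lborel. \<sigma> s x) = (LINT s:S|lborel. \<tau> s x)" for x
    unfolding set_lebesgue_integral_def by (rule integral_cong_AE[OF _ _ eq]) auto
  have set_eq: "set_integrable lborel S (\<lambda>s. \<sigma> s x) \<longleftrightarrow> set_integrable lborel S (\<lambda>s. \<tau> s x)" for x
    unfolding set_integrable_def by (rule integrable_cong_AE[OF _ _ eq]) auto
  have \<tau>p: "(\<integral>\<^sup>+x. ennreal (\<bar>\<tau> s x\<bar> powr p) \<partial>lborel) \<le> ennreal (b s powr p)" if "s \<in> S" for s
    using \<tau>b[OF that] by (simp add: Lbd_def)
  have "S \<in> sets lborel" by simp
  note M = Minkowski_integral[OF p this \<tau>m b B \<tau>p]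
  show si: "AE x in lborel. set_integrable lborel S (\<lambda>s. \<sigma> s x)"
    unfolding set_eq by (rule M(1))
  have si': "AE x in lborel. set_integrable lborel S (\<lambda>s. \<tau> s x)" by (rule M(1))
  define b' where "b' = (\<lambda>s. indicator S s * b s)"
  have [measurable]: "b' \<in> borel_measurable borel"
    using b(1) unfolding b'_def set_integrable_def by (auto dest: borel_measurable_integrable)
  have "AE s in lborel. AE x in lborel. s \<in> S \<longrightarrow> \<bar>\<tau> s x\<bar> \<le> b' s"
  proof (rule AE_I2)
    fix s
    show "AE x in lborel. s \<in> S \<longrightarrow> \<bar>\<tau> s x\<bar> \<le> b' s"
      using \<tau>b[of s] by (cases "s \<in> S") (auto simp: Lbd_def b'_def)
  qed
  moreover have "{z \<in> space (lborel \<Otimes>\<^sub>M lborel). fst z \<in> S \<longrightarrow> \<bar>\<tau> (fst z) (snd z)\<bar> \<le> b' (fst z)}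
     \<in> sets (lborel \<Otimes>\<^sub>M (lborel :: 'a measure))"
  proof -
    have [measurable]: "(\<lambda>z. \<tau> (fst z) (snd z)) \<in> borel_measurable (lborel \<Otimes>\<^sub>M lborel)"
      using \<tau>m by (simp add: split_beta')
    show ?thesis by measurable
  qed
  \<comment> \<open>The null set of \<open>x\<close> depends on \<open>s\<close>; joint
    measurability allows the quantifiers to be exchanged.\<close>
  ultimately have "AE x in lborel. AE s in lborel. s \<in> S \<longrightarrow> \<bar>\<tau> s x\<bar> \<le> b' s"
    by (subst (asm) lborel_pair.AE_commute)
  then have inf: "AE x in lborel. \<bar>LINT s:S|lborel. \<tau> s x\<bar> \<le> B"
    using si'
  proof eventually_elim
    case (elim x)
    have "\<bar>LINT s:S|lborel. \<tau> s x\<bar> \<le> (LINT s:S|lborel. \<bar>\<tau> s x\<bar>)"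
      using set_integral_norm_bound[OF elim(2)] by simp
    also have "\<dots> \<le> (LINT s:S|lborel. b s)"
      unfolding set_lebesgue_integral_def
    proof (rule integral_mono_AE)
      show "integrable lborel (\<lambda>s. indicat_real S s *\<^sub>R \<bar>\<tau> s x\<bar>)"
        using set_integrable_abs[OF elim(2)] by (simp add: set_integrable_def)
      show "integrable lborel (\<lambda>s. indicat_real S s *\<^sub>R b s)" using b(1) by (simp add: set_integrable_def)
      show "AE s in lborel. indicat_real S s *\<^sub>R \<bar>\<tau> s x\<bar> \<le> indicat_real S s *\<^sub>R b s"
        using elim(1) by eventually_elim (auto simp: indicator_def b'_def)
    qed
    finally show ?case using B(1) by linarith
  qed
  have meas: "(\<lambda>x. LINT s:S|lborel. \<tau> s x) \<in> borel_measurable borel"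
    unfolding set_lebesgue_integral_def
    by (rule lborel.borel_measurable_lebesgue_integral) measurable
  show "Lbd p (\<lambda>x. LINT s:S|lborel. \<sigma> s x) B"
    unfolding Lbd_def int_eq using inf meas B(2) M(2) by simp
qed

lemma Lbd_dist_of_bound:
  assumes w: "Lbd p w B" and \<phi>: "schwartz \<phi>"
  shows "\<bar>dist_of w \<phi>\<bar> \<le> B * (LINT x|lborel. \<bar>\<phi> x\<bar>)"
proof -
  have i: "integrable lborel (\<lambda>x. w x * \<phi> x)" by (rule Lbd_schwartz_integrable[OF w \<phi>])
  have "\<bar>dist_of w \<phi>\<bar> \<le> (LINT x|lborel. \<bar>w x * \<phi> x\<bar>)"
    unfolding dist_of_def using integral_norm_bound[of lborel "\<lambda>x. w x * \<phi> x"] by simp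
  also have "\<dots> \<le> (LINT x|lborel. B * \<bar>\<phi> x\<bar>)"
  proof (rule integral_mono_AE)
    show "integrable lborel (\<lambda>x. \<bar>w x * \<phi> x\<bar>)" by (rule integrable_abs[OF i])
    show "integrable lborel (\<lambda>x. B * \<bar>\<phi> x\<bar>)"
      by (intro integrable_mult_right integrable_abs schwartz_integrable \<phi>)
    have "AE x in lborel. \<bar>w x\<bar> \<le> B" using w by (simp add: Lbd_def)
    then show "AE x in lborel. \<bar>w x * \<phi> x\<bar> \<le> B * \<bar>\<phi> x\<bar>"
      by eventually_elim (auto simp: abs_mult intro: mult_right_mono)
  qed
  finally show ?thesis by simp
qed

lemma dist_of_time_integral:
  fixes \<sigma> :: "real \<Rightarrow> real^'n::finite \<Rightarrow> real"
  assumes m[measurable]: "(\<lambda>(s, x). \<sigma> s x) \<in> borel_measurable (borel \<Otimes>\<^sub>M borel)"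
    and \<sigma>: "AE s in lborel. s \<in> {0..t} \<longrightarrow> Lbd p (\<sigma> s) B" and \<phi>: "schwartz \<phi>"
  shows "set_integrable lborel {0..t} (\<lambda>s. dist_of (\<sigma> s) \<phi>)"
    and "dist_of (\<lambda>x. LINT s:{0..t}|lborel. \<sigma> s x) \<phi> = (LINT s:{0..t}|lborel. dist_of (\<sigma> s) \<phi>)"
proof -
  have [measurable]: "\<phi> \<in> borel_measurable borel" by (rule schwartz_measurable[OF \<phi>])
  let ?h = "\<lambda>(s, x). indicat_real {0..t} s * (\<sigma> s x * \<phi> x)"
  have hm: "?h \<in> borel_measurable (lborel \<Otimes>\<^sub>M lborel)" by measurable
  have int: "integrable (lborel \<Otimes>\<^sub>M lborel) ?h"
  proof (rule integrable_iff_bounded[THEN iffD2], intro conjI hm)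
    have "(\<integral>\<^sup>+z. ennreal (norm (?h z)) \<partial>(lborel \<Otimes>\<^sub>M lborel)) =
       (\<integral>\<^sup>+s. \<integral>\<^sup>+x. ennreal (norm (?h (s, x))) \<partial>lborel \<partial>lborel)"
      using hm by (subst lborel.nn_integral_fst[symmetric]) auto
    also have "\<dots> \<le> (\<integral>\<^sup>+s. ennreal (indicator {0..t} s * (\<bar>B\<bar> * (LINT x|lborel. \<bar>\<phi> x\<bar>))) \<partial>lborel)"
    proof (rule nn_integral_mono_AE)
      show "AE s in lborel. (\<integral>\<^sup>+x. ennreal (norm (?h (s, x))) \<partial>lborel) \<le>
          ennreal (indicator {0..t} s * (\<bar>B\<bar> * (LINT x|lborel. \<bar>\<phi> x\<bar>)))"
        using \<sigma>
      proof eventually_elim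
        case (elim s)
        show ?case
        proof (cases "s \<in> {0..t}")
          case True
          then have L: "Lbd p (\<sigma> s) B" using elim by simp
          then have ae: "AE x in lborel. \<bar>\<sigma> s x\<bar> \<le> \<bar>B\<bar>" by (auto simp: Lbd_def)
          have "(\<integral>\<^sup>+x. ennreal (norm (?h (s, x))) \<partial>lborel) \<le> (\<integral>\<^sup>+x. ennreal (\<bar>B\<bar> * \<bar>\<phi> x\<bar>) \<partial>lborel)"
          proof (rule nn_integral_mono_AE)
            from ae show "AE x in lborel. ennreal (norm (?h (s, x))) \<le> ennreal (\<bar>B\<bar> * \<bar>\<phi> x\<bar>)"
              by eventually_elim (auto simp: abs_mult indicator_def intro!: ennreal_leI mult_right_mono)
          qed
          also have "\<dots> = ennreal (LINT x|lborel. \<bar>B\<bar> * \<bar>\<phi> x\<bar>)"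
            by (intro nn_integral_eq_integral integrable_mult_right integrable_abs schwartz_integrable \<phi>) simp
          finally show ?thesis using True by simp
        qed simp
      qed
    qed
    also have "\<dots> < \<infinity>"
    proof -
      have "integrable lborel (\<lambda>s. indicator {0..t} s * (\<bar>B\<bar> * (LINT x|lborel. \<bar>\<phi> x\<bar>)) :: real)"
        by (intro integrable_mult_left) (auto simp: emeasure_lborel_Icc_eq)
      from nn_integral_eq_integral[OF this] show ?thesis by simp
    qed
    finally show "(\<integral>\<^sup>+z. ennreal (norm (?h z)) \<partial>(lborel \<Otimes>\<^sub>M lborel)) < \<infinity>" .
  qed
  have "integrable lborel (\<lambda>s. LINT x|lborel. ?h (s, x))"
    using lborel_pair.integrable_fst[OF int] by simp
  then show "set_integrable lborel {0..t} (\<lambda>s. dist_of (\<sigma> s) \<phi>)"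
    unfolding set_integrable_def dist_of_def by simp
  have "dist_of (\<lambda>x. LINT s:{0..t}|lborel. \<sigma> s x) \<phi> = (LINT x|lborel. LINT s|lborel. ?h (s, x))"
    unfolding dist_of_def set_lebesgue_integral_def by (simp add: mult.assoc flip: integral_mult_left_zero)
  also have "\<dots> = (LINT s|lborel. LINT x|lborel. ?h (s, x))"
    using lborel_pair.Fubini_integral[of "\<lambda>s x. ?h (s, x)"] int by simp
  also have "\<dots> = (LINT s:{0..t}|lborel. dist_of (\<sigma> s) \<phi>)"
    unfolding dist_of_def set_lebesgue_integral_def by simp
  finally show "dist_of (\<lambda>x. LINT s:{0..t}|lborel. \<sigma> s x) \<phi> = (LINT s:{0..t}|lborel. dist_of (\<sigma> s) \<phi>)" .
qed

lemma set_integrable_bounded: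
  fixes h :: "real \<Rightarrow> real"
  assumes "h \<in> borel_measurable borel" "AE s in lborel. s \<in> {0..t} \<longrightarrow> \<bar>h s\<bar> \<le> B"
  shows "set_integrable lborel {0..t} h"
  unfolding set_integrable_def
proof (rule Bochner_Integration.integrable_bound)
  show "integrable lborel (\<lambda>s. \<bar>B\<bar> * indicator {0..t} s :: real)"
    by (intro integrable_mult_right integrable_real_indicator) (auto simp: emeasure_lborel_Icc_eq)
  show "AE s in lborel. norm (indicat_real {0..t} s *\<^sub>R h s) \<le> norm (\<bar>B\<bar> * indicator {0..t} s :: real)"
    using assms(2) by eventually_elim (auto simp: indicator_def)
qed (use assms(1) in simp)

text \<open>Exchange the integrals over the triangle \<open>0 \<le> s \<le> \<tau> \<le> t\<close>.\<close>

lemma time_integral_convolution: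
  fixes a A :: "real \<Rightarrow> real \<Rightarrow> real"
  assumes m[measurable]: "(\<lambda>(\<tau>, s). a \<tau> s) \<in> borel_measurable (borel \<Otimes>\<^sub>M borel)"
    and B: "\<And>\<tau> s. 0 \<le> s \<Longrightarrow> 0 \<le> \<tau> \<Longrightarrow> \<tau> \<le> t \<Longrightarrow> s \<le> t \<Longrightarrow> \<bar>a \<tau> s\<bar> \<le> B"
    and A: "\<And>\<tau> s. 0 \<le> s \<Longrightarrow> 0 \<le> \<tau> \<Longrightarrow> \<tau> \<le> t \<Longrightarrow> s \<le> t \<Longrightarrow> A \<tau> s = (LINT \<theta>:{0..\<tau>}|lborel. a \<theta> s)"
  shows "(LINT \<tau>:{0..t}|lborel. (LINT s:{0..\<tau>}|lborel. a (\<tau> - s) s)) = (LINT s:{0..t}|lborel. A (t - s) s)"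
    and "set_integrable lborel {0..t} (\<lambda>\<tau>. LINT s:{0..\<tau>}|lborel. a (\<tau> - s) s)"
proof -
  let ?h = "\<lambda>(\<tau>, s). indicat_real {0..t} \<tau> * (indicator {0..\<tau>} s * a (\<tau> - s) s)"
  have ind: "indicat_real {0..\<tau>} s = (if 0 \<le> s \<and> s \<le> \<tau> then 1 else 0)" for \<tau> s by auto
  have hm: "?h \<in> borel_measurable (lborel \<Otimes>\<^sub>M lborel)" unfolding ind by measurable
  have int: "integrable (lborel \<Otimes>\<^sub>M lborel) ?h"
  proof (rule Bochner_Integration.integrable_bound)
    show "integrable (lborel \<Otimes>\<^sub>M lborel) (\<lambda>z. \<bar>B\<bar> * indicator ({0..t} \<times> {0..t}) z :: real)"
      by (intro integrable_mult_right integrable_real_indicator)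
         (auto simp: lborel.emeasure_pair_measure_Times emeasure_lborel_Icc_eq ennreal_mult_less_top)
    show "AE z in lborel \<Otimes>\<^sub>M lborel. norm (?h z) \<le> norm (\<bar>B\<bar> * indicator ({0..t} \<times> {0..t}) z :: real)"
    proof (rule AE_I2)
      fix z :: "real \<times> real"
      obtain \<tau> s where z: "z = (\<tau>, s)" by (cases z)
      show "norm (?h z) \<le> norm (\<bar>B\<bar> * indicator ({0..t} \<times> {0..t}) z :: real)"
        using B[of s "\<tau> - s"] unfolding z by (auto simp: indicator_def)
    qed
  qed (rule hm)
  show "set_integrable lborel {0..t} (\<lambda>\<tau>. LINT s:{0..\<tau>}|lborel. a (\<tau> - s) s)"
    using lborel_pair.integrable_fst[OF int]
    unfolding set_integrable_def set_lebesgue_integral_def by simp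
  have "(LINT \<tau>:{0..t}|lborel. (LINT s:{0..\<tau>}|lborel. a (\<tau> - s) s)) = (LINT \<tau>|lborel. LINT s|lborel. ?h (\<tau>, s))"
    unfolding set_lebesgue_integral_def by simp
  also have "\<dots> = (LINT s|lborel. LINT \<tau>|lborel. ?h (\<tau>, s))"
    using lborel_pair.Fubini_integral[of "\<lambda>s x. ?h (s, x)"] int by simp
  also have "\<dots> = (LINT s:{0..t}|lborel. A (t - s) s)"
    unfolding set_lebesgue_integral_def
  proof (rule Bochner_Integration.integral_cong[OF refl])
    fix s
    show "(LINT \<tau>|lborel. ?h (\<tau>, s)) = indicat_real {0..t} s *\<^sub>R A (t - s) s"
    proof (cases "s \<in> {0..t}")
      case True
      \<comment> \<open>For fixed \<open>s\<close> the slice of the triangle is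
        \<open>[s, t]\<close>; the shift \<open>\<tau> = s + \<theta>\<close> moves it to
        \<open>[0, t - s]\<close>, where the integral of \<open>a\<close> is a value of
        \<open>A\<close>.\<close>
      have "(LINT \<tau>|lborel. ?h (\<tau>, s)) = (LINT \<theta>|lborel. ?h (s + 1 * \<theta>, s))"
        using lborel_integral_real_affine[of 1 "\<lambda>\<tau>. ?h (\<tau>, s)" s] by simp
      also have "\<dots> = (LINT \<theta>:{0..t - s}|lborel. a \<theta> s)"
        unfolding set_lebesgue_integral_def
        by (rule Bochner_Integration.integral_cong) (use True in \<open>auto simp: indicator_def\<close>)
      also have "\<dots> = A (t - s) s" using A[of s "t - s"] True by simp
      finally show ?thesis using True by simp
    next
      case False
      then have "?h (\<tau>, s) = 0" for \<tau> by (auto simp: indicator_def)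
      then have "(LINT \<tau>|lborel. ?h (\<tau>, s)) = (LINT \<tau>|(lborel :: real measure). 0)"
        by (intro Bochner_Integration.integral_cong refl)
      then show ?thesis using False by simp
    qed
  qed
  finally show "(LINT \<tau>:{0..t}|lborel. (LINT s:{0..\<tau>}|lborel. a (\<tau> - s) s)) = (LINT s:{0..t}|lborel. A (t - s) s)" .
qed

section \<open>The linear flow\<close>

text \<open>In place of Hoelder's inequality: \<open>|w| \<le> |w|^p + 1\<close>, hence
  \<open>|w \<psi>| \<le> M |w|^p + |\<psi>|\<close>.\<close>

lemma in_Lp_mult_integrable:
  assumes w: "in_Lp (ereal p) w" and p: "p \<ge> 1" and \<psi>: "integrable lborel \<psi>" and M: "\<And>x. \<bar>\<psi> x\<bar> \<le> M"
  shows "integrable lborel (\<lambda>x. w x * \<psi> x :: real)"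
proof (rule Bochner_Integration.integrable_bound)
  have [measurable]: "w \<in> borel_measurable borel" "\<psi> \<in> borel_measurable borel"
    using w \<psi> by (auto simp: in_Lp_def)
  show "(\<lambda>x. w x * \<psi> x) \<in> borel_measurable lborel" by simp
  show "integrable lborel (\<lambda>x. M * \<bar>w x\<bar> powr p + \<bar>\<psi> x\<bar>)"
    using w \<psi> by (intro Bochner_Integration.integrable_add integrable_mult_right integrable_abs) (auto simp: in_Lp_def)
  show "AE x in lborel. norm (w x * \<psi> x) \<le> norm (M * \<bar>w x\<bar> powr p + \<bar>\<psi> x\<bar>)"
  proof (rule AE_I2)
    fix x
    have M0: "M \<ge> 0" using M[of x] by linarith
    have "\<bar>w x\<bar> \<le> \<bar>w x\<bar> powr p + 1"
    proof (cases "\<bar>w x\<bar> \<le> 1")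
      case True
      have "0 \<le> \<bar>w x\<bar> powr p" by simp
      then show ?thesis using True by linarith
    next
      case False
      then have "\<bar>w x\<bar> powr 1 \<le> \<bar>w x\<bar> powr p" using p by (intro powr_mono) auto
      then show ?thesis by simp
    qed
    then have "\<bar>w x\<bar> * \<bar>\<psi> x\<bar> \<le> (\<bar>w x\<bar> powr p + 1) * \<bar>\<psi> x\<bar>" by (rule mult_right_mono) simp
    also have "\<dots> \<le> M * \<bar>w x\<bar> powr p + \<bar>\<psi> x\<bar>"
      using mult_left_mono[OF M[of x], of "\<bar>w x\<bar> powr p"] by (simp add: algebra_simps)
    finally show "norm (w x * \<psi> x) \<le> norm (M * \<bar>w x\<bar> powr p + \<bar>\<psi> x\<bar>)"
      using M0 by (simp add: abs_mult)
  qed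
qed

text \<open>Supplies concrete data for the linear problem, from which
  \<open>kernel_measurable\<close> reads off the kernel. The witness \<open>1 + ?\<mu>\<close>
  serves the supremum and the integral at once.\<close>

lemma Lbd_indicator_ball: "\<exists>H. Lbd 1 (indicator (ball (0::'a::euclidean_space) n) :: 'a \<Rightarrow> real) H"
proof
  let ?\<mu> = "measure lborel (ball (0::'a) n)"
  have fin: "emeasure lborel (ball (0::'a) n) = ennreal ?\<mu>"
    by (rule emeasure_eq_ennreal_measure) (use emeasure_bounded_finite[of "ball (0::'a) n"] in auto)
  have "(\<integral>\<^sup>+x. ennreal (\<bar>indicator (ball (0::'a) n) x\<bar> powr 1) \<partial>lborel) = (\<integral>\<^sup>+x. indicator (ball (0::'a) n) x \<partial>lborel)"
    by (intro nn_integral_cong) (auto simp: indicator_def)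
  also have "\<dots> = ennreal ?\<mu>" using fin by simp
  also have "\<dots> \<le> ennreal ((1 + ?\<mu>) powr 1)" by (intro ennreal_leI) simp
  finally show "Lbd 1 (indicator (ball (0::'a) n)) (1 + ?\<mu>)"
    unfolding Lbd_def by (intro conjI borel_measurable_indicator AE_I2) (auto simp: indicator_le_1 intro: order_trans[OF indicator_le_1])
qed

locale linear_flow =
  fixes m l :: nat
    and d :: "nat \<Rightarrow> nat"
    and c :: "nat \<Rightarrow> ('n::finite \<Rightarrow> nat) \<Rightarrow> real"
    and K :: "real \<Rightarrow> 'n dist"
    and p :: real
    and r :: ereal
  assumes l: "l < m" and p: "p > 1"
    and K: "fundamental_solution m d c K"
    and r: "r \<ge> 1"
    and linear_solution:
      "\<And>f. in_Lcap 1 r f \<Longrightarrow>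
         (\<forall>t\<ge>0. conv_exists (K t) f) \<and> linear_cauchy m d c (dist_of f) (\<lambda>t. conv (K t) f)"
    and linear_estimate:
      "\<And>q. q \<ge> ereal p \<Longrightarrow>
         \<exists>C>0. \<forall>f. in_Lcap 1 r f \<longrightarrow> (\<forall>t\<ge>0. \<exists>w. in_Lp q w \<and>
           (\<forall>\<phi>. schwartz \<phi> \<longrightarrow> t_deriv l (\<lambda>s. conv (K s) f) t \<phi> = dist_of w \<phi>) \<and>
           Lp_norm q w \<le> C * (1 + t) powr (- 1 / p) * Lcap_norm 1 r f)"
begin

text \<open>\<open>dk k f t \<phi>\<close> is \<open>\<langle>\<partial>\<^sub>t\<^sup>k K(t) * f, \<phi>\<rangle>\<close>, meaningful for \<open>t \<ge> 0\<close> only; functions of all \<open>t\<close> are obtained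
  with \<open>max 0 t\<close>.\<close>

definition dk :: "nat \<Rightarrow> (real^'n \<Rightarrow> real) \<Rightarrow> real \<Rightarrow> (real^'n \<Rightarrow> real) \<Rightarrow> real" where
  "dk k f t \<phi> = t_deriv k (\<lambda>s. conv (K s) f) t \<phi>"

definition rep :: "(real^'n \<Rightarrow> real) \<Rightarrow> real \<Rightarrow> (real^'n \<Rightarrow> real) \<Rightarrow> bool" where
  "rep f t w \<longleftrightarrow> (\<forall>\<phi>. schwartz \<phi> \<longrightarrow> dk l f t \<phi> = dist_of w \<phi>)"

lemma Lcap_norm_nonneg: "in_Lcap 1 r f \<Longrightarrow> Lcap_norm 1 r f \<ge> 0"
  using in_Lp_infinity(2)[of f] unfolding in_Lcap_def Lcap_norm_def
  by (cases "r = \<infinity>") (auto simp: Lp_norm_def)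

text \<open>The estimates at \<open>q = p\<close> and \<open>q = \<infinity>\<close> come with
  different functions. Both represent the same distribution, so they agree a.e. and one function
  carries both bounds, with \<open>C1 + C2\<close> as a common constant.\<close>

lemma flow_bound_exists:
  "\<exists>C>0. \<forall>f t. in_Lcap 1 r f \<longrightarrow> t \<ge> 0 \<longrightarrow>
     (\<exists>w. Lbd p w (C * (1 + t) powr (- 1 / p) * Lcap_norm 1 r f) \<and> rep f t w)"
proof -
  from linear_estimate[of "ereal p"] obtain C1 where C1: "C1 > 0"
    "\<And>f t. in_Lcap 1 r f \<Longrightarrow> t \<ge> 0 \<Longrightarrow> \<exists>w. in_Lp (ereal p) w \<and> rep f t w \<and>
       Lp_norm (ereal p) w \<le> C1 * (1 + t) powr (- 1 / p) * Lcap_norm 1 r f"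
    unfolding rep_def dk_def by auto
  from linear_estimate[of \<infinity>] obtain C2 where C2: "C2 > 0"
    "\<And>f t. in_Lcap 1 r f \<Longrightarrow> t \<ge> 0 \<Longrightarrow> \<exists>w. in_Lp \<infinity> w \<and> rep f t w \<and>
       Lp_norm \<infinity> w \<le> C2 * (1 + t) powr (- 1 / p) * Lcap_norm 1 r f"
    unfolding rep_def dk_def by auto
  have "\<exists>w. Lbd p w ((C1 + C2) * (1 + t) powr (- 1 / p) * Lcap_norm 1 r f) \<and> rep f t w"
    if f: "in_Lcap 1 r f" and t: "t \<ge> 0" for f t
  proof -
    let ?D = "(1 + t) powr (- 1 / p) * Lcap_norm 1 r f"
    have D: "?D \<ge> 0" using Lcap_norm_nonneg[OF f] by simp
    obtain w1 where w1: "in_Lp (ereal p) w1" "rep f t w1" "Lp_norm (ereal p) w1 \<le> C1 * ?D"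
      using C1(2)[OF f t] by (auto simp: mult.assoc)
    obtain w2 where w2: "in_Lp \<infinity> w2" "rep f t w2" "Lp_norm \<infinity> w2 \<le> C2 * ?D"
      using C2(2)[OF f t] by (auto simp: mult.assoc)
    have [measurable]: "w1 \<in> borel_measurable borel" "w2 \<in> borel_measurable borel"
      using w1(1) w2(1) by (auto simp: in_Lp_def)
    have int: "integrable lborel (\<lambda>x. w1 x * \<psi> x)" "integrable lborel (\<lambda>x. w2 x * \<psi> x)"
      if \<psi>: "integrable lborel \<psi>" and M: "\<And>x. \<bar>\<psi> x\<bar> \<le> M" for \<psi> M
    proof -
      show "integrable lborel (\<lambda>x. w1 x * \<psi> x)" using in_Lp_mult_integrable[OF w1(1) _ \<psi> M] p by simp
      have [measurable]: "\<psi> \<in> borel_measurable borel" using \<psi> by auto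
      show "integrable lborel (\<lambda>x. w2 x * \<psi> x)"
      proof (rule Bochner_Integration.integrable_bound)
        show "integrable lborel (\<lambda>x. Lp_norm \<infinity> w2 * \<bar>\<psi> x\<bar>)"
          by (intro integrable_mult_right integrable_abs \<psi>)
        show "AE x in lborel. norm (w2 x * \<psi> x) \<le> norm (Lp_norm \<infinity> w2 * \<bar>\<psi> x\<bar>)"
          using in_Lp_infinity(1)[OF w2(1)]
          by eventually_elim (use in_Lp_infinity(2)[OF w2(1)] in \<open>auto simp: abs_mult intro!: mult_right_mono\<close>)
      qed simp
    qed
    have "AE x in lborel. w1 x - w2 x = 0"
    proof (rule AE_zero_if_dist_of_zero)
      fix a b :: "real^'n"
      have i: "integrable lborel (indicat_real (cbox a b))"
        by (intro integrable_real_indicator) (auto simp: emeasure_lborel_cbox_finite[unfolded infinity_ennreal_def])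
      have "set_integrable lborel (cbox a b) w1" "set_integrable lborel (cbox a b) w2"
        unfolding set_integrable_def using int[OF i, of 1] by (auto simp: mult.commute indicator_def)
      then show "set_integrable lborel (cbox a b) (\<lambda>x. w1 x - w2 x)" by (rule set_integral_diff)
    next
      fix \<phi> :: "real^'n \<Rightarrow> real" assume \<phi>: "schwartz \<phi>"
      obtain M where M: "\<And>x. \<bar>\<phi> x\<bar> \<le> M" using schwartz_decay[OF \<phi>, of 0] by auto
      have "dist_of w1 \<phi> = dist_of w2 \<phi>" using w1(2) w2(2) \<phi> by (simp add: rep_def)
      then show "dist_of (\<lambda>x. w1 x - w2 x) \<phi> = 0"
        using int[OF schwartz_integrable[OF \<phi>] M] by (simp add: dist_of_def left_diff_distrib)
    qed simp
    then have eq: "AE x in lborel. w1 x = w2 x" by simp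
    have "Lbd p w1 ((C1 + C2) * ?D)"
      unfolding Lbd_def
    proof (intro conjI)
      show "AE x in lborel. \<bar>w1 x\<bar> \<le> (C1 + C2) * ?D"
        using eq in_Lp_infinity(1)[OF w2(1)]
      proof eventually_elim
        case (elim x)
        have "C2 * ?D \<le> (C1 + C2) * ?D" using C1(1) D by (intro mult_right_mono) auto
        then show ?case using elim w2(3) by linarith
      qed
      have "Lp_norm (ereal p) w1 \<le> (C1 + C2) * ?D"
        using w1(3) C2(1) D mult_right_mono[of C1 "C1 + C2" ?D] by linarith
      then show "(\<integral>\<^sup>+x. ennreal (\<bar>w1 x\<bar> powr p) \<partial>lborel) \<le> ennreal (((C1 + C2) * ?D) powr p)"
        using in_Lp_finite[OF w1(1)] p by (auto intro!: ennreal_leI powr_mono2)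
    qed (use C1(1) C2(1) D in auto)
    then show ?thesis using w1(2) by (auto simp: mult.assoc)
  qed
  then show ?thesis using C1(1) C2(1) by (intro exI[of _ "C1 + C2"]) auto
qed

definition C :: real where
  "C = (SOME C. C > 0 \<and> (\<forall>f t. in_Lcap 1 r f \<longrightarrow> t \<ge> 0 \<longrightarrow>
     (\<exists>w. Lbd p w (C * (1 + t) powr (- 1 / p) * Lcap_norm 1 r f) \<and> rep f t w)))"

lemma C_pos: "C > 0"
  and flow_bound: "in_Lcap 1 r f \<Longrightarrow> t \<ge> 0 \<Longrightarrow>
    \<exists>w. Lbd p w (C * (1 + t) powr (- 1 / p) * Lcap_norm 1 r f) \<and> rep f t w"
  using someI_ex[OF flow_bound_exists, folded C_def] by auto

lemma rep_AE_unique: "rep f t v \<Longrightarrow> rep f t w \<Longrightarrow> Lbd p v A \<Longrightarrow> Lbd p w B \<Longrightarrow> AE x in lborel. v x = w x"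
  by (rule AE_eq_if_dist_of_eq) (auto simp: rep_def)

text \<open>A representative inherits the linear estimate even if the bound known for it is weak.
  This is applied to a difference of representatives, where the triangle inequality gives no
  smallness.\<close>

lemma rep_bound:
  assumes "in_Lcap 1 r f" "t \<ge> 0" "rep f t v" "Lbd p v A"
  shows "Lbd p v (C * (1 + t) powr (- 1 / p) * Lcap_norm 1 r f)"
proof -
  obtain w where w: "Lbd p w (C * (1 + t) powr (- 1 / p) * Lcap_norm 1 r f)" "rep f t w"
    using flow_bound[OF assms(1,2)] by blast
  show ?thesis
    by (rule Lbd_AE_cong[OF w(1) _ rep_AE_unique[OF assms(3) w(2) assms(4) w(1)]])
       (use assms(4) p in \<open>auto simp: Lbd_def\<close>)
qed

lemma dk_has_vector_derivative:
  assumes f: "in_Lcap 1 r f" and k: "k < m" and t: "t \<ge> 0" and \<phi>: "schwartz \<phi>"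
  shows "((\<lambda>s. dk k f s \<phi>) has_vector_derivative dk (Suc k) f t \<phi>) (at t within {0..})"
proof -
  have "(\<lambda>s. dk k f s \<phi>) differentiable (at t within {0..})"
    using linear_solution[OF f] k t \<phi> by (auto simp: linear_cauchy_def dk_def)
  moreover have "dk (Suc k) f t \<phi> = vector_derivative (\<lambda>s. dk k f s \<phi>) (at t within {0..})"
    by (simp add: dk_def t_deriv_def)
  ultimately show ?thesis by (simp add: vector_derivative_works[symmetric])
qed

lemma dk_0: "dk 0 f t \<phi> = conv (K t) f \<phi>"
  by (simp add: dk_def t_deriv_def)

lemma dk_continuous:
  assumes "in_Lcap 1 r f" "k < m" "schwartz \<phi>"
  shows "continuous_on {0..} (\<lambda>s. dk k f s \<phi>)"
  unfolding continuous_on_eq_continuous_within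
  using dk_has_vector_derivative[OF assms(1,2) _ assms(3)] has_vector_derivative_continuous by (metis atLeast_iff)

lemma dk_set_integrable:
  assumes "in_Lcap 1 r f" "k < m" "schwartz \<phi>"
  shows "set_integrable lborel {0..t} (\<lambda>s. dk k f s \<phi>)"
  unfolding set_integrable_def
  by (intro borel_integrable_compact continuous_on_subset[OF dk_continuous[OF assms]]) auto

text \<open>No boundary term arises: \<open>k < l \<le> m - 1\<close>, and the derivatives of order
  below \<open>m - 1\<close> vanish at time 0.\<close>

lemma dk_integral:
  assumes f: "in_Lcap 1 r f" and k: "k < l" and t: "t \<ge> 0" and \<phi>: "schwartz \<phi>"
  shows "dk k f t \<phi> = (LINT s:{0..t}|lborel. dk (Suc k) f s \<phi>)"
proof -
  have "((\<lambda>s. dk (Suc k) f s \<phi>) has_integral (dk k f t \<phi> - dk k f 0 \<phi>)) {0..t}"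
  proof (rule fundamental_theorem_of_calculus[OF t])
    fix s assume "s \<in> {0..t}"
    then show "((\<lambda>s. dk k f s \<phi>) has_vector_derivative dk (Suc k) f s \<phi>) (at s within {0..t})"
      using k l by (intro has_vector_derivative_within_subset[OF dk_has_vector_derivative[OF f _ _ \<phi>]]) auto
  qed
  moreover have "dk k f 0 \<phi> = 0"
    using linear_solution[OF f] k l \<phi> by (auto simp: linear_cauchy_def dk_def)
  ultimately show ?thesis
    using set_borel_integral_eq_integral(2)[OF dk_set_integrable[OF f _ \<phi>], of "Suc k" t] k l
    by (auto dest: integral_unique)
qed

lemma dk_l_bound:
  assumes f: "in_Lcap 1 r f" and t: "t \<ge> 0" and \<phi>: "schwartz \<phi>"
  shows "\<bar>dk l f t \<phi>\<bar> \<le> C * (LINT x|lborel. \<bar>\<phi> x\<bar>) * Lcap_norm 1 r f"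
proof -
  obtain w where w: "Lbd p w (C * (1 + t) powr (- 1 / p) * Lcap_norm 1 r f)" "rep f t w"
    using flow_bound[OF f t] by blast
  have N: "Lcap_norm 1 r f \<ge> 0" by (rule Lcap_norm_nonneg[OF f])
  have I: "(LINT x|lborel. \<bar>\<phi> x\<bar>) \<ge> 0" by simp
  have "(1 + t) powr (- 1 / p) \<le> (1 + t) powr 0" using t p by (intro powr_mono) auto
  then have le: "(1 + t) powr (- 1 / p) \<le> 1" using t by simp
  have "\<bar>dk l f t \<phi>\<bar> \<le> C * (1 + t) powr (- 1 / p) * Lcap_norm 1 r f * (LINT x|lborel. \<bar>\<phi> x\<bar>)"
    using Lbd_dist_of_bound[OF w(1) \<phi>] w(2) \<phi> by (simp add: rep_def)
  also have "\<dots> \<le> C * 1 * Lcap_norm 1 r f * (LINT x|lborel. \<bar>\<phi> x\<bar>)"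
    using C_pos N I le by (intro mult_right_mono mult_left_mono) auto
  finally show ?thesis by (simp add: mult_ac)
qed

text \<open>The linear estimate controls order \<open>l\<close> only. Each lower order is the time
  integral of the next one, at the cost of a factor \<open>|T|\<close>. The constant is uniform in
  \<open>f\<close>, as the Fubini arguments for families of data require.\<close>

lemma dk_bound:
  assumes \<phi>: "schwartz \<phi>" and k: "k \<le> l"
  shows "\<exists>B\<ge>0. \<forall>f t. in_Lcap 1 r f \<longrightarrow> 0 \<le> t \<longrightarrow> t \<le> T \<longrightarrow> \<bar>dk k f t \<phi>\<bar> \<le> B * Lcap_norm 1 r f"
  using k
proof (induction rule: inc_induct)
  case base
  show ?case
    using dk_l_bound[OF _ _ \<phi>] C_pos by (intro exI[of _ "C * (LINT x|lborel. \<bar>\<phi> x\<bar>)"]) auto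
next
  case (step k)
  then obtain B where B: "B \<ge> 0" "\<And>f t. in_Lcap 1 r f \<Longrightarrow> 0 \<le> t \<Longrightarrow> t \<le> T \<Longrightarrow> \<bar>dk (Suc k) f t \<phi>\<bar> \<le> B * Lcap_norm 1 r f"
    by blast
  have "\<bar>dk k f t \<phi>\<bar> \<le> \<bar>T\<bar> * B * Lcap_norm 1 r f" if f: "in_Lcap 1 r f" and t: "0 \<le> t" "t \<le> T" for f t
  proof -
    let ?BN = "B * Lcap_norm 1 r f"
    have BN: "?BN \<ge> 0" using B(1) Lcap_norm_nonneg[OF f] by simp
    have si: "set_integrable lborel {0..t} (\<lambda>s. dk (Suc k) f s \<phi>)"
      using step l by (intro dk_set_integrable f \<phi>) auto
    have ci: "set_integrable lborel {0..t} (\<lambda>s. ?BN)"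
      by (intro set_integrable_bounded[where B = ?BN]) (use BN in auto)
    have "\<bar>dk k f t \<phi>\<bar> = \<bar>LINT s:{0..t}|lborel. dk (Suc k) f s \<phi>\<bar>"
      using dk_integral[OF f _ t(1) \<phi>, of k] step by simp
    also have "\<dots> \<le> (LINT s:{0..t}|lborel. \<bar>dk (Suc k) f s \<phi>\<bar>)"
      using set_integral_norm_bound[OF si] by simp
    also have "\<dots> \<le> (LINT s:{0..t}|lborel. ?BN)"
      by (intro set_integral_mono set_integrable_abs si ci B(2)[OF f]) (use t in auto)
    also have "\<dots> = t * ?BN" using t by (simp add: set_lebesgue_integral_def)
    also have "\<dots> \<le> \<bar>T\<bar> * ?BN" using t BN by (intro mult_right_mono) auto
    finally show ?thesis by (simp add: mult.assoc)
  qed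
  then show ?case using B(1) by (intro exI[of _ "\<bar>T\<bar> * B"]) auto
qed

text \<open>Continuity in \<open>\<tau>\<close> is part of the notion of a fundamental solution; measurability in \<open>y\<close> is
  extracted from the existence of the convolution with indicators of balls.\<close>

lemma kernel_measurable:
  assumes \<phi>: "schwartz \<phi>"
  shows "(\<lambda>(\<tau>, y). K (max 0 \<tau>) (\<lambda>x. \<phi> (x + y))) \<in> borel_measurable (borel \<Otimes>\<^sub>M borel)"
proof -
  have "(\<lambda>(y, \<tau>). K (max 0 \<tau>) (\<lambda>x. \<phi> (x + y))) \<in> borel_measurable (borel \<Otimes>\<^sub>M borel)"
  proof (rule caratheodory_measurable)
    fix y :: "real^'n"
    have "(\<lambda>s. t_deriv 0 K s (\<lambda>x. \<phi> (x + y))) differentiable (at t within {0..})" if "t \<ge> 0" for t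
      using K schwartz_translate[OF \<phi>, of y] l that unfolding fundamental_solution_def linear_cauchy_def
      by (metis gr_zeroI not_less_zero)
    then have "continuous_on {0..} (\<lambda>s. K s (\<lambda>x. \<phi> (x + y)))"
      unfolding t_deriv_def
      by (intro differentiable_imp_continuous_on) (auto simp: differentiable_on_def)
    then have "continuous_on UNIV ((\<lambda>s. K s (\<lambda>x. \<phi> (x + y))) \<circ> (\<lambda>\<tau>. max 0 \<tau>))"
      by (intro continuous_on_compose) (auto intro!: continuous_intros elim: continuous_on_subset)
    then show "continuous_on UNIV (\<lambda>\<tau>. K (max 0 \<tau>) (\<lambda>x. \<phi> (x + y)))" by (simp add: o_def)
  next
    fix \<tau> :: real
    let ?k = "\<lambda>y. K (max 0 \<tau>) (\<lambda>x. \<phi> (x + y))"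
    show "?k \<in> borel_measurable borel"
    proof (rule borel_measurable_LIMSEQ_real)
      fix j :: nat
      obtain H where "Lbd 1 (indicator (ball (0::real^'n) (real j)) :: _ \<Rightarrow> real) H"
        using Lbd_indicator_ball by blast
      then have "in_Lcap 1 r (indicator (ball (0::real^'n) (real j)))" by (rule Lbd_in_Lcap[OF _ r])
      then have "conv_exists (K (max 0 \<tau>)) (indicator (ball (0::real^'n) (real j)))"
        using linear_solution by simp
      then show "(\<lambda>y. indicator (ball (0::real^'n) (real j)) y * ?k y) \<in> borel_measurable borel"
        using \<phi> unfolding conv_exists_def by (auto dest: borel_measurable_integrable)
    next
      fix y :: "real^'n"
      have "\<forall>\<^sub>F j in sequentially. ?k y = indicator (ball (0::real^'n) (real j)) y * ?k y"
      proof -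
        obtain N where "norm y < real N" using reals_Archimedean2 by blast
        then have "y \<in> ball 0 (real j)" if "j \<ge> N" for j using that by auto
        then show ?thesis by (auto simp: eventually_sequentially intro!: exI[of _ N])
      qed
      then show "(\<lambda>j. indicator (ball (0::real^'n) (real j)) y * ?k y) \<longlonglongrightarrow> ?k y"
        by (rule Lim_transform_eventually[OF tendsto_const])
    qed
  qed
  from measurable_compose[OF measurable_pair_swap' this] show ?thesis by (simp add: split_beta')
qed

text \<open>Time derivatives are limits of forward difference quotients.\<close>

lemma dk_measurable:
  assumes g[measurable]: "(\<lambda>(s, x). g s x) \<in> borel_measurable (borel \<Otimes>\<^sub>M borel)"
    and gL: "\<And>s. in_Lcap 1 r (g s)" and \<phi>: "schwartz \<phi>" and k: "k \<le> m"
  shows "(\<lambda>(\<tau>, s). dk k (g s) (max 0 \<tau>) \<phi>) \<in> borel_measurable (borel \<Otimes>\<^sub>M (borel :: real measure))"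
  using k
proof (induction k)
  case 0
  note [measurable] = kernel_measurable[OF \<phi>]
  show ?case
    unfolding dk_0 conv_def split_beta'
    by (rule lborel.borel_measurable_lebesgue_integral) measurable
next
  case (Suc k)
  then have IH[measurable]: "(\<lambda>(\<tau>, s). dk k (g s) (max 0 \<tau>) \<phi>) \<in> borel_measurable (borel \<Otimes>\<^sub>M borel)" by simp
  show ?case
  proof (rule borel_measurable_LIMSEQ_real)
    fix j :: nat
    \<comment> \<open>The outer \<open>max 0\<close> brings the term into the shape of the induction
      hypothesis.\<close>
    have "(\<lambda>(\<tau>, s). (dk k (g s) (max 0 (max 0 \<tau> + 1 / real (Suc j))) \<phi> - dk k (g s) (max 0 \<tau>) \<phi>) * real (Suc j))
       \<in> borel_measurable (borel \<Otimes>\<^sub>M borel)" by measurable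
    then show "(\<lambda>(\<tau>, s). (dk k (g s) (max 0 \<tau> + 1 / real (Suc j)) \<phi> - dk k (g s) (max 0 \<tau>) \<phi>) * real (Suc j))
       \<in> borel_measurable (borel \<Otimes>\<^sub>M borel)" by (simp add: max_def)
  next
    fix z :: "real \<times> real"
    obtain \<tau> s where z: "z = (\<tau>, s)" by (cases z)
    let ?t = "max 0 \<tau>"
    have "((\<lambda>\<theta>. dk k (g s) \<theta> \<phi>) has_real_derivative dk (Suc k) (g s) ?t \<phi>) (at ?t within {0..})"
      using dk_has_vector_derivative[OF gL _ _ \<phi>, of k ?t s] Suc
      by (simp add: has_real_derivative_iff_has_vector_derivative)
    then have lim: "((\<lambda>\<theta>. (dk k (g s) \<theta> \<phi> - dk k (g s) ?t \<phi>) / (\<theta> - ?t)) \<longlongrightarrow> dk (Suc k) (g s) ?t \<phi>) (at ?t within {0..})"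
      by (simp add: has_field_derivative_iff)
    have "filterlim (\<lambda>j. ?t + 1 / real (Suc j)) (at ?t within {0..}) sequentially"
      unfolding filterlim_at
    proof
      have "(\<lambda>j. ?t + 1 / real (Suc j)) \<longlonglongrightarrow> ?t + 0"
        by (intro tendsto_intros LIMSEQ_Suc lim_1_over_n)
      then show "(\<lambda>j. ?t + 1 / real (Suc j)) \<longlonglongrightarrow> ?t" by simp
    qed (auto intro!: always_eventually)
    from filterlim_compose[OF lim this]
    show "(\<lambda>j. case z of (\<tau>, s) \<Rightarrow> (dk k (g s) (max 0 \<tau> + 1 / real (Suc j)) \<phi> - dk k (g s) (max 0 \<tau>) \<phi>) * real (Suc j))
       \<longlonglongrightarrow> (case z of (\<tau>, s) \<Rightarrow> dk (Suc k) (g s) (max 0 \<tau>) \<phi>)"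
      by (simp add: z del: of_nat_Suc)
  qed
qed

text \<open>Convolution is linear in the datum, and linearity passes to each time derivative by
  uniqueness of derivatives within the half line.\<close>

lemma dk_diff:
  assumes f: "in_Lcap 1 r f1" "in_Lcap 1 r f2" "in_Lcap 1 r (\<lambda>x. f1 x - f2 x)" and \<phi>: "schwartz \<phi>" and k: "k \<le> m"
    and t: "t \<ge> 0"
  shows "dk k (\<lambda>x. f1 x - f2 x) t \<phi> = dk k f1 t \<phi> - dk k f2 t \<phi>"
  using k t
proof (induction k arbitrary: t)
  case 0
  have "integrable lborel (\<lambda>y. f1 y * K t (\<lambda>x. \<phi> (x + y)))" "integrable lborel (\<lambda>y. f2 y * K t (\<lambda>x. \<phi> (x + y)))"
    using linear_solution[OF f(1)] linear_solution[OF f(2)] \<phi> 0 by (auto simp: conv_exists_def)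
  then show ?case by (simp add: dk_0 conv_def left_diff_distrib)
next
  case (Suc k)
  have k: "k < m" using Suc by simp
  have "((\<lambda>s. dk k f1 s \<phi> - dk k f2 s \<phi>) has_vector_derivative dk (Suc k) f1 t \<phi> - dk (Suc k) f2 t \<phi>) (at t within {0..})"
    by (intro has_vector_derivative_diff dk_has_vector_derivative f k Suc \<phi>)
  then have "((\<lambda>s. dk k (\<lambda>x. f1 x - f2 x) s \<phi>) has_vector_derivative dk (Suc k) f1 t \<phi> - dk (Suc k) f2 t \<phi>) (at t within {0..})"
    by (rule has_vector_derivative_transform[rotated 2]) (use Suc in auto)
  moreover have "at t within {0..} \<noteq> bot"
  proof -
    have "at_right t \<le> at t within {0..}" using Suc.prems(2) by (intro at_le) auto
    then show ?thesis using trivial_limit_at_right_real[of t] by (metis bot.extremum_uniqueI)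
  qed
  ultimately show ?case
    using vector_derivative_unique_within[OF _ dk_has_vector_derivative[OF f(3) k Suc.prems(2) \<phi>]] by blast
qed

end

section \<open>The Duhamel term\<close>

text \<open>The bound is required for negative \<open>s\<close> as well; the families in use vanish there.\<close>

definition family :: "real \<Rightarrow> (real \<Rightarrow> 'a::euclidean_space \<Rightarrow> real) \<Rightarrow> bool" where
  "family q g \<longleftrightarrow> (\<lambda>(s, x). g s x) \<in> borel_measurable (borel \<Otimes>\<^sub>M borel) \<and>
     (\<forall>T. \<exists>H. \<forall>s\<le>T. Lbd q (g s) H)"

lemma family_measurable: "family q g \<Longrightarrow> (\<lambda>(s, x). g s x) \<in> borel_measurable (borel \<Otimes>\<^sub>M borel)"
  by (simp add: family_def)

lemma family_bound:
  assumes "family q g" "q \<ge> 0"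
  obtains H where "H > 0" "\<And>s. s \<le> T \<Longrightarrow> Lbd q (g s) H"
proof -
  obtain H where H: "\<And>s. s \<le> T \<Longrightarrow> Lbd q (g s) H" using assms unfolding family_def by blast
  show ?thesis
  proof (rule that[of "\<bar>H\<bar> + 1"])
    show "Lbd q (g s) (\<bar>H\<bar> + 1)" if "s \<le> T" for s by (rule Lbd_mono[OF H[OF that]]) (use assms in auto)
  qed simp
qed

lemma family_in_Lcap: "family 1 g \<Longrightarrow> r \<ge> 1 \<Longrightarrow> in_Lcap 1 r (g s)"
  using Lbd_in_Lcap(1) unfolding family_def by blast

text \<open>The variant of \<open>family\<close> with bounds at almost every time: it is preserved
  by primitives in time, and \<open>Linf_loc\<close> follows from it.\<close>

definition loc_bdd :: "real \<Rightarrow> (real \<Rightarrow> 'a::euclidean_space \<Rightarrow> real) \<Rightarrow> bool" where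
  "loc_bdd p u \<longleftrightarrow> (\<lambda>(s, x). u s x) \<in> borel_measurable (borel \<Otimes>\<^sub>M borel) \<and>
     (\<forall>T. \<exists>B. AE s in lborel. s \<in> {0..T} \<longrightarrow> Lbd p (u s) B)"

lemma loc_bdd_measurable: "loc_bdd p u \<Longrightarrow> (\<lambda>(s, x). u s x) \<in> borel_measurable (borel \<Otimes>\<^sub>M borel)"
  by (simp add: loc_bdd_def)

lemma loc_bdd_bound:
  assumes "loc_bdd p u" "p > 1"
  obtains B where "B > 0" "AE s in lborel. s \<in> {0..T} \<longrightarrow> Lbd p (u s) B"
proof -
  obtain B where B: "AE s in lborel. s \<in> {0..T} \<longrightarrow> Lbd p (u s) B" using assms unfolding loc_bdd_def by blast
  show ?thesis
  proof (rule that[of "\<bar>B\<bar> + 1"])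
    show "AE s in lborel. s \<in> {0..T} \<longrightarrow> Lbd p (u s) (\<bar>B\<bar> + 1)"
      using B by eventually_elim (use assms(2) in \<open>auto elim!: Lbd_mono\<close>)
  qed simp
qed

section \<open>Primitives in time\<close>

definition primitive :: "(real \<Rightarrow> 'a::euclidean_space \<Rightarrow> real) \<Rightarrow> real \<Rightarrow> 'a \<Rightarrow> real" where
  "primitive u t x = (LINT s:{0..t}|lborel. u s x)"

lemma primitive_measurable:
  assumes m[measurable]: "(\<lambda>(s, x). u s x) \<in> borel_measurable (borel \<Otimes>\<^sub>M borel)"
  shows "(\<lambda>(s, x). primitive u s x) \<in> borel_measurable (borel \<Otimes>\<^sub>M borel)"
proof -
  have ind: "indicat_real {0..t} s = (if 0 \<le> s \<and> s \<le> t then 1 else 0)" for t s by auto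
  show ?thesis
    unfolding primitive_def set_lebesgue_integral_def split_beta' ind
    by (rule lborel.borel_measurable_lebesgue_integral) measurable
qed

text \<open>The summand 1 in \<open>\<bar>T\<bar> + 1\<close> keeps the bound positive, as
  \<open>time_integral_Lbd\<close> demands, also when the interval is empty or a point.\<close>

lemma primitive_Lbd:
  assumes p: "p > 1" and m: "(\<lambda>(s, x). u s x) \<in> borel_measurable (borel \<Otimes>\<^sub>M borel)"
    and B: "B > 0" "AE s in lborel. s \<in> {0..T} \<longrightarrow> Lbd p (u s) B" and t: "t \<le> T"
  shows "Lbd p (primitive u t) ((\<bar>T\<bar> + 1) * B)"
    and "AE x in lborel. set_integrable lborel {0..t} (\<lambda>s. u s x)"
proof -
  have "AE s in lborel. s \<in> {0..t} \<longrightarrow> Lbd p (u s) B"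
    using B(2) by eventually_elim (use t in auto)
  moreover have "set_integrable lborel {0..t} (\<lambda>s. B)"
    by (rule set_integrable_bounded[where B = B]) (use B in auto)
  moreover have "(LINT s:{0..t}|lborel. B) \<le> (\<bar>T\<bar> + 1) * B"
  proof (cases "t \<ge> 0")
    case True
    then show ?thesis using B t by (simp add: set_lebesgue_integral_def)
  next
    case False
    then show ?thesis using B by (simp add: set_lebesgue_integral_def)
  qed
  moreover have "(\<bar>T\<bar> + 1) * B > 0" using B by simp
  ultimately show "Lbd p (primitive u t) ((\<bar>T\<bar> + 1) * B)" "AE x in lborel. set_integrable lborel {0..t} (\<lambda>s. u s x)"
    using time_integral_Lbd[OF p _ m, of "{0..t}" "\<lambda>_. B"] B(1) unfolding primitive_def[abs_def] by auto
qed

lemma loc_bdd_primitive: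
  assumes p: "p > 1" and u: "loc_bdd p u"
  shows "loc_bdd p (primitive u)"
  unfolding loc_bdd_def
proof (intro conjI allI)
  note m = loc_bdd_measurable[OF u]
  show "(\<lambda>(s, x). primitive u s x) \<in> borel_measurable (borel \<Otimes>\<^sub>M borel)" by (rule primitive_measurable[OF m])
  fix T
  obtain B where B: "B > 0" "AE s in lborel. s \<in> {0..T} \<longrightarrow> Lbd p (u s) B"
    using loc_bdd_bound[OF u p] by blast
  show "\<exists>B. AE s in lborel. s \<in> {0..T} \<longrightarrow> Lbd p (primitive u s) B"
    using primitive_Lbd(1)[OF p m B] by (intro exI[of _ "(\<bar>T\<bar> + 1) * B"] AE_I2) auto
qed

lemma loc_bdd_primitive_iterate: "p > 1 \<Longrightarrow> loc_bdd p u \<Longrightarrow> loc_bdd p ((primitive ^^ j) u)"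
  by (induction j) (auto intro: loc_bdd_primitive)

context linear_flow
begin

text \<open>The functions chosen for the individual pairs are unrelated, but their pairings with a
  test function are values of \<open>dk\<close>, hence measurable in the pair. So the box integrals
  are measurable, and cube averages give the joint representative.\<close>

lemma J_exists:
  fixes g :: "real \<Rightarrow> real^'n \<Rightarrow> real"
  assumes g: "(\<lambda>(s, x). g s x) \<in> borel_measurable (borel \<Otimes>\<^sub>M borel)" and gL: "\<And>s. in_Lcap 1 r (g s)"
  shows "\<exists>\<sigma>. (\<lambda>(a, x). \<sigma> a x) \<in> borel_measurable ((borel \<Otimes>\<^sub>M borel) \<Otimes>\<^sub>M borel) \<and>
     (\<forall>\<tau> s. Lbd p (\<sigma> (\<tau>, s)) (C * (1 + max 0 \<tau>) powr (- 1 / p) * Lcap_norm 1 r (g s)) \<and>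
        rep (g s) (max 0 \<tau>) (\<sigma> (\<tau>, s)))"
proof -
  have "\<forall>a :: real \<times> real. \<exists>w. Lbd p w (C * (1 + max 0 (fst a)) powr (- 1 / p) * Lcap_norm 1 r (g (snd a))) \<and>
      rep (g (snd a)) (max 0 (fst a)) w"
    using flow_bound[OF gL] by simp
  then obtain w where w: "\<And>a. Lbd p (w a) (C * (1 + max 0 (fst a)) powr (- 1 / p) * Lcap_norm 1 r (g (snd a)))"
    "\<And>a :: real \<times> real. rep (g (snd a)) (max 0 (fst a)) (w a)" by metis
  let ?M = "borel \<Otimes>\<^sub>M borel :: (real \<times> real) measure"
  have [measurable]: "w a \<in> borel_measurable borel" for a using w(1) by (auto simp: Lbd_def)
  have int: "set_integrable lborel (cbox b c) (w a)" for a b c by (rule Lbd_set_integrable[OF w(1)])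
  have "(\<lambda>a. dist_of (w a) \<phi>) \<in> borel_measurable ?M" if \<phi>: "schwartz \<phi>" for \<phi>
  proof -
    have "dist_of (w a) \<phi> = dk l (g (snd a)) (max 0 (fst a)) \<phi>" for a
      using w(2)[of a] \<phi> by (simp add: rep_def)
    then show ?thesis using dk_measurable[OF g gL \<phi>, of l] l by (simp add: split_beta')
  qed
  then have "(\<lambda>a. LINT y:cbox b c|lborel. w a y) \<in> borel_measurable ?M" for b c
    by (intro cbox_integral_measurable int) auto
  with int obtain \<sigma> where \<sigma>: "(\<lambda>(a, x). \<sigma> a x) \<in> borel_measurable (?M \<Otimes>\<^sub>M borel)"
    "\<And>a. a \<in> space ?M \<Longrightarrow> AE x in lborel. \<sigma> a x = w a x"
    using jointly_measurable_representative[of ?M w] by blast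
  have eq: "AE x in lborel. \<sigma> a x = w a x" for a using \<sigma>(2)[of a] by (simp add: space_pair_measure)
  have [measurable]: "\<sigma> a \<in> borel_measurable borel" for a
    using measurable_compose[OF measurable_Pair1'[of a ?M borel] \<sigma>(1)] by (simp add: space_pair_measure)
  have "Lbd p (\<sigma> (\<tau>, s)) (C * (1 + max 0 \<tau>) powr (- 1 / p) * Lcap_norm 1 r (g s)) \<and>
        rep (g s) (max 0 \<tau>) (\<sigma> (\<tau>, s))" for \<tau> s
  proof
    show "Lbd p (\<sigma> (\<tau>, s)) (C * (1 + max 0 \<tau>) powr (- 1 / p) * Lcap_norm 1 r (g s))"
      using Lbd_AE_cong[OF w(1)[of "(\<tau>, s)"] _ eq] p by simp
    have "dist_of (\<sigma> (\<tau>, s)) \<phi> = dist_of (w (\<tau>, s)) \<phi>" if "schwartz \<phi>" for \<phi>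
      unfolding dist_of_def
    proof (rule integral_cong_AE)
      have [measurable]: "\<phi> \<in> borel_measurable borel" by (rule schwartz_measurable[OF that])
      show "(\<lambda>x. \<sigma> (\<tau>, s) x * \<phi> x) \<in> borel_measurable lborel" "(\<lambda>x. w (\<tau>, s) x * \<phi> x) \<in> borel_measurable lborel"
        by simp_all
      show "AE x in lborel. \<sigma> (\<tau>, s) x * \<phi> x = w (\<tau>, s) x * \<phi> x"
        using eq[of "(\<tau>, s)"] by eventually_elim simp
    qed
    then show "rep (g s) (max 0 \<tau>) (\<sigma> (\<tau>, s))" using w(2)[of "(\<tau>, s)"] by (simp add: rep_def)
  qed
  then show ?thesis using \<sigma>(1) by blast
qed

text \<open>\<open>J g (\<tau>, s)\<close> is \<open>\<partial>\<^sub>t\<^sup>l K(\<tau>) * g(s)\<close> as a function that is measurable in \<open>(\<tau>, s, x)\<close>. The linear estimate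
  provides representatives for each \<open>(\<tau>, s)\<close> separately only.\<close>

definition J :: "(real \<Rightarrow> real^'n \<Rightarrow> real) \<Rightarrow> real \<times> real \<Rightarrow> real^'n \<Rightarrow> real" where
  "J g = (SOME \<sigma>. (\<lambda>(a, x). \<sigma> a x) \<in> borel_measurable ((borel \<Otimes>\<^sub>M borel) \<Otimes>\<^sub>M borel) \<and>
     (\<forall>\<tau> s. Lbd p (\<sigma> (\<tau>, s)) (C * (1 + max 0 \<tau>) powr (- 1 / p) * Lcap_norm 1 r (g s)) \<and>
        rep (g s) (max 0 \<tau>) (\<sigma> (\<tau>, s))))"

lemma
  assumes g: "(\<lambda>(s, x). g s x) \<in> borel_measurable (borel \<Otimes>\<^sub>M borel)" and gL: "\<And>s. in_Lcap 1 r (g s)"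
  shows J_measurable: "(\<lambda>(a, x). J g a x) \<in> borel_measurable ((borel \<Otimes>\<^sub>M borel) \<Otimes>\<^sub>M borel)"
    and J_Lbd: "Lbd p (J g (\<tau>, s)) (C * (1 + max 0 \<tau>) powr (- 1 / p) * Lcap_norm 1 r (g s))"
    and J_rep: "rep (g s) (max 0 \<tau>) (J g (\<tau>, s))"
  using someI_ex[OF J_exists[OF assms], folded J_def] by auto

lemma decay_le_1: "t \<ge> 0 \<Longrightarrow> (1 + t) powr (- 1 / p) \<le> 1"
  using p powr_mono[of "- 1 / p" 0 "1 + t"] by simp

text \<open>\<open>J\<close> is obtained by choice and is not literally linear in \<open>g\<close>.
  The difference still represents the flow of the difference of the data, by linearity of
  \<open>dk\<close>, and \<open>rep_bound\<close> then yields the linear estimate for it.\<close>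

lemma J_diff_Lbd:
  assumes g: "family 1 g1" "family 1 g2" and H: "Lbd 1 (\<lambda>x. g1 s x - g2 s x) H" and \<tau>: "\<tau> \<ge> 0"
  shows "Lbd p (\<lambda>x. J g1 (\<tau>, s) x - J g2 (\<tau>, s) x) (2 * C * (1 + \<tau>) powr (- 1 / p) * H)"
proof -
  note 1 = J_Lbd[OF family_measurable[OF g(1)] family_in_Lcap[OF g(1) r]]
    J_rep[OF family_measurable[OF g(1)] family_in_Lcap[OF g(1) r]]
  note 2 = J_Lbd[OF family_measurable[OF g(2)] family_in_Lcap[OF g(2) r]]
    J_rep[OF family_measurable[OF g(2)] family_in_Lcap[OF g(2) r]]
  let ?f = "\<lambda>x. g1 s x - g2 s x"
  have f: "in_Lcap 1 r ?f" "Lcap_norm 1 r ?f \<le> 2 * H" using Lbd_in_Lcap[OF H r] by auto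
  have L: "Lbd p (\<lambda>x. J g1 (\<tau>, s) x - J g2 (\<tau>, s) x)
     (C * (1 + max 0 \<tau>) powr (- 1 / p) * Lcap_norm 1 r (g1 s) + C * (1 + max 0 \<tau>) powr (- 1 / p) * Lcap_norm 1 r (g2 s))"
    using p by (intro Lbd_diff 1 2) simp
  have "rep ?f \<tau> (\<lambda>x. J g1 (\<tau>, s) x - J g2 (\<tau>, s) x)"
    unfolding rep_def
  proof (intro allI impI)
    fix \<phi> :: "real^'n \<Rightarrow> real" assume \<phi>: "schwartz \<phi>"
    have "dist_of (\<lambda>x. J g1 (\<tau>, s) x - J g2 (\<tau>, s) x) \<phi> = dist_of (J g1 (\<tau>, s)) \<phi> - dist_of (J g2 (\<tau>, s)) \<phi>"
      unfolding dist_of_def left_diff_distrib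
      by (rule Bochner_Integration.integral_diff[OF Lbd_schwartz_integrable[OF 1(1) \<phi>] Lbd_schwartz_integrable[OF 2(1) \<phi>]])
    then show "dk l ?f \<tau> \<phi> = dist_of (\<lambda>x. J g1 (\<tau>, s) x - J g2 (\<tau>, s) x) \<phi>"
      using dk_diff[OF family_in_Lcap[OF g(1) r] family_in_Lcap[OF g(2) r] f(1) \<phi>, of l \<tau>] l \<tau>
        1(2)[of s \<tau>] 2(2)[of s \<tau>] \<phi> by (simp add: rep_def)
  qed
  from rep_bound[OF f(1) \<tau> this L]
  have "Lbd p (\<lambda>x. J g1 (\<tau>, s) x - J g2 (\<tau>, s) x) (C * (1 + \<tau>) powr (- 1 / p) * Lcap_norm 1 r ?f)" .
  moreover have "C * (1 + \<tau>) powr (- 1 / p) * Lcap_norm 1 r ?f \<le> C * (1 + \<tau>) powr (- 1 / p) * (2 * H)"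
    using C_pos f(2) by (intro mult_left_mono) auto
  ultimately show ?thesis using p by (auto elim!: Lbd_mono simp: mult_ac)
qed

definition \<Phi> :: "(real \<Rightarrow> real^'n \<Rightarrow> real) \<Rightarrow> real \<Rightarrow> real^'n \<Rightarrow> real" where
  "\<Phi> g t x = (LINT s:{0..t}|lborel. J g (t - s, s) x)"

lemma J_slice_measurable:
  assumes g: "family 1 g"
  shows "(\<lambda>(s, x). J g (t - s, s) x) \<in> borel_measurable (borel \<Otimes>\<^sub>M borel)"
proof -
  note J_measurable[OF family_measurable[OF g] family_in_Lcap[OF g r], measurable]
  show ?thesis by measurable
qed

lemma J_slice_Lbd:
  assumes g: "family 1 g" and H: "Lbd 1 (g s) H" and s: "s \<in> {0..t}"
  shows "Lbd p (J g (t - s, s)) (2 * C * H)"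
proof -
  have "C * (1 + max 0 (t - s)) powr (- 1 / p) * Lcap_norm 1 r (g s) \<le> C * 1 * (2 * H)"
    using C_pos decay_le_1[of "max 0 (t - s)"] Lbd_in_Lcap[OF H r] H Lcap_norm_nonneg
    by (intro mult_mono) (auto simp: Lbd_def)
  then show ?thesis
    using J_Lbd[OF family_measurable[OF g] family_in_Lcap[OF g r], of "t - s" s] p
    by (auto elim!: Lbd_mono simp: mult_ac)
qed

lemma J_slice_bound:
  assumes g: "family 1 g"
  obtains B where "B > 0" "\<And>s t. s \<in> {0..t} \<Longrightarrow> t \<le> T \<Longrightarrow> Lbd p (J g (t - s, s)) B"
proof -
  obtain H where H: "H > 0" "\<And>s. s \<le> T \<Longrightarrow> Lbd 1 (g s) H" using family_bound[OF g zero_le_one] by blast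
  show ?thesis using that[of "2 * C * H"] H C_pos J_slice_Lbd[OF g] by simp
qed

lemma \<Phi>_measurable:
  assumes g: "family 1 g"
  shows "(\<lambda>(t, x). \<Phi> g t x) \<in> borel_measurable (borel \<Otimes>\<^sub>M borel)"
proof -
  note J_measurable[OF family_measurable[OF g] family_in_Lcap[OF g r], measurable]
  have ind: "indicat_real {0..t} s = (if 0 \<le> s \<and> s \<le> t then 1 else 0)" for t s by auto
  show ?thesis
    unfolding \<Phi>_def set_lebesgue_integral_def split_beta' ind
    by (rule lborel.borel_measurable_lebesgue_integral) measurable
qed

lemma \<Phi>_integrable:
  assumes g: "family 1 g"
  shows "AE x in lborel. set_integrable lborel {0..t} (\<lambda>s. J g (t - s, s) x)"
proof -
  obtain B where B: "B > 0" "\<And>s t'. s \<in> {0..t'} \<Longrightarrow> t' \<le> t \<Longrightarrow> Lbd p (J g (t' - s, s)) B"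
    using J_slice_bound[OF g] by blast
  have "AE s in lborel. s \<in> {0..t} \<longrightarrow> Lbd p (J g (t - s, s)) B" using B(2) by (intro AE_I2) auto
  from primitive_Lbd(2)[OF p J_slice_measurable[OF g] B(1) this order_refl] show ?thesis .
qed

text \<open>The common source of the contraction estimate and of the short time estimate for
  uniqueness, which differ only in the source bound \<open>H\<close>.\<close>

lemma \<Phi>_diff_Lbd:
  assumes g: "family 1 g1" "family 1 g2"
    and H: "AE s in lborel. s \<in> {0..t} \<longrightarrow> Lbd 1 (\<lambda>x. g1 s x - g2 s x) (H s)" "\<And>s. s \<in> {0..t} \<Longrightarrow> H s > 0"
    and int: "set_integrable lborel {0..t} (\<lambda>s. 2 * C * (1 + (t - s)) powr (- 1 / p) * H s)"
      "(LINT s:{0..t}|lborel. 2 * C * (1 + (t - s)) powr (- 1 / p) * H s) \<le> B" "B > 0"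
  shows "Lbd p (\<lambda>x. \<Phi> g1 t x - \<Phi> g2 t x) B"
proof -
  let ?\<sigma> = "\<lambda>s x. J g1 (t - s, s) x - J g2 (t - s, s) x"
  note [measurable] = J_slice_measurable[OF g(1)] J_slice_measurable[OF g(2)] \<Phi>_measurable[OF g(1)] \<Phi>_measurable[OF g(2)]
  have m: "(\<lambda>(s, x). ?\<sigma> s x) \<in> borel_measurable (borel \<Otimes>\<^sub>M borel)" by measurable
  have [measurable]: "\<Phi> g1 t \<in> borel_measurable borel" "\<Phi> g2 t \<in> borel_measurable borel"
    using measurable_compose[OF measurable_Pair1'[of t borel borel] \<Phi>_measurable[OF g(1)]]
      measurable_compose[OF measurable_Pair1'[of t borel borel] \<Phi>_measurable[OF g(2)]] by simp_all
  have "AE s in lborel. s \<in> {0..t} \<longrightarrow> Lbd p (?\<sigma> s) (2 * C * (1 + (t - s)) powr (- 1 / p) * H s)"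
    using H(1) by eventually_elim (intro impI J_diff_Lbd g, auto)
  moreover have "2 * C * (1 + (t - s)) powr (- 1 / p) * H s > 0" if "s \<in> {0..t}" for s
    using C_pos H(2)[OF that] that by auto
  ultimately have L: "Lbd p (\<lambda>x. LINT s:{0..t}|lborel. ?\<sigma> s x) B"
    using time_integral_Lbd(2)[OF p _ m int(1) _ int(2,3)] by simp
  have "AE x in lborel. \<Phi> g1 t x - \<Phi> g2 t x = (LINT s:{0..t}|lborel. ?\<sigma> s x)"
    using \<Phi>_integrable[OF g(1), of t] \<Phi>_integrable[OF g(2), of t]
    by eventually_elim (simp add: \<Phi>_def set_integral_diff)
  from Lbd_AE_cong[OF L _ this] p show ?thesis by simp
qed

lemma \<Phi>_bound:
  assumes g: "family 1 g"
  obtains B where "B > 0" "\<And>t. t \<le> T \<Longrightarrow> Lbd p (\<Phi> g t) B"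
proof -
  obtain B where B: "B > 0" "\<And>s t'. s \<in> {0..t'} \<Longrightarrow> t' \<le> T \<Longrightarrow> Lbd p (J g (t' - s, s)) B"
    using J_slice_bound[OF g] by blast
  have "Lbd p (\<Phi> g t) ((\<bar>T\<bar> + 1) * B)" if t: "t \<le> T" for t
  proof -
    have "AE s in lborel. s \<in> {0..t} \<longrightarrow> Lbd p (J g (t - s, s)) B" using B(2) t by (intro AE_I2) auto
    from primitive_Lbd(1)[OF p J_slice_measurable[OF g] B(1) this order_refl]
    have L: "Lbd p (\<Phi> g t) ((\<bar>t\<bar> + 1) * B)" by (simp add: primitive_def[abs_def] \<Phi>_def[abs_def])
    show ?thesis
    proof (cases "t \<ge> 0")
      case True
      then show ?thesis using t B(1) p by (intro Lbd_mono[OF L] mult_right_mono) auto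
    next
      case False
      have "\<Phi> g t = (\<lambda>_. 0)" using False by (simp add: \<Phi>_def[abs_def] set_lebesgue_integral_def)
      then show ?thesis using Lbd_mono[OF Lbd_zero, of "(\<bar>T\<bar> + 1) * B" p] B(1) p by simp
    qed
  qed
  then show ?thesis using that[of "(\<bar>T\<bar> + 1) * B"] B(1) by simp
qed

lemma \<Phi>_dist_of:
  assumes g: "family 1 g" and t: "t \<ge> 0" and \<phi>: "schwartz \<phi>"
  shows "dist_of (\<Phi> g t) \<phi> = (LINT s:{0..t}|lborel. dk l (g s) (t - s) \<phi>)"
proof -
  obtain B where B: "B > 0" "\<And>s t'. s \<in> {0..t'} \<Longrightarrow> t' \<le> t \<Longrightarrow> Lbd p (J g (t' - s, s)) B"
    using J_slice_bound[OF g] by blast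
  have "AE s in lborel. s \<in> {0..t} \<longrightarrow> Lbd p (J g (t - s, s)) B" using B(2) by (intro AE_I2) auto
  from dist_of_time_integral(2)[OF J_slice_measurable[OF g] this \<phi>]
  have "dist_of (\<Phi> g t) \<phi> = (LINT s:{0..t}|lborel. dist_of (J g (t - s, s)) \<phi>)"
    by (simp add: \<Phi>_def[abs_def])
  also have "\<dots> = (LINT s:{0..t}|lborel. dk l (g s) (t - s) \<phi>)"
    unfolding set_lebesgue_integral_def
  proof (rule Bochner_Integration.integral_cong[OF refl])
    fix s
    have "rep (g s) (max 0 (t - s)) (J g (t - s, s))"
      by (rule J_rep[OF family_measurable[OF g] family_in_Lcap[OF g r]])
    then show "indicat_real {0..t} s *\<^sub>R dist_of (J g (t - s, s)) \<phi> = indicat_real {0..t} s *\<^sub>R dk l (g s) (t - s) \<phi>"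
      using \<phi> by (auto simp: rep_def indicator_def)
  qed
  finally show ?thesis .
qed

text \<open>A datum is a family that is constant in \<open>s\<close>, so \<open>J\<close> supplies
  its flow as a measurable function too.\<close>

definition U :: "(real^'n \<Rightarrow> real) \<Rightarrow> real \<Rightarrow> real^'n \<Rightarrow> real" where
  "U f t x = J (\<lambda>_. f) (t, 0) x"

lemma const_family:
  assumes "in_Lcap 1 r f"
  shows "(\<lambda>(s :: real, x). f x) \<in> borel_measurable (borel \<Otimes>\<^sub>M borel)"
proof -
  have [measurable]: "f \<in> borel_measurable borel" using assms by (auto simp: in_Lcap_def in_Lp_def)
  show ?thesis by measurable
qed

lemma U_measurable:
  assumes f: "in_Lcap 1 r f"
  shows "(\<lambda>(t, x). U f t x) \<in> borel_measurable (borel \<Otimes>\<^sub>M borel)"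
proof -
  note J_measurable[OF const_family[OF f] f, measurable]
  show ?thesis unfolding U_def by measurable
qed

lemma U_Lbd:
  assumes f: "in_Lcap 1 r f" and t: "t \<ge> 0"
  shows "Lbd p (U f t) (C * (1 + t) powr (- 1 / p) * Lcap_norm 1 r f)"
  using J_Lbd[OF const_family[OF f] f, of t 0] t by (simp add: U_def[abs_def])

lemma U_dist_of:
  assumes f: "in_Lcap 1 r f" and t: "t \<ge> 0" and \<phi>: "schwartz \<phi>"
  shows "dist_of (U f t) \<phi> = dk l f t \<phi>"
  using J_rep[OF const_family[OF f] f, of t 0] t \<phi> by (simp add: U_def[abs_def] rep_def)

text \<open>\<open>V f g\<close> is \<open>\<partial>\<^sub>t\<^sup>l u\<close> for the solution \<open>u\<close> of \<open>L u = g\<close> with datum \<open>f\<close>.\<close>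

definition V :: "(real^'n \<Rightarrow> real) \<Rightarrow> (real \<Rightarrow> real^'n \<Rightarrow> real) \<Rightarrow> real \<Rightarrow> real^'n \<Rightarrow> real" where
  "V f g t x = U f t x + \<Phi> g t x"

lemma V_measurable:
  assumes f: "in_Lcap 1 r f" and g: "family 1 g"
  shows "(\<lambda>(t, x). V f g t x) \<in> borel_measurable (borel \<Otimes>\<^sub>M borel)"
proof -
  note [measurable] = U_measurable[OF f] \<Phi>_measurable[OF g]
  show ?thesis unfolding V_def by measurable
qed

lemma V_bound:
  assumes f: "in_Lcap 1 r f" and g: "family 1 g"
  shows "\<exists>B. \<forall>t\<in>{0..T}. Lbd p (V f g t) B"
proof -
  obtain B where B: "B > 0" "\<And>t. t \<le> T \<Longrightarrow> Lbd p (\<Phi> g t) B" using \<Phi>_bound[OF g] by blast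
  have "Lbd p (V f g t) (C * Lcap_norm 1 r f + B)" if t: "t \<in> {0..T}" for t
  proof -
    have "C * (1 + t) powr (- 1 / p) * Lcap_norm 1 r f \<le> C * 1 * Lcap_norm 1 r f"
      using t C_pos decay_le_1[of t] Lcap_norm_nonneg[OF f] by (intro mult_right_mono mult_left_mono) auto
    then have "Lbd p (U f t) (C * Lcap_norm 1 r f)"
      using t p by (intro Lbd_mono[OF U_Lbd[OF f]]) auto
    then show ?thesis unfolding V_def[abs_def] using t B(2) p by (intro Lbd_add) auto
  qed
  then show ?thesis by blast
qed

lemma V_loc_bdd: "in_Lcap 1 r f \<Longrightarrow> family 1 g \<Longrightarrow> loc_bdd p (V f g)"
  unfolding loc_bdd_def using V_measurable V_bound by (fast intro: AE_I2)

section \<open>The Duhamel identity as a statement about pairings\<close>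

lemma dk_family_integrable:
  assumes g: "family 1 g" and \<phi>: "schwartz \<phi>" and k: "k \<le> l" and t: "t \<ge> 0"
  shows "set_integrable lborel {0..t} (\<lambda>s. dk k (g s) (t - s) \<phi>)"
    and "\<exists>B. \<forall>\<tau> s. 0 \<le> \<tau> \<longrightarrow> \<tau> \<le> t \<longrightarrow> s \<le> t \<longrightarrow> \<bar>dk k (g s) (max 0 \<tau>) \<phi>\<bar> \<le> B"
proof -
  obtain B where B: "B \<ge> 0" "\<And>f \<tau>. in_Lcap 1 r f \<Longrightarrow> 0 \<le> \<tau> \<Longrightarrow> \<tau> \<le> t \<Longrightarrow> \<bar>dk k f \<tau> \<phi>\<bar> \<le> B * Lcap_norm 1 r f"
    using dk_bound[OF \<phi> k] by blast
  obtain H where H: "H > 0" "\<And>s. s \<le> t \<Longrightarrow> Lbd 1 (g s) H" using family_bound[OF g zero_le_one] by blast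
  have bd: "\<bar>dk k (g s) \<tau> \<phi>\<bar> \<le> B * (2 * H)" if "0 \<le> \<tau>" "\<tau> \<le> t" "s \<le> t" for \<tau> s
    using B(2)[OF family_in_Lcap[OF g r] that(1,2), of s] mult_left_mono[OF Lbd_in_Lcap(2)[OF H(2)[OF that(3)] r] B(1)]
    by linarith
  then show "\<exists>B. \<forall>\<tau> s. 0 \<le> \<tau> \<longrightarrow> \<tau> \<le> t \<longrightarrow> s \<le> t \<longrightarrow> \<bar>dk k (g s) (max 0 \<tau>) \<phi>\<bar> \<le> B"
    by (intro exI[of _ "B * (2 * H)"]) auto
  note [measurable] = dk_measurable[OF family_measurable[OF g] family_in_Lcap[OF g r] \<phi>, of k]
  have "k \<le> m" using k l by simp
  then have m: "(\<lambda>s. dk k (g s) (max 0 (t - s)) \<phi>) \<in> borel_measurable borel"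
    using measurable_compose[of "\<lambda>s. (t - s, s)" borel "borel \<Otimes>\<^sub>M borel", OF _
      dk_measurable[OF family_measurable[OF g] family_in_Lcap[OF g r] \<phi>, of k]] by simp
  have "set_integrable lborel {0..t} (\<lambda>s. dk k (g s) (max 0 (t - s)) \<phi>)"
    using bd by (intro set_integrable_bounded[where B = "B * (2 * H)"] m AE_I2) auto
  then show "set_integrable lborel {0..t} (\<lambda>s. dk k (g s) (t - s) \<phi>)"
    by (rule set_integrable_cong[THEN iffD1, rotated 3]) auto
qed

text \<open>Each integration in time lowers the order of the derivative on \<open>K\<close> by one
  and preserves the convolution form, by \<open>time_integral_convolution\<close>. At
  \<open>j = l\<close> the right-hand side is that of the Duhamel identity.\<close>

lemma V_primitive_dist_of:
  assumes f: "in_Lcap 1 r f" and g: "family 1 g" and j: "j \<le> l" and t: "t \<ge> 0" and \<phi>: "schwartz \<phi>"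
  shows "dist_of ((primitive ^^ j) (V f g) t) \<phi> =
     dk (l - j) f t \<phi> + (LINT s:{0..t}|lborel. dk (l - j) (g s) (t - s) \<phi>)"
  using j t
proof (induction j arbitrary: t)
  case 0
  obtain B where "Lbd p (\<Phi> g t) B" using \<Phi>_bound[OF g] by blast
  then have "dist_of (V f g t) \<phi> = dist_of (U f t) \<phi> + dist_of (\<Phi> g t) \<phi>"
    unfolding dist_of_def V_def[abs_def] distrib_right
    by (intro Bochner_Integration.integral_add Lbd_schwartz_integrable[OF _ \<phi>]
          Lbd_schwartz_integrable[OF U_Lbd[OF f 0(2)] \<phi>])
  then show ?case using U_dist_of[OF f 0(2) \<phi>] \<Phi>_dist_of[OF g 0(2) \<phi>] by simp
next
  case (Suc j)
  let ?W = "(primitive ^^ j) (V f g)"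
  have loc: "loc_bdd p ?W" by (intro loc_bdd_primitive_iterate p V_loc_bdd f g)
  obtain B where B: "AE s in lborel. s \<in> {0..t} \<longrightarrow> Lbd p (?W s) B" using loc_bdd_bound[OF loc p] by blast
  define k where "k = l - Suc j"
  have k: "l - j = Suc k" "k < l" "Suc k \<le> l" using Suc.prems(1) by (auto simp: k_def)
  obtain B' where B': "\<And>\<tau> s. 0 \<le> \<tau> \<Longrightarrow> \<tau> \<le> t \<Longrightarrow> s \<le> t \<Longrightarrow> \<bar>dk (Suc k) (g s) (max 0 \<tau>) \<phi>\<bar> \<le> B'"
    using dk_family_integrable(2)[OF g \<phi> k(3) Suc.prems(2)] by blast
  have m: "(\<lambda>(\<tau>, s). dk (Suc k) (g s) (max 0 \<tau>) \<phi>) \<in> borel_measurable (borel \<Otimes>\<^sub>M borel)"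
    by (rule dk_measurable[OF family_measurable[OF g] family_in_Lcap[OF g r] \<phi>]) (use k l in simp)
  have A: "dk k (g s) (max 0 \<tau>) \<phi> = (LINT \<theta>:{0..\<tau>}|lborel. dk (Suc k) (g s) (max 0 \<theta>) \<phi>)" if "0 \<le> \<tau>" for \<tau> s
  proof -
    have "dk k (g s) (max 0 \<tau>) \<phi> = (LINT \<theta>:{0..\<tau>}|lborel. dk (Suc k) (g s) \<theta> \<phi>)"
      using dk_integral[OF family_in_Lcap[OF g r] k(2) that \<phi>] that by simp
    also have "\<dots> = (LINT \<theta>:{0..\<tau>}|lborel. dk (Suc k) (g s) (max 0 \<theta>) \<phi>)"
      by (rule set_lebesgue_integral_cong) auto
    finally show ?thesis .
  qed
  have mx: "(LINT s:{0..\<tau>}|lborel. dk i (g s) (max 0 (\<tau> - s)) \<phi>) = (LINT s:{0..\<tau>}|lborel. dk i (g s) (\<tau> - s) \<phi>)" for \<tau> i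
    by (rule set_lebesgue_integral_cong) auto
  note T = time_integral_convolution[OF m B' A, where t = t, unfolded mx]
  have "dist_of ((primitive ^^ Suc j) (V f g) t) \<phi> = (LINT \<tau>:{0..t}|lborel. dist_of (?W \<tau>) \<phi>)"
    using dist_of_time_integral(2)[OF loc_bdd_measurable[OF loc] B \<phi>] by (simp add: primitive_def[abs_def])
  also have "\<dots> = (LINT \<tau>:{0..t}|lborel. dk (Suc k) f \<tau> \<phi> + (LINT s:{0..\<tau>}|lborel. dk (Suc k) (g s) (\<tau> - s) \<phi>))"
    using Suc.IH Suc.prems by (intro set_lebesgue_integral_cong) (auto simp: k)
  also have "\<dots> = (LINT \<tau>:{0..t}|lborel. dk (Suc k) f \<tau> \<phi>) +
      (LINT \<tau>:{0..t}|lborel. (LINT s:{0..\<tau>}|lborel. dk (Suc k) (g s) (\<tau> - s) \<phi>))"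
    using k l T(2) by (intro set_integral_add dk_set_integrable f \<phi>) auto
  also have "\<dots> = dk k f t \<phi> + (LINT s:{0..t}|lborel. dk k (g s) (t - s) \<phi>)"
    using dk_integral[OF f k(2) Suc.prems(2) \<phi>] T(1) by simp
  finally show ?case by (simp add: k_def)
qed

text \<open>\<open>g\<close> is a version of \<open>F(v)\<close> bounded at every time, so that the
  linear theory applies to each \<open>g s\<close>; \<open>v\<close> is tied to it at almost every
  time only. The identity becomes an equality of distributions with the \<open>l\<close>-fold
  primitive.\<close>

lemma V_duhamel:
  assumes f: "in_Lcap 1 r f" and g: "family 1 g" and t: "t \<ge> 0"
    and m: "(\<lambda>(s, x). indicator {0..} s * F (v s x)) \<in> borel_measurable (borel \<Otimes>\<^sub>M borel)"
    and v: "AE s in lborel. s \<in> {0..t} \<longrightarrow> (\<lambda>x. F (v s x)) = g s"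
  shows "duhamel K F f u v t \<longleftrightarrow> (\<forall>\<phi>. schwartz \<phi> \<longrightarrow> dist_of (u t) \<phi> = dist_of ((primitive ^^ l) (V f g) t) \<phi>)"
proof -
  have ce: "conv_exists (K t) f" using linear_solution[OF f] t by blast
  have ceg: "AE s in lborel. s \<in> {0..t} \<longrightarrow> conv_exists (K (t - s)) (\<lambda>x. F (v s x))"
    using v by eventually_elim (use linear_solution[OF family_in_Lcap[OF g r]] in auto)
  have eq: "set_integrable lborel {0..t} (\<lambda>s. conv (K (t - s)) (\<lambda>x. F (v s x)) \<phi>) \<and>
     (LINT s:{0..t}|lborel. conv (K (t - s)) (\<lambda>x. F (v s x)) \<phi>) = (LINT s:{0..t}|lborel. dk 0 (g s) (t - s) \<phi>)"
    if \<phi>: "schwartz \<phi>" for \<phi>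
  proof -
    let ?c = "\<lambda>s. indicat_real {0..t} s *\<^sub>R conv (K (t - s)) (\<lambda>x. F (v s x)) \<phi>"
    have int: "integrable lborel (\<lambda>s. indicat_real {0..t} s *\<^sub>R dk 0 (g s) (t - s) \<phi>)"
      using dk_family_integrable(1)[OF g \<phi> _ t, of 0] by (simp add: set_integrable_def)
    have eq: "AE s in lborel. ?c s = indicat_real {0..t} s *\<^sub>R dk 0 (g s) (t - s) \<phi>"
      using v by eventually_elim (auto simp: dk_0 indicator_def)
    \<comment> \<open>Agreement a.e. with an integrable function does not make \<open>?c\<close>
      Borel measurable, as \<open>lborel\<close> is not complete; measurability of the kernel and of
      \<open>F(v)\<close> does.\<close>
    have "?c \<in> borel_measurable borel"
    proof -
      note [measurable] = kernel_measurable[OF \<phi>] m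
      have "(\<lambda>s. indicat_real {0..t} s * (LINT y|lborel. (indicator {0..} s * F (v s y)) *
          K (max 0 (t - s)) (\<lambda>x. \<phi> (x + y)))) \<in> borel_measurable borel"
        by (intro borel_measurable_times borel_measurable_indicator lborel.borel_measurable_lebesgue_integral) measurable
      also have "(\<lambda>s. indicat_real {0..t} s * (LINT y|lborel. (indicator {0..} s * F (v s y)) *
          K (max 0 (t - s)) (\<lambda>x. \<phi> (x + y)))) = ?c"
        by (rule ext) (auto simp: conv_def indicator_def max_def)
      finally show ?thesis .
    qed
    then have c: "?c \<in> borel_measurable lborel" by simp
    show ?thesis
      unfolding set_integrable_def set_lebesgue_integral_def
      using integrable_cong_AE[OF c borel_measurable_integrable[OF int] eq]
        integral_cong_AE[OF c borel_measurable_integrable[OF int] eq] int by simp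
  qed
  show ?thesis
    unfolding duhamel_def using ce ceg eq V_primitive_dist_of[OF f g order_refl t] by (auto simp: dk_0)
qed

end

section \<open>Weak time derivatives\<close>

lemma measurable_slice:
  assumes "(\<lambda>(t, x). v t x) \<in> borel_measurable (borel \<Otimes>\<^sub>M borel)"
  shows "(\<lambda>t. v t x) \<in> borel_measurable borel" "v t \<in> borel_measurable borel"
  using measurable_compose[OF measurable_Pair2'[of x borel borel] assms]
    measurable_compose[OF measurable_Pair1'[of t borel borel] assms] by simp_all

lemma loc_bdd_family:
  assumes "family p v"
  shows "loc_bdd p v"
  unfolding loc_bdd_def
proof (intro conjI allI family_measurable[OF assms])
  fix T
  obtain B where "\<And>s. s \<le> T \<Longrightarrow> Lbd p (v s) B" using assms unfolding family_def by blast
  then show "\<exists>B. AE s in lborel. s \<in> {0..T} \<longrightarrow> Lbd p (v s) B"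
    by (intro exI[of _ B] AE_I2) simp
qed

lemma loc_bdd_Linf_loc:
  assumes p: "p > 1" and u: "loc_bdd p (u :: real \<Rightarrow> real^'n::finite \<Rightarrow> real)"
  shows "Linf_loc p u"
  unfolding Linf_loc_def
proof (intro conjI allI impI)
  have "({0..} \<times> UNIV :: (real \<times> (real^'n)) set) \<in> sets borel"
    by (intro borel_closed closed_Times) auto
  then show "set_borel_measurable borel ({0..} \<times> UNIV) (\<lambda>(t, x). u t x)"
    using loc_bdd_measurable[OF u] unfolding set_borel_measurable_def borel_prod by simp
  fix R :: real
  obtain B where "AE s in lborel. s \<in> {0..R} \<longrightarrow> Lbd p (u s) B" using loc_bdd_bound[OF u p] by blast
  then have "AE t in lborel. t \<in> {0..R} \<longrightarrow> in_Lcap (ereal p) \<infinity> (u t) \<and> Lcap_norm (ereal p) \<infinity> (u t) \<le> 2 * B"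
  proof eventually_elim
    case (elim t)
    then show ?case using Lbd_Lcap_norm[of p "u t" B] p by simp
  qed
  then show "\<exists>B. AE t in lborel. t \<in> {0..R} \<longrightarrow> in_Lcap (ereal p) \<infinity> (u t) \<and> Lcap_norm (ereal p) \<infinity> (u t) \<le> B" ..
qed

text \<open>The values at negative times and at the exceptional times for the bounds on
  \<open>[0, k]\<close>, a null set since there are countably many \<open>k\<close>, are replaced by
  0. Bounds for almost every time thus become bounds at every time.\<close>

lemma Linf_loc_family:
  assumes p: "p > 1" and u: "Linf_loc p (u :: real \<Rightarrow> real^'n::finite \<Rightarrow> real)"
  obtains v where "family p v" "AE t in lborel. 0 \<le> t \<longrightarrow> v t = u t" "\<And>t. v t = u t \<or> v t = (\<lambda>_. 0)"
proof -
  have "\<forall>k::nat. \<exists>B. AE t in lborel. t \<in> {0..real k} \<longrightarrow> Lbd p (u t) B"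
  proof
    fix k :: nat
    obtain B where "AE t in lborel. t \<in> {0..real k} \<longrightarrow> in_Lcap (ereal p) \<infinity> (u t) \<and> Lcap_norm (ereal p) \<infinity> (u t) \<le> B"
      using u of_nat_0_le_iff[of k] unfolding Linf_loc_def by blast
    then have "AE t in lborel. t \<in> {0..real k} \<longrightarrow> Lbd p (u t) B"
    proof eventually_elim
      case (elim t)
      then show ?case using in_Lcap_Lbd[of p "u t" B] p by simp
    qed
    then show "\<exists>B. AE t in lborel. t \<in> {0..real k} \<longrightarrow> Lbd p (u t) B" ..
  qed
  then obtain B where "\<And>k::nat. AE t in lborel. t \<in> {0..real k} \<longrightarrow> Lbd p (u t) (B k)" by metis
  then have "AE t in lborel. \<forall>k::nat. t \<in> {0..real k} \<longrightarrow> Lbd p (u t) (B k)"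
    by (simp add: AE_all_countable)
  then obtain N where N: "N \<in> null_sets lborel" "\<And>t k. t \<notin> N \<Longrightarrow> t \<in> {0..real k} \<Longrightarrow> Lbd p (u t) (B k)"
    by (auto elim!: AE_E3)
  have [measurable]: "N \<in> sets borel" using N(1) by auto
  define v where "v t x = (if 0 \<le> t \<and> t \<notin> N then u t x else 0)" for t x
  have "(\<lambda>z. indicator ({0..} \<times> UNIV) z *\<^sub>R (case z of (t, x) \<Rightarrow> u t x)) \<in> borel_measurable borel"
    using u by (simp add: Linf_loc_def set_borel_measurable_def)
  then have [measurable]: "(\<lambda>z. indicator ({0..} \<times> UNIV) z *\<^sub>R (case z of (t, x) \<Rightarrow> u t x)) \<in> borel_measurable (borel \<Otimes>\<^sub>M borel)"
    by (simp add: borel_prod)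
  have "(\<lambda>z. if fst z \<notin> N then indicator ({0..} \<times> UNIV) z *\<^sub>R (case z of (t, x) \<Rightarrow> u t x) else 0) \<in> borel_measurable (borel \<Otimes>\<^sub>M borel)"
    by measurable
  also have "(\<lambda>z. if fst z \<notin> N then indicator ({0..} \<times> UNIV) z *\<^sub>R (case z of (t, x) \<Rightarrow> u t x) else 0) = (\<lambda>(t, x). v t x)"
    by (auto simp: v_def fun_eq_iff indicator_def)
  finally have m: "(\<lambda>(t, x). v t x) \<in> borel_measurable (borel \<Otimes>\<^sub>M borel)" .
  have "Lbd p (v s) \<bar>B (nat \<lceil>T\<rceil>)\<bar>" if s: "s \<le> T" for s T
  proof (cases "0 \<le> s \<and> s \<notin> N")
    case True
    then have "Lbd p (u s) (B (nat \<lceil>T\<rceil>))" using s by (intro N(2)) (auto intro: order_trans[OF _ le_of_int_ceiling])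
    then have "Lbd p (u s) \<bar>B (nat \<lceil>T\<rceil>)\<bar>" by (rule Lbd_mono) (use p in auto)
    then show ?thesis using True by (simp add: v_def[abs_def])
  next
    case False
    then have "v s = (\<lambda>_. 0)" by (auto simp: v_def)
    then show ?thesis using Lbd_mono[OF Lbd_zero, of "\<bar>B (nat \<lceil>T\<rceil>)\<bar>" p] p by simp
  qed
  then have "family p v" unfolding family_def using m by blast
  moreover have "AE t in lborel. 0 \<le> t \<longrightarrow> v t = u t"
    using AE_not_in[OF N(1)] by eventually_elim (simp add: v_def fun_eq_iff)
  moreover have "v t = u t \<or> v t = (\<lambda>_. 0)" for t by (auto simp: v_def fun_eq_iff)
  ultimately show ?thesis using that by blast
qed

section \<open>Test functions in time and integration by parts\<close>

lemma time_testD: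
  assumes "time_test \<psi>"
  obtains a b where "0 < a" "a < b" "\<And>k t. t \<notin> {a<..<b} \<Longrightarrow> (deriv ^^ k) \<psi> t = 0"
proof -
  obtain a b where ab: "0 < a" "\<And>t. t \<notin> {a..b} \<Longrightarrow> \<psi> t = 0" using assms unfolding time_test_def by blast
  have "(deriv ^^ k) \<psi> t = 0" if "t \<notin> {a..b}" for k t
    using that
  proof (induction k arbitrary: t)
    case (Suc k)
    have "open (- {a..b})" by auto
    then have "((deriv ^^ k) \<psi> has_real_derivative 0) (at t)"
      using Suc by (intro has_field_derivative_transform_within_open[OF DERIV_const[of 0], where S = "- {a..b}"]) auto
    then show ?case by (simp add: DERIV_imp_deriv)
  qed (use ab in simp)
  \<comment> \<open>The given interval may be empty or a point; the enlarged one is nonempty, stays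
    away from 0, and the vanishing includes its end points.\<close>
  moreover have "t \<notin> {a..b}" if "t \<notin> {a/2<..<max a b + 1}" for t
    using that ab(1) by (auto simp: not_less max_def split: if_splits)
  ultimately have "(deriv ^^ k) \<psi> t = 0" if "t \<notin> {a/2<..<max a b + 1}" for k t using that by blast
  moreover have "0 < a/2" "a/2 < max a b + 1" using ab(1) by auto
  ultimately show ?thesis using that by blast
qed

lemma time_test_deriv: assumes "time_test \<psi>" shows "time_test (deriv \<psi>)"
proof -
  obtain a b where ab: "0 < a" "\<And>k t. t \<notin> {a<..<b} \<Longrightarrow> (deriv ^^ k) \<psi> t = 0" using time_testD[OF assms] by metis
  have "(deriv ^^ k) (deriv \<psi>) = (deriv ^^ Suc k) \<psi>" for k by (simp add: funpow_swap1)
  moreover have "deriv \<psi> t = 0" if "t \<notin> {a..b}" for t using ab(2)[of t 1] that by auto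
  ultimately show ?thesis using assms ab(1) unfolding time_test_def by metis
qed

lemma time_test_continuous:
  assumes "time_test \<psi>"
  shows "continuous_on UNIV ((deriv ^^ k) \<psi>)"
proof (intro continuous_at_imp_continuous_on ballI)
  fix t
  have "(deriv ^^ k) \<psi> differentiable (at t)" using assms unfolding time_test_def by blast
  then show "isCont ((deriv ^^ k) \<psi>) t" by (rule differentiable_imp_continuous_within)
qed

text \<open>\<open>h\<close> is merely integrable, so its primitive need not be differentiable
  everywhere. Exchanging the integrals over \<open>s \<le> t \<le> T\<close> leaves the integral of
  \<open>\<psi>'\<close> over \<open>[s, T]\<close>, which is \<open>- \<psi> s\<close>.\<close>

lemma primitive_by_parts:
  fixes h \<psi> \<psi>' :: "real \<Rightarrow> real"
  assumes h: "set_integrable lborel {0..T} h" and T: "T \<ge> 0"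
    and \<psi>': "continuous_on UNIV \<psi>'" "\<And>t. (\<psi> has_real_derivative \<psi>' t) (at t)" and \<psi>T: "\<psi> T = 0"
  shows "(LINT t:{0..T}|lborel. \<psi>' t * (LINT s:{0..t}|lborel. h s)) = - (LINT s:{0..T}|lborel. \<psi> s * h s)"
proof -
  have [measurable]: "\<psi>' \<in> borel_measurable borel" by (rule borel_measurable_continuous_onI[OF \<psi>'(1)])
  define k where "k s = indicator {0..T} s * h s" for s
  have ki: "integrable lborel k" using h by (simp add: k_def[abs_def] set_integrable_def)
  then have [measurable]: "k \<in> borel_measurable borel" by auto
  let ?f = "\<lambda>(t, s). indicat_real {0..T} t * \<psi>' t * (indicator {0..t} s * k s)"
  have "bounded (\<psi>' ` {0..T})"
    by (intro compact_imp_bounded compact_continuous_image continuous_on_subset[OF \<psi>'(1)]) auto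
  then obtain M where M: "\<And>t. t \<in> {0..T} \<Longrightarrow> \<bar>\<psi>' t\<bar> \<le> M" unfolding bounded_iff real_norm_def by blast
  have ind: "indicat_real {0..\<tau>} s = (if 0 \<le> s \<and> s \<le> \<tau> then 1 else 0)" for \<tau> s by auto
  have fm[measurable]: "?f \<in> borel_measurable (lborel \<Otimes>\<^sub>M lborel)" unfolding ind by measurable
  have i1: "integrable (lborel \<Otimes>\<^sub>M lborel) (\<lambda>(t, s). (M * indicator {0..T} t) * k s)"
  proof (rule lborel_pair.Fubini_integrable)
    have "integrable lborel (\<lambda>t. \<bar>M * indicator {0..T} t\<bar> * (LINT s|lborel. \<bar>k s\<bar>))"
      by (intro integrable_mult_left integrable_abs integrable_mult_right integrable_real_indicator)
         (auto simp: emeasure_lborel_Icc_eq)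
    then show "integrable lborel (\<lambda>t. LINT s|lborel. norm (case (t, s) of (t, s) \<Rightarrow> (M * indicator {0..T} t) * k s))"
      by (simp add: abs_mult)
    show "AE t in lborel. integrable lborel (\<lambda>s. case (t, s) of (t, s) \<Rightarrow> (M * indicator {0..T} t) * k s)"
      using ki by simp
  qed measurable
  have int: "integrable (lborel \<Otimes>\<^sub>M lborel) ?f"
  proof (rule Bochner_Integration.integrable_bound[OF i1])
    show "AE z in lborel \<Otimes>\<^sub>M lborel. norm (?f z) \<le> norm (case z of (t, s) \<Rightarrow> (M * indicator {0..T} t) * k s)"
    proof (rule AE_I2)
      fix z :: "real \<times> real"
      obtain t s where z: "z = (t, s)" by (cases z)
      have "\<bar>\<psi>' t\<bar> * \<bar>k s\<bar> \<le> \<bar>M\<bar> * \<bar>k s\<bar>" if "t \<in> {0..T}" using M[OF that] by (intro mult_right_mono) auto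
      then show "norm (?f z) \<le> norm (case z of (t, s) \<Rightarrow> (M * indicator {0..T} t) * k s)"
        unfolding z by (auto simp: indicator_def abs_mult)
    qed
  qed (rule fm)
  have "(LINT t:{0..T}|lborel. \<psi>' t * (LINT s:{0..t}|lborel. h s)) = (LINT t|lborel. LINT s|lborel. ?f (t, s))"
    unfolding set_lebesgue_integral_def
  proof (rule Bochner_Integration.integral_cong[OF refl])
    fix t
    have "(LINT s|lborel. indicat_real {0..t} s *\<^sub>R h s) = (LINT s|lborel. indicator {0..t} s * k s)" if "t \<in> {0..T}"
      by (rule Bochner_Integration.integral_cong) (use that in \<open>auto simp: k_def indicator_def\<close>)
    then show "indicat_real {0..T} t *\<^sub>R (\<psi>' t * (LINT s|lborel. indicat_real {0..t} s *\<^sub>R h s)) = (LINT s|lborel. ?f (t, s))"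
      by (cases "t \<in> {0..T}") auto
  qed
  also have "\<dots> = (LINT s|lborel. LINT t|lborel. ?f (t, s))"
    using lborel_pair.Fubini_integral[of "\<lambda>s x. ?f (s, x)"] int by simp
  also have "\<dots> = (LINT s|lborel. - (indicat_real {0..T} s *\<^sub>R (\<psi> s * h s)))"
  proof (rule Bochner_Integration.integral_cong[OF refl])
    fix s
    show "(LINT t|lborel. ?f (t, s)) = - (indicat_real {0..T} s *\<^sub>R (\<psi> s * h s))"
    proof (cases "s \<in> {0..T}")
      case True
      have "(LINT t|lborel. ?f (t, s)) = (LINT t|lborel. (indicat_real {s..T} t * \<psi>' t) * k s)"
        by (rule Bochner_Integration.integral_cong) (use True in \<open>auto simp: indicator_def\<close>)
      also have "\<dots> = (LINT t:{s..T}|lborel. \<psi>' t) * k s" by (simp add: set_lebesgue_integral_def)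
      also have "(LINT t:{s..T}|lborel. \<psi>' t) = \<psi> T - \<psi> s"
      proof -
        have "set_integrable lborel {s..T} \<psi>'"
          unfolding set_integrable_def
          by (intro borel_integrable_compact continuous_on_subset[OF \<psi>'(1)]) auto
        moreover have "(\<psi>' has_integral (\<psi> T - \<psi> s)) {s..T}"
          using True \<psi>'(2) by (intro fundamental_theorem_of_calculus)
            (auto simp flip: has_real_derivative_iff_has_vector_derivative intro: has_field_derivative_at_within)
        ultimately show ?thesis using set_borel_integral_eq_integral(2) by (metis integral_unique)
      qed
      finally show ?thesis using True \<psi>T by (simp add: k_def)
    next
      case False
      then have "k s = 0" by (simp add: k_def)
      then show ?thesis using False by simp
    qed
  qed
  finally show ?thesis by (simp add: set_lebesgue_integral_def)
qed

text \<open>The intervals \<open>[0, k]\<close> suffice, so a single null set of \<open>x\<close>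
  serves all \<open>T\<close>.\<close>

lemma AE_set_integrable_all:
  assumes p: "p > 1" and u: "loc_bdd p u"
  shows "AE x in lborel. \<forall>T. set_integrable lborel {0..T} (\<lambda>s. u s x)"
proof -
  have "AE x in lborel. set_integrable lborel {0..real k} (\<lambda>s. u s x)" for k :: nat
  proof -
    obtain B where "B > 0" "AE s in lborel. s \<in> {0..real k} \<longrightarrow> Lbd p (u s) B" using loc_bdd_bound[OF u p] by blast
    from primitive_Lbd(2)[OF p loc_bdd_measurable[OF u] this order_refl] show ?thesis .
  qed
  then have "AE x in lborel. \<forall>k::nat. set_integrable lborel {0..real k} (\<lambda>s. u s x)" by (simp add: AE_all_countable)
  then show ?thesis
  proof eventually_elim
    case (elim x)
    show ?case
    proof
      fix T :: real
      have "set_integrable lborel {0..real (nat \<lceil>T\<rceil>)} (\<lambda>s. u s x)" using elim by blast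
      then show "set_integrable lborel {0..T} (\<lambda>s. u s x)"
      proof (rule set_integrable_subset)
        show "{0..T} \<subseteq> {0..real (nat \<lceil>T\<rceil>)}" using real_nat_ceiling_ge[of T] by auto
      qed simp
    qed
  qed
qed

lemma restrict_half_line:
  fixes f :: "real \<Rightarrow> real"
  assumes "\<And>t. t > T \<Longrightarrow> f t = 0"
  shows "(LINT t:{0..}|lborel. f t) = (LINT t:{0..T}|lborel. f t)"
  unfolding set_lebesgue_integral_def
proof (rule Bochner_Integration.integral_cong[OF refl])
  show "indicat_real {0..} t *\<^sub>R f t = indicat_real {0..T} t *\<^sub>R f t" for t
    using assms[of t] by (cases "t \<le> T") (auto simp: indicator_def)
qed

lemma weak_t_deriv_primitive:
  assumes p: "p > 1" and u: "loc_bdd p u"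
  shows "weak_t_deriv 1 (primitive u) u"
  unfolding weak_t_deriv_def
proof (intro allI impI)
  fix \<psi> assume \<psi>: "time_test \<psi>"
  obtain a b where ab: "0 < a" "a < b" "\<And>k t. t \<notin> {a<..<b} \<Longrightarrow> (deriv ^^ k) \<psi> t = 0" using time_testD[OF \<psi>] by blast
  have z: "\<psi> t = 0" "deriv \<psi> t = 0" if "t \<ge> b" for t using ab(3)[of t 0] ab(3)[of t 1] that by auto
  show "AE x in lborel. (LINT t:{0..}|lborel. (deriv ^^ 1) \<psi> t * primitive u t x) = (- 1) ^ 1 * (LINT t:{0..}|lborel. \<psi> t * u t x)"
    using AE_set_integrable_all[OF p u]
  proof eventually_elim
    case (elim x)
    have "(LINT t:{0..}|lborel. (deriv ^^ 1) \<psi> t * primitive u t x) = (LINT t:{0..b}|lborel. deriv \<psi> t * (LINT s:{0..t}|lborel. u s x))"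
      unfolding primitive_def using z by (subst restrict_half_line[of b]) auto
    also have "\<dots> = - (LINT s:{0..b}|lborel. \<psi> s * u s x)"
    proof (rule primitive_by_parts)
      show "continuous_on UNIV (deriv \<psi>)" using time_test_continuous[OF \<psi>, of 1] by simp
      have "\<psi> differentiable (at t)" for t using \<psi> unfolding time_test_def by (metis funpow_0)
      then show "(\<psi> has_real_derivative deriv \<psi> t) (at t)" for t by (simp add: DERIV_deriv_iff_real_differentiable)
    qed (use elim ab z in auto)
    also have "(LINT s:{0..b}|lborel. \<psi> s * u s x) = (LINT t:{0..}|lborel. \<psi> t * u t x)"
      using z by (subst restrict_half_line[of b]) auto
    finally show ?case by simp
  qed
qed

lemma weak_t_deriv_trans:
  assumes "weak_t_deriv k u v" "weak_t_deriv 1 v w"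
  shows "weak_t_deriv (Suc k) u w"
  unfolding weak_t_deriv_def
proof (intro allI impI)
  fix \<psi> assume \<psi>: "time_test \<psi>"
  have "AE x in lborel. (LINT t:{0..}|lborel. (deriv ^^ k) (deriv \<psi>) t * u t x) = (-1) ^ k * (LINT t:{0..}|lborel. deriv \<psi> t * v t x)"
    using assms(1) time_test_deriv[OF \<psi>] unfolding weak_t_deriv_def by blast
  moreover have "AE x in lborel. (LINT t:{0..}|lborel. (deriv ^^ 1) \<psi> t * v t x) = (-1) ^ 1 * (LINT t:{0..}|lborel. \<psi> t * w t x)"
    using assms(2) \<psi> unfolding weak_t_deriv_def by blast
  ultimately show "AE x in lborel. (LINT t:{0..}|lborel. (deriv ^^ Suc k) \<psi> t * u t x) = (-1) ^ Suc k * (LINT t:{0..}|lborel. \<psi> t * w t x)"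
    by eventually_elim (simp add: funpow_swap1)
qed

lemma weak_t_deriv_primitive_iterate:
  assumes p: "p > 1" and u: "loc_bdd p u"
  shows "weak_t_deriv k ((primitive ^^ k) u) u"
  using u
proof (induction k arbitrary: u)
  case 0
  show ?case by (simp add: weak_t_deriv_def)
next
  case (Suc k)
  have "weak_t_deriv k ((primitive ^^ k) (primitive u)) (primitive u)"
    by (intro Suc.IH loc_bdd_primitive p Suc.prems)
  from weak_t_deriv_trans[OF this weak_t_deriv_primitive[OF p Suc.prems]] show ?case
    by (simp add: funpow_swap1)
qed

lemma W_loc_primitive_iterate:
  assumes p: "p > 1" and u: "loc_bdd p u"
  shows "W_loc l p ((primitive ^^ l) u)"
  unfolding W_loc_def
proof (intro conjI allI impI)
  show "Linf_loc p ((primitive ^^ l) u)" by (intro loc_bdd_Linf_loc loc_bdd_primitive_iterate p u)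
  fix k assume "k \<le> l"
  then have "(primitive ^^ l) u = (primitive ^^ k) ((primitive ^^ (l - k)) u)"
    by (metis funpow_add le_add_diff_inverse comp_apply)
  moreover have "loc_bdd p ((primitive ^^ (l - k)) u)" by (intro loc_bdd_primitive_iterate p u)
  ultimately show "\<exists>v. Linf_loc p v \<and> weak_t_deriv k ((primitive ^^ l) u) v"
    using weak_t_deriv_primitive_iterate[OF p] loc_bdd_Linf_loc[OF p] by metis
qed

section \<open>Functions of time and space determined by tests in time\<close>

lemma AE_time_space_commute:
  fixes v w :: "real \<Rightarrow> 'a::euclidean_space \<Rightarrow> real"
  assumes v: "(\<lambda>(t, x). v t x) \<in> borel_measurable (borel \<Otimes>\<^sub>M borel)"
    and w: "(\<lambda>(t, x). w t x) \<in> borel_measurable (borel \<Otimes>\<^sub>M borel)" and I: "I \<in> sets borel"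
  shows "(AE t in lborel. t \<in> I \<longrightarrow> (AE x in lborel. v t x = w t x)) \<longleftrightarrow>
     (AE x in lborel. AE t in lborel. t \<in> I \<longrightarrow> v t x = w t x)"
proof -
  have [measurable]: "(\<lambda>z. v (fst z) (snd z)) \<in> borel_measurable (lborel \<Otimes>\<^sub>M lborel)"
    "(\<lambda>z. w (fst z) (snd z)) \<in> borel_measurable (lborel \<Otimes>\<^sub>M lborel)" "I \<in> sets lborel"
    using v w I by (simp_all add: split_beta')
  have "{z \<in> space (lborel \<Otimes>\<^sub>M lborel). fst z \<in> I \<longrightarrow> v (fst z) (snd z) = w (fst z) (snd z)} \<in> sets (lborel \<Otimes>\<^sub>M lborel)"
    by measurable
  from lborel_pair.AE_commute[OF this] show ?thesis by simp
qed

text \<open>The null set of \<open>x\<close> depends on \<open>\<psi>\<close>. But a single box in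
  time and space needs only the countably many bumps that approximate its time interval, so the box
  integrals of \<open>v - w\<close> vanish; differentiation of integrals in the product space does
  the rest.\<close>

lemma AE_eq_if_weak_eq:
  fixes v w :: "real \<Rightarrow> real^'n::finite \<Rightarrow> real"
  assumes p: "p > 1" and v: "loc_bdd p v" and w: "loc_bdd p w"
    and eq: "\<And>\<psi>. time_test \<psi> \<Longrightarrow> AE x in lborel.
       (LINT t:{0..}|lborel. \<psi> t * v t x) = (LINT t:{0..}|lborel. \<psi> t * w t x)"
  shows "AE t in lborel. t \<in> {0..} \<longrightarrow> (AE x in lborel. v t x = w t x)"
proof -
  note vm = loc_bdd_measurable[OF v] and wm = loc_bdd_measurable[OF w]
  have [measurable]: "(\<lambda>z. v (fst z) (snd z)) \<in> borel_measurable (borel \<Otimes>\<^sub>M borel)"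
    "(\<lambda>z. w (fst z) (snd z)) \<in> borel_measurable (borel \<Otimes>\<^sub>M borel)" using vm wm by (simp_all add: split_beta')

  \<comment> \<open>Time tests are supported away from 0, hence the cut-off at
    \<open>\<epsilon>\<close>; it is removed along \<open>\<epsilon> = 1/(k+1)\<close> at the
    end.\<close>
  have main: "AE z in lborel. indicator {\<epsilon><..} (fst z) * (v (fst z) (snd z) - w (fst z) (snd z)) = 0" if \<epsilon>: "\<epsilon> > 0" for \<epsilon>
  proof (rule AE_zero_if_cbox_integrals_zero)
    let ?D = "\<lambda>z. indicator {\<epsilon><..} (fst z) * (v (fst z) (snd z) - w (fst z) (snd z))"
    fix z1 z2 :: "real \<times> (real^'n)"
    obtain a A where z1: "z1 = (a, A)" by (cases z1)
    obtain b B where z2: "z2 = (b, B)" by (cases z2)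
    have cb: "cbox z1 z2 = {a..b} \<times> cbox A B" by (simp add: z1 z2 cbox_Pair_eq)
    obtain b1 b2 where b1: "AE s in lborel. s \<in> {0..b} \<longrightarrow> Lbd p (v s) b1" and b2: "AE s in lborel. s \<in> {0..b} \<longrightarrow> Lbd p (w s) b2"
      using loc_bdd_bound[OF v p] loc_bdd_bound[OF w p] by metis
    have bd: "AE s in lborel. AE x in lborel. s \<in> {\<epsilon><..b} \<longrightarrow> \<bar>v s x - w s x\<bar> \<le> b1 + b2"
      using b1 b2
    proof eventually_elim
      case (elim s)
      show ?case
      proof (cases "s \<in> {\<epsilon><..b}")
        case True
        then have "AE x in lborel. \<bar>v s x\<bar> \<le> b1" "AE x in lborel. \<bar>w s x\<bar> \<le> b2" using elim \<epsilon> by (auto simp: Lbd_def)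
        then show ?thesis by eventually_elim auto
      next
        case False
        then show ?thesis by (intro AE_I2) auto
      qed
    qed
    have "AE z in lborel \<Otimes>\<^sub>M lborel. fst z \<in> {\<epsilon><..b} \<longrightarrow> \<bar>v (fst z) (snd z) - w (fst z) (snd z)\<bar> \<le> b1 + b2"
    proof -
      have "{z \<in> space (lborel \<Otimes>\<^sub>M lborel). fst z \<in> {\<epsilon><..b} \<longrightarrow> \<bar>v (fst z) (snd z) - w (fst z) (snd z)\<bar> \<le> b1 + b2}
          \<in> sets (lborel \<Otimes>\<^sub>M lborel)" by measurable
      from lborel_pair.AE_pair_iff[OF this] bd show ?thesis by simp
    qed
    then have bd2: "AE z in lborel. fst z \<in> {\<epsilon><..b} \<longrightarrow> \<bar>v (fst z) (snd z) - w (fst z) (snd z)\<bar> \<le> b1 + b2"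
      unfolding lborel_prod .
    have m: "(\<lambda>z. indicat_real (cbox z1 z2) z *\<^sub>R ?D z) \<in> borel_measurable (borel \<Otimes>\<^sub>M borel)"
    proof -
      have "(\<lambda>z. indicat_real S (fst z)) \<in> borel_measurable (borel \<Otimes>\<^sub>M (borel :: (real^'n) measure))"
        if "S \<in> sets (borel :: real measure)" for S
        by (rule measurable_compose[OF measurable_fst]) (use that in simp)
      moreover have "(\<lambda>z. indicat_real S (snd z)) \<in> borel_measurable ((borel :: real measure) \<Otimes>\<^sub>M borel)"
        if "S \<in> sets (borel :: (real^'n) measure)" for S
        by (rule measurable_compose[OF measurable_snd]) (use that in simp)
      ultimately have "(\<lambda>z. (indicat_real {a..b} (fst z) * indicat_real (cbox A B) (snd z)) * ?D z) \<in> borel_measurable (borel \<Otimes>\<^sub>M borel)"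
        by (intro borel_measurable_times borel_measurable_diff) auto
      then show ?thesis unfolding cb indicator_times real_scaleR_def .
    qed
    show int: "set_integrable lborel (cbox z1 z2) ?D"
      unfolding set_integrable_def
    proof (rule Bochner_Integration.integrable_bound)
      show "integrable lborel (\<lambda>z. \<bar>b1 + b2\<bar> * indicator (cbox z1 z2) z :: real)"
        by (intro integrable_mult_right integrable_real_indicator) (auto simp: emeasure_lborel_cbox_finite[unfolded infinity_ennreal_def])
      show "(\<lambda>z. indicat_real (cbox z1 z2) z *\<^sub>R ?D z) \<in> borel_measurable lborel"
        using m by (simp add: borel_prod)
      show "AE z in lborel. norm (indicat_real (cbox z1 z2) z *\<^sub>R ?D z) \<le> norm (\<bar>b1 + b2\<bar> * indicator (cbox z1 z2) z :: real)"
        using bd2 by eventually_elim (auto simp: cb indicator_def)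
    qed
    have inner: "AE x in lborel. (LINT t|lborel. indicat_real {a..b} t * (indicator {\<epsilon><..} t * (v t x - w t x))) = 0"
    proof (cases "max a \<epsilon> < b")
      case ab: True
      let ?a = "max a \<epsilon>"
      have tt: "time_test (bump ?a b k)" for k by (rule time_test_bump) (use ab \<epsilon> in auto)
      have "AE x in lborel. \<forall>k. (LINT t:{0..}|lborel. bump ?a b k t * v t x) = (LINT t:{0..}|lborel. bump ?a b k t * w t x)"
        using eq[OF tt] by (simp add: AE_all_countable)
      then show ?thesis
        using AE_set_integrable_all[OF p v] AE_set_integrable_all[OF p w]
      proof eventually_elim
        case (elim x)
        have [measurable]: "(\<lambda>t. v t x) \<in> borel_measurable borel" "(\<lambda>t. w t x) \<in> borel_measurable borel"
          using measurable_slice(1)[OF vm] measurable_slice(1)[OF wm] by auto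
        have sup: "bump ?a b k t = 0" if "t \<notin> {?a<..<b}" for k t using bump_deriv_eq_0[where j = 0, OF ab that] by simp
        have [measurable]: "bump ?a b k \<in> borel_measurable borel" for k
          using time_test_continuous[OF tt, of 0] by (auto intro: borel_measurable_continuous_onI)
        have i: "integrable lborel (\<lambda>t. indicat_real {0..b} t * v t x)" "integrable lborel (\<lambda>t. indicat_real {0..b} t * w t x)"
          using elim by (auto simp: set_integrable_def)
        have ik: "integrable lborel (\<lambda>t. bump ?a b k t * (indicat_real {0..b} t * f t))"
          if "integrable lborel (\<lambda>t. indicat_real {0..b} t * f t)" "f \<in> borel_measurable borel" for k f
          using that bump_bounds by (intro Bochner_Integration.integrable_bound[OF that(1)]) (auto simp: abs_mult mult_left_le_one_le)
        have zero: "(LINT t|lborel. bump ?a b k t * (indicat_real {0..b} t * v t x - indicat_real {0..b} t * w t x)) = 0" for k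
        proof -
          have "(LINT t:{0..}|lborel. bump ?a b k t * f t) = (LINT t|lborel. bump ?a b k t * (indicat_real {0..b} t * f t))" for f
            unfolding set_lebesgue_integral_def
            by (rule Bochner_Integration.integral_cong) (use sup[of _ k] in \<open>auto simp: indicator_def not_le\<close>)
          then show ?thesis
            using elim(1)[rule_format, of k] ik[OF i(1), of k] ik[OF i(2), of k] by (simp add: right_diff_distrib)
        qed
        have "(\<lambda>k. LINT t|lborel. bump ?a b k t * (indicat_real {0..b} t * v t x - indicat_real {0..b} t * w t x)) \<longlonglongrightarrow>
          (LINT t|lborel. indicator {?a<..<b} t * (indicat_real {0..b} t * v t x - indicat_real {0..b} t * w t x))"
        proof (rule integral_dominated_convergence[where w = "\<lambda>t. \<bar>indicat_real {0..b} t * v t x - indicat_real {0..b} t * w t x\<bar>"])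
          show "integrable lborel (\<lambda>t. \<bar>indicat_real {0..b} t * v t x - indicat_real {0..b} t * w t x\<bar>)"
            by (intro integrable_abs Bochner_Integration.integrable_diff i)
          show "AE t in lborel. (\<lambda>k. bump ?a b k t * (indicat_real {0..b} t * v t x - indicat_real {0..b} t * w t x)) \<longlonglongrightarrow>
            indicator {?a<..<b} t * (indicat_real {0..b} t * v t x - indicat_real {0..b} t * w t x)"
            by (intro AE_I2 tendsto_mult tendsto_const bump_tendsto_indicator ab)
          show "AE t in lborel. norm (bump ?a b k t * (indicat_real {0..b} t * v t x - indicat_real {0..b} t * w t x)) \<le>
            \<bar>indicat_real {0..b} t * v t x - indicat_real {0..b} t * w t x\<bar>" for k
            using bump_bounds by (intro AE_I2) (simp add: abs_mult mult_left_le_one_le)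
        qed simp_all
        then have "(LINT t|lborel. indicator {?a<..<b} t * (indicat_real {0..b} t * v t x - indicat_real {0..b} t * w t x)) = 0"
          unfolding zero by (simp add: LIMSEQ_const_iff)
        also have "(LINT t|lborel. indicator {?a<..<b} t * (indicat_real {0..b} t * v t x - indicat_real {0..b} t * w t x)) =
            (LINT t|lborel. indicat_real {a..b} t * (indicator {\<epsilon><..} t * (v t x - w t x)))"
        proof (rule integral_cong_AE)
          have "AE t in lborel. t \<noteq> a \<and> t \<noteq> b" using AE_lborel_singleton[of a] AE_lborel_singleton[of b] by eventually_elim simp
          then show "AE t in lborel. indicator {?a<..<b} t * (indicat_real {0..b} t * v t x - indicat_real {0..b} t * w t x) =
              indicat_real {a..b} t * (indicator {\<epsilon><..} t * (v t x - w t x))"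
            by eventually_elim (use \<epsilon> in \<open>auto simp: indicator_def\<close>)
        qed simp_all
        finally show ?case .
      qed
    next
      case False
      show ?thesis
      proof (rule AE_I2)
        fix x
        have "AE t in lborel. indicat_real {a..b} t * (indicator {\<epsilon><..} t * (v t x - w t x)) = 0"
          using AE_lborel_singleton[of a] by eventually_elim (use False in \<open>auto simp: indicator_def\<close>)
        then show "(LINT t|lborel. indicat_real {a..b} t * (indicator {\<epsilon><..} t * (v t x - w t x))) = 0"
          by (rule integral_eq_zero_AE)
      qed
    qed
    have "(LINT z:cbox z1 z2|lborel. ?D z) = (LINT z|(lborel \<Otimes>\<^sub>M lborel). indicat_real (cbox z1 z2) z *\<^sub>R ?D z)"
      unfolding set_lebesgue_integral_def lborel_prod ..
    also have "\<dots> = (LINT x|lborel. LINT t|lborel. indicat_real (cbox z1 z2) (t, x) *\<^sub>R ?D (t, x))"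
    proof -
      have "integrable (lborel \<Otimes>\<^sub>M lborel) (\<lambda>(t, x). indicat_real (cbox z1 z2) (t, x) *\<^sub>R ?D (t, x))"
        using int unfolding set_integrable_def lborel_prod[symmetric] split_beta' by simp
      from lborel_pair.integral_snd[OF this] show ?thesis by (simp add: split_beta')
    qed
    also have "\<dots> = (LINT x|lborel. indicator (cbox A B) x * (LINT t|lborel. indicat_real {a..b} t * (indicator {\<epsilon><..} t * (v t x - w t x))))"
    proof (rule Bochner_Integration.integral_cong[OF refl])
      fix x
      have "indicat_real (cbox z1 z2) (t, x) *\<^sub>R ?D (t, x) =
          indicator (cbox A B) x * (indicat_real {a..b} t * (indicator {\<epsilon><..} t * (v t x - w t x)))" for t
        unfolding cb by (simp add: indicator_times)
      then show "(LINT t|lborel. indicat_real (cbox z1 z2) (t, x) *\<^sub>R ?D (t, x)) =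
          indicator (cbox A B) x * (LINT t|lborel. indicat_real {a..b} t * (indicator {\<epsilon><..} t * (v t x - w t x)))"
        by (simp only: integral_mult_right_zero)
    qed
    also have "\<dots> = 0"
      by (rule integral_eq_zero_AE) (use inner in \<open>eventually_elim, simp\<close>)
    finally show "(LINT z:cbox z1 z2|lborel. ?D z) = 0" .
  qed
  have "AE z in lborel \<Otimes>\<^sub>M lborel. fst z > 0 \<longrightarrow> v (fst z) (snd z) = w (fst z) (snd z)"
  proof -
    have "AE z in lborel. \<forall>k::nat. indicator {1 / real (Suc k)<..} (fst z) * (v (fst z) (snd z) - w (fst z) (snd z)) = 0"
      unfolding AE_all_countable by (intro allI main) simp
    then have "AE z in lborel. fst z > 0 \<longrightarrow> v (fst z) (snd z) = w (fst z) (snd z)"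
    proof eventually_elim
      case (elim z)
      show ?case
      proof
        assume "fst z > 0"
        then obtain k where "1 / real (Suc k) < fst z" by (rule nat_approx_posE)
        then show "v (fst z) (snd z) = w (fst z) (snd z)" using elim[rule_format, of k] by simp
      qed
    qed
    then show ?thesis unfolding lborel_prod .
  qed
  then have "AE t in lborel. AE x in lborel. t > 0 \<longrightarrow> v t x = w t x"
  proof -
    assume "AE z in lborel \<Otimes>\<^sub>M lborel. fst z > 0 \<longrightarrow> v (fst z) (snd z) = w (fst z) (snd z)"
    from lborel_pair.AE_pair[OF this] show ?thesis by simp
  qed
  then show ?thesis
    using AE_lborel_singleton[of "0::real"] by eventually_elim auto
qed

section \<open>The nonlinearity\<close>

text \<open>The left side is at most the \<open>p\<close>-th power of the larger of \<open>a\<close>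
  and \<open>e\<close>. This coarse Young inequality takes the place of Hoelder's in
  \<open>F_diff_Lbd\<close>.\<close>

lemma mult_powr_le_sum_powr:
  fixes a e :: real
  assumes "a \<ge> 0" "e \<ge> 0" "p > 1"
  shows "a * e powr (p - 1) \<le> a powr p + e powr p"
proof (cases "a \<le> e")
  case True
  have "a * e powr (p - 1) \<le> e * e powr (p - 1)" using True by (rule mult_right_mono) simp
  also have "\<dots> = e powr p" using assms by (cases "e = 0") (auto simp: powr_diff)
  finally show ?thesis by (simp add: add_increasing)
next
  case False
  have "a * e powr (p - 1) \<le> a * a powr (p - 1)" using False assms by (intro mult_left_mono powr_mono2) auto
  also have "\<dots> = a powr p" using assms False by (auto simp: powr_diff)
  finally show ?thesis by (simp add: add_increasing2)
qed

locale nonlinearity =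
  fixes p :: real and \<mu> F :: "real \<Rightarrow> real" and eps L :: real
  assumes p_gt_1: "p > 1" and mu_nonneg: "\<And>s. s \<ge> 0 \<Longrightarrow> \<mu> s \<ge> 0"
    and F: "\<And>s. F s = \<bar>s\<bar> powr p * \<mu> \<bar>s\<bar>"
    and mu_mono: "mono_on {0..} \<mu>"
    and eps: "eps > 0" and L_pos: "L > 0"
    and F_lipschitz: "\<And>y z. \<bar>y\<bar> \<le> eps \<Longrightarrow> \<bar>z\<bar> \<le> eps \<Longrightarrow>
         \<bar>F y - F z\<bar> \<le> L * \<bar>y - z\<bar> * (\<bar>y\<bar> powr (p - 1) + \<bar>z\<bar> powr (p - 1)) * \<mu> (\<bar>y\<bar> + \<bar>z\<bar>)"
begin

lemma mu_le: "0 \<le> s \<Longrightarrow> s \<le> t \<Longrightarrow> \<mu> s \<le> \<mu> t"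
  using mu_mono by (auto simp: mono_on_def)

text \<open>\<open>\<mu>\<close> is monotone on \<open>[0, \<infinity>)\<close> only; freezing it at
  its value at 0 on the left gives a monotone function on the line.\<close>

lemma mu_max_measurable[measurable]: "(\<lambda>s. \<mu> (max 0 s)) \<in> borel_measurable borel"
  by (rule borel_measurable_mono) (auto simp: mono_def intro!: mu_le)

lemma F_measurable[measurable]: "F \<in> borel_measurable borel"
proof -
  have "F = (\<lambda>s. \<bar>s\<bar> powr p * \<mu> (max 0 \<bar>s\<bar>))" by (rule ext) (simp add: F)
  also have "\<dots> \<in> borel_measurable borel"
    by (intro borel_measurable_times measurable_compose[OF _ mu_max_measurable]) measurable
  finally show ?thesis .
qed

lemma F_0: "F 0 = 0"
  by (simp add: F)

text \<open>\<open>|F(v)| \<le> \<mu>(b) |v|^p\<close> turns the \<open>L^p\<close> bound of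
  \<open>v\<close> into an \<open>L^1\<close> bound. The radius \<open>b\<close> is arbitrary, so
  this also serves the competitors in the uniqueness argument.\<close>

lemma F_Lbd:
  assumes v: "Lbd p v b"
  shows "Lbd 1 (\<lambda>x. F (v x)) (b powr p * \<mu> b)"
proof -
  have [measurable]: "v \<in> borel_measurable borel" and b: "b \<ge> 0" and ae: "AE x in lborel. \<bar>v x\<bar> \<le> b"
    using v by (auto simp: Lbd_def)
  have le: "\<bar>F (v x)\<bar> \<le> \<mu> b * \<bar>v x\<bar> powr p" if "\<bar>v x\<bar> \<le> b" for x
    using that mu_le[of "\<bar>v x\<bar>" b] mu_nonneg[of "\<bar>v x\<bar>"] by (simp add: F abs_mult mult.commute mult_right_mono)
  have "AE x in lborel. \<bar>F (v x)\<bar> \<le> b powr p * \<mu> b"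
    using ae
  proof eventually_elim
    case (elim x)
    have "\<bar>v x\<bar> powr p \<le> b powr p" using elim p_gt_1 by (intro powr_mono2) auto
    then have "\<mu> b * \<bar>v x\<bar> powr p \<le> \<mu> b * b powr p" using mu_nonneg[OF b] by (rule mult_left_mono)
    then show ?case using le[OF elim] by (simp add: mult.commute)
  qed
  moreover have "(\<integral>\<^sup>+x. ennreal (\<bar>F (v x)\<bar> powr 1) \<partial>lborel) \<le> ennreal ((b powr p * \<mu> b) powr 1)"
  proof -
    have "(\<integral>\<^sup>+x. ennreal (\<bar>F (v x)\<bar> powr 1) \<partial>lborel) \<le> (\<integral>\<^sup>+x. ennreal (\<mu> b) * ennreal (\<bar>v x\<bar> powr p) \<partial>lborel)"
    proof (rule nn_integral_mono_AE)
      show "AE x in lborel. ennreal (\<bar>F (v x)\<bar> powr 1) \<le> ennreal (\<mu> b) * ennreal (\<bar>v x\<bar> powr p)"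
        using ae by eventually_elim (use le mu_nonneg[OF b] in \<open>auto simp: ennreal_leI simp flip: ennreal_mult\<close>)
    qed
    also have "\<dots> = ennreal (\<mu> b) * (\<integral>\<^sup>+x. ennreal (\<bar>v x\<bar> powr p) \<partial>lborel)" by (rule nn_integral_cmult) simp
    also have "\<dots> \<le> ennreal (\<mu> b) * ennreal (b powr p)" using v by (intro mult_left_mono) (auto simp: Lbd_def)
    also have "\<dots> = ennreal ((b powr p * \<mu> b) powr 1)"
      using mu_nonneg[OF b] by (simp add: mult.commute flip: ennreal_mult)
    finally show ?thesis .
  qed
  ultimately show ?thesis using mu_nonneg[OF b] b unfolding Lbd_def by simp
qed

lemma F_family:
  assumes v: "family p v"
  shows "family 1 (\<lambda>s x. F (v s x))"
  unfolding family_def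
proof (intro conjI allI)
  show "(\<lambda>(s, x). F (v s x)) \<in> borel_measurable (borel \<Otimes>\<^sub>M borel)"
    using measurable_compose[OF family_measurable[OF v] F_measurable] by (simp add: split_beta')
  fix T
  obtain B where B: "\<And>s. s \<le> T \<Longrightarrow> Lbd p (v s) B" using v unfolding family_def by blast
  then show "\<exists>H. \<forall>s\<le>T. Lbd 1 (\<lambda>x. F (v s x)) H" using F_Lbd by blast
qed

text \<open>The difference is divided by \<open>\<delta>\<close> and the functions by
  \<open>b\<close> before \<open>mult_powr_le_sum_powr\<close> is applied; then each normalised
  power integrates to at most 1. The difference occurs twice, \<open>v\<close> and \<open>w\<close>
  once each, which makes the 4; for the supremum already 2 is enough.\<close>

lemma F_diff_Lbd:
  assumes v: "Lbd p v b" and w: "Lbd p w b" and d: "Lbd p (\<lambda>x. v x - w x) \<delta>"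
    and pos: "b > 0" "b \<le> eps" "\<delta> > 0"
  shows "Lbd 1 (\<lambda>x. F (v x) - F (w x)) (4 * L * \<delta> * b powr (p - 1) * \<mu> (2 * b))"
proof -
  have [measurable]: "v \<in> borel_measurable borel" "w \<in> borel_measurable borel"
    using v w by (auto simp: Lbd_def)
  let ?m = "\<mu> (2 * b)"
  let ?k = "L * ?m * (\<delta> * b powr (p - 1))"
  have m: "?m \<ge> 0" using mu_nonneg pos by simp
  have k: "?k \<ge> 0" using m L_pos pos by simp
  let ?d = "\<lambda>x. v x - w x"
  have ae: "AE x in lborel. \<bar>v x\<bar> \<le> b \<and> \<bar>w x\<bar> \<le> b \<and> \<bar>?d x\<bar> \<le> \<delta>"
    using v w d by (auto simp: Lbd_def)
  have le: "\<bar>F (v x) - F (w x)\<bar> \<le> L * ?m * (\<bar>?d x\<bar> * (\<bar>v x\<bar> powr (p - 1) + \<bar>w x\<bar> powr (p - 1)))"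
    if "\<bar>v x\<bar> \<le> b" "\<bar>w x\<bar> \<le> b" for x
  proof -
    have "\<mu> (\<bar>v x\<bar> + \<bar>w x\<bar>) \<le> ?m" using that by (intro mu_le) auto
    then have "L * \<bar>?d x\<bar> * (\<bar>v x\<bar> powr (p - 1) + \<bar>w x\<bar> powr (p - 1)) * \<mu> (\<bar>v x\<bar> + \<bar>w x\<bar>) \<le>
        L * \<bar>?d x\<bar> * (\<bar>v x\<bar> powr (p - 1) + \<bar>w x\<bar> powr (p - 1)) * ?m"
      using L_pos by (intro mult_left_mono mult_nonneg_nonneg add_nonneg_nonneg) auto
    with F_lipschitz[of "v x" "w x"] that pos show ?thesis by (simp add: mult_ac)
  qed
  have "AE x in lborel. \<bar>F (v x) - F (w x)\<bar> \<le> 4 * L * \<delta> * b powr (p - 1) * ?m"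
    using ae
  proof eventually_elim
    case (elim x)
    have "\<bar>?d x\<bar> * (\<bar>v x\<bar> powr (p - 1) + \<bar>w x\<bar> powr (p - 1)) \<le> \<delta> * (b powr (p - 1) + b powr (p - 1))"
      using elim p_gt_1 pos by (intro mult_mono add_mono powr_mono2) auto
    then have "L * ?m * (\<bar>?d x\<bar> * (\<bar>v x\<bar> powr (p - 1) + \<bar>w x\<bar> powr (p - 1))) \<le> L * ?m * (\<delta> * (b powr (p - 1) + b powr (p - 1)))"
      using m L_pos by (intro mult_left_mono) auto
    also have "\<dots> = 2 * ?k" by (simp add: algebra_simps)
    also have "\<dots> \<le> 4 * ?k" using k by linarith
    finally show ?case using le[of x] elim by (simp add: mult_ac)
  qed
  moreover have "(\<integral>\<^sup>+x. ennreal (\<bar>F (v x) - F (w x)\<bar> powr 1) \<partial>lborel) \<le> ennreal ((4 * L * \<delta> * b powr (p - 1) * ?m) powr 1)"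
  proof -
    let ?A = "\<lambda>x. ennreal (\<bar>?d x\<bar> powr p)" and ?V = "\<lambda>x. ennreal (\<bar>v x\<bar> powr p)" and ?W = "\<lambda>x. ennreal (\<bar>w x\<bar> powr p)"
    let ?a = "ennreal (?k * (2 / \<delta> powr p))" and ?b = "ennreal (?k * (1 / b powr p))"
    have "(\<integral>\<^sup>+x. ennreal (\<bar>F (v x) - F (w x)\<bar> powr 1) \<partial>lborel) \<le> (\<integral>\<^sup>+x. ?a * ?A x + ?b * ?V x + ?b * ?W x \<partial>lborel)"
    proof (rule nn_integral_mono_AE)
      show "AE x in lborel. ennreal (\<bar>F (v x) - F (w x)\<bar> powr 1) \<le> ?a * ?A x + ?b * ?V x + ?b * ?W x"
        using ae
      proof eventually_elim
        case (elim x)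
        have one: "\<bar>?d x\<bar> * \<bar>z\<bar> powr (p - 1) \<le> \<delta> * b powr (p - 1) * (\<bar>?d x\<bar> powr p / \<delta> powr p + \<bar>z\<bar> powr p / b powr p)" for z
        proof -
          have "\<delta> * b powr (p - 1) * ((\<bar>?d x\<bar> / \<delta>) * (\<bar>z\<bar> / b) powr (p - 1)) \<le>
             \<delta> * b powr (p - 1) * ((\<bar>?d x\<bar> / \<delta>) powr p + (\<bar>z\<bar> / b) powr p)"
            using pos p_gt_1 by (intro mult_left_mono mult_powr_le_sum_powr) auto
          moreover have "\<delta> * b powr (p - 1) * ((\<bar>?d x\<bar> / \<delta>) * (\<bar>z\<bar> / b) powr (p - 1)) = \<bar>?d x\<bar> * \<bar>z\<bar> powr (p - 1)"
            using pos by (simp add: powr_divide)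
          ultimately show ?thesis using pos by (simp add: powr_divide)
        qed
        have "\<bar>?d x\<bar> * (\<bar>v x\<bar> powr (p - 1) + \<bar>w x\<bar> powr (p - 1)) \<le>
            \<delta> * b powr (p - 1) * (2 / \<delta> powr p * \<bar>?d x\<bar> powr p + 1 / b powr p * \<bar>v x\<bar> powr p + 1 / b powr p * \<bar>w x\<bar> powr p)"
        proof -
          have "X * (2 / P * D + 1 / Q * V + 1 / Q * W) = X * (D / P + V / Q) + X * (D / P + W / Q)" for X P Q D V W :: real
            by (simp add: divide_inverse algebra_simps)
          then show ?thesis using one[of "v x"] one[of "w x"] by (simp only: distrib_left)
        qed
        then have "L * ?m * (\<bar>?d x\<bar> * (\<bar>v x\<bar> powr (p - 1) + \<bar>w x\<bar> powr (p - 1))) \<le> L * ?m * (\<delta> * b powr (p - 1) *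
            (2 / \<delta> powr p * \<bar>?d x\<bar> powr p + 1 / b powr p * \<bar>v x\<bar> powr p + 1 / b powr p * \<bar>w x\<bar> powr p))"
          using m L_pos by (intro mult_left_mono) auto
        also have "\<dots> = ?k * (2 / \<delta> powr p) * \<bar>?d x\<bar> powr p + ?k * (1 / b powr p) * \<bar>v x\<bar> powr p + ?k * (1 / b powr p) * \<bar>w x\<bar> powr p"
          by (simp only: distrib_left mult.assoc)
        finally have "\<bar>F (v x) - F (w x)\<bar> powr 1 \<le> ?k * (2 / \<delta> powr p) * \<bar>?d x\<bar> powr p + ?k * (1 / b powr p) * \<bar>v x\<bar> powr p + ?k * (1 / b powr p) * \<bar>w x\<bar> powr p"
          using le[of x] elim by simp
        moreover have "?k * (2 / \<delta> powr p) \<ge> 0" "?k * (1 / b powr p) \<ge> 0" using k by (simp_all add: zero_le_divide_iff del: times_divide_eq_right)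
        ultimately show ?case
          by (simp only: ennreal_mult'[symmetric] ennreal_plus[symmetric] mult_nonneg_nonneg add_nonneg_nonneg powr_ge_zero ennreal_leI)
      qed
    qed
    also have "\<dots> = ?a * (\<integral>\<^sup>+x. ?A x \<partial>lborel) + ?b * (\<integral>\<^sup>+x. ?V x \<partial>lborel) + ?b * (\<integral>\<^sup>+x. ?W x \<partial>lborel)"
      by (simp add: nn_integral_add nn_integral_cmult)
    also have "\<dots> \<le> ?a * ennreal (\<delta> powr p) + ?b * ennreal (b powr p) + ?b * ennreal (b powr p)"
      using v w d by (intro add_mono mult_left_mono) (auto simp: Lbd_def)
    also have "\<dots> = ennreal (?k * (2 / \<delta> powr p) * \<delta> powr p + ?k * (1 / b powr p) * b powr p + ?k * (1 / b powr p) * b powr p)"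
    proof -
      have "?k * (2 / \<delta> powr p) \<ge> 0" "?k * (1 / b powr p) \<ge> 0" using k by (simp_all add: zero_le_divide_iff del: times_divide_eq_right)
      then show ?thesis
        by (simp only: ennreal_mult'[symmetric] ennreal_plus[symmetric] mult_nonneg_nonneg add_nonneg_nonneg powr_ge_zero)
    qed
    also have "?k * (2 / \<delta> powr p) * \<delta> powr p + ?k * (1 / b powr p) * b powr p + ?k * (1 / b powr p) * b powr p = 4 * ?k"
      using pos by simp
    also have "4 * ?k = (4 * L * \<delta> * b powr (p - 1) * ?m) powr 1" using k by (simp add: mult_ac)
    finally show ?thesis .
  qed
  moreover have "4 * L * \<delta> * b powr (p - 1) * ?m \<ge> 0" using L_pos pos m by simp
  ultimately show ?thesis unfolding Lbd_def by simp
qed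

text \<open>The first summand is the decay of \<open>F(v)\<close> for \<open>v = O((1 + s)\<^bsup>-1/p\<^esup>)\<close>. The second one only serves to make the
  weight positive, as \<open>Minkowski_integral\<close> requires.\<close>

definition wt :: "real \<Rightarrow> real \<Rightarrow> real" where
  "wt c s = (\<mu> (c * (1 + s) powr (- 1 / p)) + (1 + s) powr (- 1 / p)) / (1 + s)"

lemma powr_decay_le_1: "s \<ge> 0 \<Longrightarrow> (1 + s) powr (- 1 / p) \<le> 1"
  using p_gt_1 powr_mono[of "- 1 / p" 0 "1 + s"] by simp

lemma wt_pos: "c > 0 \<Longrightarrow> s \<ge> 0 \<Longrightarrow> wt c s > 0"
  unfolding wt_def by (rule divide_pos_pos[OF add_nonneg_pos[OF mu_nonneg]]) auto

lemma wt_le: "c > 0 \<Longrightarrow> s \<ge> 0 \<Longrightarrow> wt c s \<le> (\<mu> c + 1) / (1 + s)"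
  unfolding wt_def using powr_decay_le_1[of s]
  by (intro divide_right_mono add_mono mu_le) (auto simp: mult_left_le)

lemma wt_measurable:
  assumes "c > 0"
  shows "(\<lambda>s. wt c (max 0 s)) \<in> borel_measurable borel"
proof -
  have "(\<lambda>s. wt c (max 0 s)) = (\<lambda>s. (\<mu> (max 0 (c * (1 + max 0 s) powr (- 1 / p))) + (1 + max 0 s) powr (- 1 / p)) / (1 + max 0 s))"
    using assms by (simp add: wt_def)
  also have "\<dots> \<in> borel_measurable borel"
    by (intro borel_measurable_divide borel_measurable_add measurable_compose[OF _ mu_max_measurable]) measurable
  finally show ?thesis .
qed

lemma wt_integrable:
  assumes "c > 0" and h: "h \<in> borel_measurable borel" "\<And>s. s \<in> {0..t} \<Longrightarrow> \<bar>h s\<bar> \<le> B"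
  shows "set_integrable lborel {0..t} (\<lambda>s. h s * wt c s)"
proof -
  have "set_integrable lborel {0..t} (\<lambda>s. h s * wt c (max 0 s))"
  proof (rule set_integrable_bounded)
    show "(\<lambda>s. h s * wt c (max 0 s)) \<in> borel_measurable borel"
      using wt_measurable[OF assms(1)] h(1) by simp
    show "AE s in lborel. s \<in> {0..t} \<longrightarrow> \<bar>h s * wt c (max 0 s)\<bar> \<le> B * (\<mu> c + 1)"
    proof (intro AE_I2 impI)
      fix s assume s: "s \<in> {0..t}"
      have m: "\<mu> c \<ge> 0" using mu_nonneg assms(1) by simp
      have "wt c s \<le> (\<mu> c + 1) / (1 + s)" using wt_le assms(1) s by simp
      also have "\<dots> \<le> \<mu> c + 1" using s m by (simp add: field_simps)
      finally have "\<bar>wt c s\<bar> \<le> \<mu> c + 1" using wt_pos[OF assms(1), of s] s by simp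
      then have "\<bar>h s\<bar> * \<bar>wt c s\<bar> \<le> B * (\<mu> c + 1)" using h(2)[OF s] by (intro mult_mono) auto
      then show "\<bar>h s * wt c (max 0 s)\<bar> \<le> B * (\<mu> c + 1)" using s by (simp add: abs_mult)
    qed
  qed
  then show ?thesis by (rule set_integrable_cong[THEN iffD1, rotated 3]) auto
qed

text \<open>With \<open>\<tau> = c (1 + s)^(-1/p)\<close> one has
  \<open>ds / (1 + s) = - p d\<tau> / \<tau>\<close>, so the integral over any \<open>[0, R]\<close>
  is at most \<open>p\<close> times that of \<open>\<nu>(\<tau>) / \<tau>\<close> over
  \<open>(0, c]\<close>.\<close>

lemma wt_integral_bound:
  assumes c: "c > 0" and dini: "set_integrable lborel {0<..c} (\<lambda>\<tau>. \<mu> \<tau> / \<tau>)"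
  shows "\<exists>W>0. \<forall>R\<ge>0. (LINT s:{0..R}|lborel. wt c s) \<le> W"
proof -
  \<comment> \<open>The summand \<open>(1 + s)^(-1/p)\<close> of the weight is
    \<open>\<tau> / c\<close> in the new variable; divided by \<open>\<tau>\<close> it is a
    constant.\<close>
  define \<nu> where "\<nu> \<tau> = \<mu> (max 0 \<tau>) + \<tau> / c" for \<tau>
  define q where "q = (\<lambda>\<tau>. ennreal (indicator {0<..c} \<tau> * (\<nu> \<tau> / \<tau>)))"
  have [measurable]: "\<nu> \<in> borel_measurable borel" unfolding \<nu>_def by measurable
  have qm[measurable]: "q \<in> borel_measurable borel" unfolding q_def by measurable
  have "set_integrable lborel {0<..c} (\<lambda>\<tau>. \<mu> \<tau> / \<tau> + 1 / c)"
  proof (intro set_integral_add dini)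
    show "set_integrable lborel {0<..c} (\<lambda>\<tau>. 1 / c)"
      unfolding set_integrable_def using c
      by (intro integrable_scaleR_left integrable_real_indicator) auto
  qed
  then have "integrable lborel (\<lambda>\<tau>. indicator {0<..c} \<tau> * (\<nu> \<tau> / \<tau>))"
    unfolding set_integrable_def
    by (rule Bochner_Integration.integrable_cong[THEN iffD1, rotated 2]) (auto simp: \<nu>_def indicator_def add_divide_distrib)
  then have "(\<integral>\<^sup>+\<tau>. q \<tau> \<partial>lborel) = ennreal (LINT \<tau>|lborel. indicator {0<..c} \<tau> * (\<nu> \<tau> / \<tau>))"
    unfolding q_def using c mu_nonneg
    by (intro nn_integral_eq_integral AE_I2) (auto simp: \<nu>_def indicator_def)
  then obtain Q where Q: "(\<integral>\<^sup>+\<tau>. q \<tau> \<partial>lborel) = ennreal Q" by blast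
  have "(LINT s:{0..R}|lborel. wt c s) \<le> p * \<bar>Q\<bar> + 1" if R: "R \<ge> 0" for R
  proof -
    \<comment> \<open>\<open>g\<close> is minus the new variable, because the substitution rule asks
      for a nonnegative derivative; a reflection undoes the sign afterwards.\<close>
    define g where "g s = - (c * (1 + s) powr (- 1 / p))" for s
    define g' where "g' s = c / p * (1 + s) powr (- 1 / p - 1)" for s
    define f where "f y = \<nu> (- y) / (- y)" for y
    have [measurable]: "f \<in> borel_measurable borel" unfolding f_def by measurable
    have fg: "wt c s = p * (f (g s) * g' s)" if "s \<ge> 0" for s
    proof -
      have e: "(1 + s) powr (- 1 / p - 1) = (1 + s) powr (- 1 / p) / (1 + s)" using that by (simp add: powr_diff)
      define z where "z = (1 + s) powr (- 1 / p)"
      have z: "z > 0" using that by (simp add: z_def)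
      have "p * (X / (c * z) * (c / p * (z / (1 + s)))) = X / (1 + s)" for X
        using c p_gt_1 z by simp
      moreover have "\<nu> (c * z) = \<mu> (c * z) + z" using c z by (simp add: \<nu>_def)
      ultimately show ?thesis
        unfolding wt_def f_def g_def g'_def e z_def[symmetric] minus_minus by metis
    qed
    have "ennreal (LINT s:{0..R}|lborel. wt c s) = (\<integral>\<^sup>+s. ennreal (indicator {0..R} s * wt c s) \<partial>lborel)"
      using wt_integrable[OF c, of "\<lambda>_. 1" R 1] wt_pos[OF c]
      unfolding set_lebesgue_integral_def set_integrable_def
      by (subst nn_integral_eq_integral) (auto simp: indicator_def less_imp_le)
    also have "\<dots> = (\<integral>\<^sup>+s. ennreal p * ennreal (f (g s) * g' s * indicator {0..R} s) \<partial>lborel)"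
    proof (rule nn_integral_cong)
      fix s
      show "ennreal (indicator {0..R} s * wt c s) = ennreal p * ennreal (f (g s) * g' s * indicator {0..R} s)"
        using fg[of s] p_gt_1 by (auto simp: indicator_def ennreal_mult'[symmetric])
    qed
    also have "\<dots> = ennreal p * (\<integral>\<^sup>+s. ennreal (f (g s) * g' s * indicator {0..R} s) \<partial>lborel)"
    proof (rule nn_integral_cmult)
      show "(\<lambda>s. ennreal (f (g s) * g' s * indicator {0..R} s)) \<in> borel_measurable lborel"
        unfolding g_def g'_def by measurable
    qed
    finally have 1: "ennreal (LINT s:{0..R}|lborel. wt c s) =
        ennreal p * (\<integral>\<^sup>+s. ennreal (f (g s) * g' s * indicator {0..R} s) \<partial>lborel)" .
    have "(\<integral>\<^sup>+s. ennreal (f (g s) * g' s * indicator {0..R} s) \<partial>lborel) = (\<integral>\<^sup>+y. ennreal (f y * indicator {g 0..g R} y) \<partial>lborel)"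
    proof (rule nn_integral_substitution[symmetric])
      show "set_borel_measurable borel {g 0..g R} f" unfolding set_borel_measurable_def by simp
      fix s assume "s \<in> {0..R}"
      then show "(g has_real_derivative g' s) (at s)"
        unfolding g_def g'_def using p_gt_1 by (auto intro!: derivative_eq_intros simp: field_simps)
      show "g' s \<ge> 0" unfolding g'_def using c p_gt_1 by simp
    next
      show "continuous_on {0..R} g'"
        unfolding g'_def by (intro continuous_intros) auto
    qed (rule R)
    also have "\<dots> \<le> (\<integral>\<^sup>+y. q (0 + (- 1) * y) \<partial>lborel)"
    proof (rule nn_integral_mono)
      fix y
      have "g 0 = - c" by (simp add: g_def)
      moreover have "g R < 0" using c R by (simp add: g_def)
      ultimately show "ennreal (f y * indicator {g 0..g R} y) \<le> q (0 + (- 1) * y)"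
        by (auto simp: q_def f_def indicator_def)
    qed
    also have "\<dots> = (\<integral>\<^sup>+\<tau>. q \<tau> \<partial>lborel)" using nn_integral_real_affine[OF qm, of "-1" 0] by simp
    also have "\<dots> \<le> ennreal \<bar>Q\<bar>" unfolding Q by (rule ennreal_leI) simp
    finally have "ennreal (LINT s:{0..R}|lborel. wt c s) \<le> ennreal p * ennreal \<bar>Q\<bar>"
      unfolding 1 by (rule mult_left_mono) simp
    then have "ennreal (LINT s:{0..R}|lborel. wt c s) \<le> ennreal (p * \<bar>Q\<bar>)"
      using p_gt_1 by (simp add: ennreal_mult)
    then have "(LINT s:{0..R}|lborel. wt c s) \<le> p * \<bar>Q\<bar>"
      using p_gt_1 by (subst (asm) ennreal_le_iff) auto
    then show ?thesis by simp
  qed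
  moreover have "p * \<bar>Q\<bar> + 1 > 0" using p_gt_1 by (simp add: add_nonneg_pos)
  ultimately show ?thesis by blast
qed

lemma powr_integral_bound:
  assumes t: "t \<ge> 0"
  shows "(LINT s:{0..t}|lborel. (1 + (t - s)) powr (- 1 / p)) \<le> (1 + t) powr (1 - 1 / p) / (1 - 1 / p)"
proof -
  have a: "1 - 1 / p > 0" using p_gt_1 by simp
  let ?G = "\<lambda>s. - ((1 + (t - s)) powr (1 - 1 / p)) / (1 - 1 / p)"
  have "((\<lambda>s. (1 + (t - s)) powr (- 1 / p)) has_integral (?G t - ?G 0)) {0..t}"
  proof (rule fundamental_theorem_of_calculus[OF t])
    fix s assume "s \<in> {0..t}"
    then have "(?G has_real_derivative (1 + (t - s)) powr (- 1 / p)) (at s)"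
      using a by (auto intro!: derivative_eq_intros)
    then show "(?G has_vector_derivative (1 + (t - s)) powr (- 1 / p)) (at s within {0..t})"
      by (simp add: has_real_derivative_iff_has_vector_derivative has_vector_derivative_at_within)
  qed
  moreover have "set_integrable lborel {0..t} (\<lambda>s. (1 + (t - s)) powr (- 1 / p))"
    unfolding set_integrable_def
    by (intro borel_integrable_compact continuous_intros) auto
  ultimately have "(LINT s:{0..t}|lborel. (1 + (t - s)) powr (- 1 / p)) = ?G t - ?G 0"
    using set_borel_integral_eq_integral(2) by (metis integral_unique)
  also have "\<dots> \<le> (1 + t) powr (1 - 1 / p) / (1 - 1 / p)"
    using a t by (simp add: diff_divide_distrib[symmetric] divide_right_mono)
  finally show ?thesis .
qed

text \<open>Split at \<open>t / 2\<close>. For earlier \<open>s\<close> the kernel is at most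
  \<open>2^(1/p) (1 + t)^(-1/p)\<close> and the weight has bounded integral. For later
  \<open>s\<close> the weight is at most \<open>2 N / (1 + t)\<close>, while the kernel integrates
  to at most a multiple of \<open>(1 + t)^(1 - 1/p)\<close> since \<open>p > 1\<close>. The two
  constants add up to \<open>A\<close>.\<close>

lemma decay_convolution:
  assumes c: "c > 0" and dini: "set_integrable lborel {0<..c} (\<lambda>\<tau>. \<mu> \<tau> / \<tau>)"
  shows "\<exists>A>0. \<forall>t\<ge>0. (LINT s:{0..t}|lborel. (1 + (t - s)) powr (- 1 / p) * wt c s) \<le> A * (1 + t) powr (- 1 / p)"
proof -
  obtain W where W: "W > 0" "\<And>R. R \<ge> 0 \<Longrightarrow> (LINT s:{0..R}|lborel. wt c s) \<le> W"
    using wt_integral_bound[OF assms] by blast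
  define N where "N = \<mu> c + 1"
  have N: "N > 0" using mu_nonneg[of c] c by (simp add: N_def)
  define A where "A = 2 powr (1 / p) * W + 2 * N / (1 - 1 / p)"
  have a: "1 - 1 / p > 0" using p_gt_1 by simp
  have "(LINT s:{0..t}|lborel. (1 + (t - s)) powr (- 1 / p) * wt c s) \<le> A * (1 + t) powr (- 1 / p)" if t: "t \<ge> 0" for t
  proof -
    let ?k = "\<lambda>s. (1 + (t - s)) powr (- 1 / p)"
    let ?d = "(1 + t) powr (- 1 / p)"
    have k1: "\<bar>?k s\<bar> \<le> 1" if "s \<in> {0..t}" for s using powr_decay_le_1[of "t - s"] that by simp
    have ki: "set_integrable lborel {0..t} ?k"
      by (rule set_integrable_bounded[where B = 1]) (use k1 in auto)
    have wi: "set_integrable lborel {0..t} (wt c)" using wt_integrable[OF c, of "\<lambda>_. 1" t 1] by simp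
    \<comment> \<open>The two regimes are added pointwise instead of splitting the integral; in each
      of them the other summand is nonnegative.\<close>
    have pt: "?k s * wt c s \<le> 2 powr (1 / p) * ?d * wt c s + 2 * N / (1 + t) * ?k s" if s: "s \<in> {0..t}" for s
    proof (cases "s \<le> t / 2")
      case True
      have "?k s \<le> ((1 + t) / 2) powr (- 1 / p)" using True s p_gt_1 by (intro powr_mono2') auto
      also have "\<dots> = 2 powr (1 / p) * ?d" using t by (simp add: powr_divide powr_minus_divide)
      finally have "?k s * wt c s \<le> 2 powr (1 / p) * ?d * wt c s"
        using wt_pos[OF c, of s] s by (intro mult_right_mono) auto
      moreover have "2 * N / (1 + t) * ?k s \<ge> 0" using N t by simp
      ultimately show ?thesis by linarith
    next
      case False
      have "wt c s \<le> N / (1 + s)" using wt_le[OF c, of s] s by (simp add: N_def)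
      also have "\<dots> \<le> N / ((1 + t) / 2)" using N False s t by (intro divide_left_mono) auto
      finally have "?k s * wt c s \<le> ?k s * (2 * N / (1 + t))" by (intro mult_left_mono) (auto simp: mult.commute)
      moreover have "2 powr (1 / p) * ?d * wt c s \<ge> 0" using wt_pos[OF c, of s] s by simp
      ultimately show ?thesis by (simp add: mult.commute)
    qed
    have "(LINT s:{0..t}|lborel. ?k s * wt c s) \<le> (LINT s:{0..t}|lborel. 2 powr (1 / p) * ?d * wt c s + 2 * N / (1 + t) * ?k s)"
      by (intro set_integral_mono set_integral_add set_integrable_mult_right wi ki pt wt_integrable[OF c, where B = 1] k1) auto
    also have "\<dots> = 2 powr (1 / p) * ?d * (LINT s:{0..t}|lborel. wt c s) + 2 * N / (1 + t) * (LINT s:{0..t}|lborel. ?k s)"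
      using wi ki by (subst set_integral_add) auto
    also have "\<dots> \<le> 2 powr (1 / p) * ?d * W + 2 * N / (1 + t) * ((1 + t) powr (1 - 1 / p) / (1 - 1 / p))"
      using W(2)[OF t] powr_integral_bound[OF t] N t by (intro add_mono mult_left_mono) auto
    also have "2 * N / (1 + t) * ((1 + t) powr (1 - 1 / p) / (1 - 1 / p)) = 2 * N / (1 - 1 / p) * ?d"
    proof -
      have "(1 + t) powr (1 - 1 / p) = (1 + t) * ?d" using t by (simp add: powr_diff powr_minus_divide)
      then show ?thesis using t by simp
    qed
    finally show ?thesis by (simp add: A_def algebra_simps)
  qed
  moreover have "A > 0" unfolding A_def using W(1) N a by (intro add_pos_pos mult_pos_pos divide_pos_pos) auto
  ultimately show ?thesis by blast
qed

end

section \<open>Existence\<close>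

lemma primitive_AE_cong:
  assumes v: "(\<lambda>(t, x). v t x) \<in> borel_measurable (borel \<Otimes>\<^sub>M borel)"
    and w: "(\<lambda>(t, x). w t x) \<in> borel_measurable (borel \<Otimes>\<^sub>M borel)"
    and eq: "AE t in lborel. t \<in> {0..} \<longrightarrow> (AE x in lborel. v t x = (w t x :: real))"
  shows "AE x in lborel. primitive v t x = primitive w t x"
proof -
  have "AE x in lborel. AE t in lborel. t \<in> {0..} \<longrightarrow> v t x = w t x"
    using eq AE_time_space_commute[OF v w, of "{0..}"] by simp
  then show ?thesis
  proof eventually_elim
    case (elim x)
    have [measurable]: "(\<lambda>t. v t x) \<in> borel_measurable borel" "(\<lambda>t. w t x) \<in> borel_measurable borel"
      using measurable_slice(1)[OF v] measurable_slice(1)[OF w] by auto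
    show ?case
      unfolding primitive_def set_lebesgue_integral_def
      by (rule integral_cong_AE) (use elim in \<open>auto elim!: eventually_mono simp: indicator_def\<close>)
  qed
qed

lemma primitive_iterate_cong:
  assumes v: "(\<lambda>(t, x). v t x) \<in> borel_measurable (borel \<Otimes>\<^sub>M borel)"
    and w: "(\<lambda>(t, x). w t x) \<in> borel_measurable (borel \<Otimes>\<^sub>M borel)"
    and eq: "AE t in lborel. t \<in> {0..} \<longrightarrow> (AE x in lborel. v t x = (w t x :: real))"
  shows "AE t in lborel. t \<in> {0..} \<longrightarrow> (AE x in lborel. (primitive ^^ j) v t x = (primitive ^^ j) w t x)"
proof (induction j)
  case (Suc j)
  have m: "(\<lambda>(t, x). (primitive ^^ j) u t x) \<in> borel_measurable (borel \<Otimes>\<^sub>M borel)"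
    if "(\<lambda>(t, x). u t x) \<in> borel_measurable (borel \<Otimes>\<^sub>M borel)" for u :: "real \<Rightarrow> 'a \<Rightarrow> real"
    using that by (induction j) (auto intro: primitive_measurable)
  show ?case using primitive_AE_cong[OF m[OF v] m[OF w] Suc.IH] by simp
qed (use eq in simp)

locale semilinear = linear_flow m l d c K p r + nonlinearity p \<mu> F eps L
  for m l :: nat and d :: "nat \<Rightarrow> nat" and c :: "nat \<Rightarrow> ('n::finite \<Rightarrow> nat) \<Rightarrow> real"
    and K :: "real \<Rightarrow> 'n dist" and p :: real and r :: ereal and \<mu> F :: "real \<Rightarrow> real" and eps L :: real
begin

definition Fc :: "(real \<Rightarrow> real^'n \<Rightarrow> real) \<Rightarrow> real \<Rightarrow> real^'n \<Rightarrow> real" where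
  "Fc v = (\<lambda>s x. F (v s x))"

lemma Fc_family: "family p v \<Longrightarrow> family 1 (Fc v)"
  unfolding Fc_def by (rule F_family)

text \<open>At each time \<open>J\<close> of the zero family is 0 only a.e. in \<open>x\<close>. The
  integral is compared with multiples of \<open>1/(k+1)\<close> for every \<open>k\<close>, since
  \<open>primitive_Lbd\<close> accepts positive bounds only.\<close>

lemma \<Phi>_zero:
  assumes "g = (\<lambda>_ _. 0)"
  shows "AE x in lborel. \<Phi> g t x = 0"
proof -
  have g: "family 1 g" unfolding family_def assms using Lbd_zero by (auto intro!: exI[of _ 0])
  have "Lbd p (\<Phi> g t) ((\<bar>t\<bar> + 1) * (1 / Suc k))" for k :: nat
  proof -
    have "Lbd p (J g (t - s, s)) (1 / Suc k)" if "s \<in> {0..t}" for s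
    proof (rule Lbd_mono)
      have "Lbd 1 (g s) 0" unfolding assms by (rule Lbd_zero)
      from J_slice_Lbd[OF g this that] show "Lbd p (J g (t - s, s)) (2 * C * 0)" .
    qed (use p in auto)
    then have "AE s in lborel. s \<in> {0..t} \<longrightarrow> Lbd p (J g (t - s, s)) (1 / Suc k)" by (intro AE_I2) auto
    from primitive_Lbd(1)[OF p J_slice_measurable[OF g] _ this order_refl]
    show ?thesis by (simp add: primitive_def[abs_def] \<Phi>_def[abs_def])
  qed
  then have "AE x in lborel. \<forall>k::nat. \<bar>\<Phi> g t x\<bar> \<le> (\<bar>t\<bar> + 1) * (1 / Suc k)"
    unfolding AE_all_countable Lbd_def by blast
  then show ?thesis
  proof eventually_elim
    case (elim x)
    have "(\<lambda>k. (\<bar>t\<bar> + 1) * (1 / real (Suc k))) \<longlonglongrightarrow> (\<bar>t\<bar> + 1) * 0"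
      by (intro tendsto_intros LIMSEQ_Suc lim_1_over_n)
    then have "\<bar>\<Phi> g t x\<bar> \<le> (\<bar>t\<bar> + 1) * 0" by (rule LIMSEQ_le_const) (use elim in auto)
    then show ?case by simp
  qed
qed

definition T :: "(real^'n \<Rightarrow> real) \<Rightarrow> (real \<Rightarrow> real^'n \<Rightarrow> real) \<Rightarrow> real \<Rightarrow> real^'n \<Rightarrow> real" where
  "T f v t x = (if t < 0 then 0 else V f (Fc v) t x)"

text \<open>Vanishing at negative times makes the members a \<open>family\<close>, whose bounds
  concern all \<open>s \<le> T\<close>.\<close>

definition small :: "real \<Rightarrow> (real \<Rightarrow> real^'n \<Rightarrow> real) \<Rightarrow> bool" where
  "small M v \<longleftrightarrow> (\<lambda>(t, x). v t x) \<in> borel_measurable (borel \<Otimes>\<^sub>M borel) \<and> (\<forall>t<0. v t = (\<lambda>_. 0)) \<and>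
     (\<forall>t\<ge>0. Lbd p (v t) (M * (1 + t) powr (- 1 / p)))"

lemma small_Lbd:
  assumes "small M v" "M \<ge> 0"
  shows "Lbd p (v t) M"
proof (cases "t < 0")
  case True
  then have "v t = (\<lambda>_. 0)" using assms by (simp add: small_def)
  then show ?thesis using Lbd_mono[OF Lbd_zero, of M p] assms p by simp
next
  case False
  then have "Lbd p (v t) (M * (1 + t) powr (- 1 / p))" using assms by (simp add: small_def)
  then show ?thesis
    by (rule Lbd_mono) (use decay_le_1[of t] False assms(2) p in \<open>auto simp: mult_left_le\<close>)
qed

lemma small_family: "small M v \<Longrightarrow> M \<ge> 0 \<Longrightarrow> family p v"
  unfolding family_def using small_Lbd by (auto simp: small_def)

lemma T_measurable:
  assumes f: "in_Lcap 1 r f" and v: "family p v"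
  shows "(\<lambda>(t, x). T f v t x) \<in> borel_measurable (borel \<Otimes>\<^sub>M borel)"
proof -
  note [measurable] = V_measurable[OF f Fc_family[OF v]]
  show ?thesis unfolding T_def by measurable
qed

text \<open>Here the decay rate meets the power: \<open>- 1/p - (p - 1)/p = - 1\<close>.\<close>

lemma decay_powr:
  assumes "t \<ge> 0" "M > 0" "D > 0"
  shows "D * (1 + t) powr (- 1 / p) * (M * (1 + t) powr (- 1 / p)) powr (p - 1) = D * M powr (p - 1) / (1 + t)"
proof -
  have "(1 + t) powr (- 1 / p) * ((1 + t) powr (- 1 / p)) powr (p - 1) = (1 + t) powr (- 1 / p + (- 1 / p) * (p - 1))"
    by (simp only: powr_powr powr_add)
  also have "- 1 / p + (- 1 / p) * (p - 1) = - 1" using p by (simp add: field_simps)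
  also have "(1 + t) powr - 1 = 1 / (1 + t)" using assms by (simp add: powr_minus_divide)
  finally have e: "(1 + t) powr (- 1 / p) * ((1 + t) powr (- 1 / p)) powr (p - 1) = 1 / (1 + t)" .
  have "D * z * (M * z) powr (p - 1) = D * M powr (p - 1) * (z * z powr (p - 1))" for z
    by (simp add: powr_mult)
  from this[of "(1 + t) powr (- 1 / p)"] show ?thesis unfolding e by simp
qed

text \<open>\<open>M \<le> eps\<close> keeps \<open>v\<close> and \<open>w\<close> where
  \<open>F\<close> is Lipschitz, and \<open>2 * M \<le> c0\<close> dominates the argument of
  \<open>\<mu>\<close> by that in the weight \<open>wt c0\<close>.\<close>

lemma Fc_diff_wt:
  assumes v: "small M v" and w: "small M w" and M: "0 < M" "M \<le> eps" "2 * M \<le> c0" and D: "D > 0" and t: "t \<ge> 0"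
    and d: "Lbd p (\<lambda>x. v t x - w t x) (D * (1 + t) powr (- 1 / p))"
  shows "Lbd 1 (\<lambda>x. Fc v t x - Fc w t x) (4 * L * D * M powr (p - 1) * wt c0 t)"
proof -
  let ?e = "(1 + t) powr (- 1 / p)"
  have e: "?e > 0" "?e \<le> 1" using t decay_le_1 by auto
  have "M * ?e \<le> eps" using M e by (meson mult_left_le less_imp_le order_trans)
  then have 1: "Lbd 1 (\<lambda>x. Fc v t x - Fc w t x) (4 * L * (D * ?e) * (M * ?e) powr (p - 1) * \<mu> (2 * (M * ?e)))"
    unfolding Fc_def using v w d M D e t by (intro F_diff_Lbd) (auto simp: small_def)
  have "\<mu> (2 * (M * ?e)) \<le> \<mu> (c0 * ?e)" using M e by (intro mu_le) auto
  also have "\<dots> \<le> \<mu> (c0 * ?e) + ?e" using e by simp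
  finally have le: "\<mu> (2 * (M * ?e)) \<le> \<mu> (c0 * ?e) + ?e" .
  have "4 * L * (D * ?e) * (M * ?e) powr (p - 1) * \<mu> (2 * (M * ?e)) = 4 * L * (D * M powr (p - 1) / (1 + t)) * \<mu> (2 * (M * ?e))"
    using decay_powr[OF t M(1) D] by (simp only: mult.assoc)
  also have "\<dots> \<le> 4 * L * (D * M powr (p - 1) / (1 + t)) * (\<mu> (c0 * ?e) + ?e)"
    using L_pos D M t by (intro mult_left_mono le) auto
  also have "\<dots> = 4 * L * D * M powr (p - 1) * wt c0 t" by (simp add: wt_def)
  finally show ?thesis by (intro Lbd_mono[OF 1]) auto
qed

lemma T_contraction:
  assumes f: "in_Lcap 1 r f" and v: "small M v" and w: "small M w" and M: "0 < M" "M \<le> eps" "2 * M \<le> c0" and D: "D > 0"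
    and A: "A > 0" "\<forall>t\<ge>0. (LINT s:{0..t}|lborel. (1 + (t - s)) powr (- 1 / p) * wt c0 s) \<le> A * (1 + t) powr (- 1 / p)"
    and MA: "16 * C * L * A * M powr (p - 1) \<le> 1"
    and d: "\<And>t. t \<ge> 0 \<Longrightarrow> Lbd p (\<lambda>x. v t x - w t x) (D * (1 + t) powr (- 1 / p))" and t: "t \<ge> 0"
  shows "Lbd p (\<lambda>x. \<Phi> (Fc v) t x - \<Phi> (Fc w) t x) (D / 2 * (1 + t) powr (- 1 / p))"
proof (rule \<Phi>_diff_Lbd)
  let ?H = "\<lambda>s. 4 * L * D * M powr (p - 1) * wt c0 s"
  let ?k = "2 * C * (4 * L * D * M powr (p - 1))"
  have c0: "c0 > 0" using M by simp
  show "family 1 (Fc v)" "family 1 (Fc w)" using small_family v w M(1) Fc_family by auto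
  show "AE s in lborel. s \<in> {0..t} \<longrightarrow> Lbd 1 (\<lambda>x. Fc v s x - Fc w s x) (?H s)"
    by (intro AE_I2 impI Fc_diff_wt v w M D d) auto
  show "?H s > 0" if "s \<in> {0..t}" for s using that wt_pos[OF c0] L_pos D M by simp
  have e: "2 * C * (1 + (t - s)) powr (- 1 / p) * ?H s = ?k * ((1 + (t - s)) powr (- 1 / p) * wt c0 s)" for s
    by (simp only: mult_ac)
  have int: "set_integrable lborel {0..t} (\<lambda>s. (1 + (t - s)) powr (- 1 / p) * wt c0 s)"
    using decay_le_1 by (intro wt_integrable[OF c0, where B = 1]) auto
  show "set_integrable lborel {0..t} (\<lambda>s. 2 * C * (1 + (t - s)) powr (- 1 / p) * ?H s)"
    unfolding e by (rule set_integrable_mult_right[OF int])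
  have "(LINT s:{0..t}|lborel. 2 * C * (1 + (t - s)) powr (- 1 / p) * ?H s) = ?k * (LINT s:{0..t}|lborel. (1 + (t - s)) powr (- 1 / p) * wt c0 s)"
    unfolding e by (rule set_integral_mult_right)
  also have "\<dots> \<le> ?k * (A * (1 + t) powr (- 1 / p))"
    using C_pos L_pos D by (intro mult_left_mono A(2)[rule_format, OF t]) auto
  \<comment> \<open>16 collects the 2 of \<open>Lcap_norm\<close>, the 4 of
    \<open>F_diff_Lbd\<close> and another 2 for the contraction factor \<open>1/2\<close>.\<close>
  also have "\<dots> = (16 * C * L * A * M powr (p - 1)) * (D / 2 * (1 + t) powr (- 1 / p))" by simp
  also have "\<dots> \<le> 1 * (D / 2 * (1 + t) powr (- 1 / p))" using MA D by (intro mult_right_mono) auto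
  finally show "(LINT s:{0..t}|lborel. 2 * C * (1 + (t - s)) powr (- 1 / p) * ?H s) \<le> D / 2 * (1 + t) powr (- 1 / p)" by simp
  show "D / 2 * (1 + t) powr (- 1 / p) > 0" using D t by simp
qed

lemma small_zero: "M \<ge> 0 \<Longrightarrow> small M (\<lambda>_ _. 0)"
  unfolding small_def using p by (auto intro!: Lbd_mono[OF Lbd_zero])

text \<open>As \<open>F 0 = 0\<close>, the Duhamel term is its difference from that of the zero
  function, and the contraction estimate with \<open>D = M\<close> bounds it by half the radius. The
  datum fills the other half.\<close>

lemma T_small:
  assumes f: "in_Lcap 1 r f" and v: "small M v" and M: "0 < M" "M \<le> eps" "2 * M \<le> c0"
    and A: "A > 0" "\<forall>t\<ge>0. (LINT s:{0..t}|lborel. (1 + (t - s)) powr (- 1 / p) * wt c0 s) \<le> A * (1 + t) powr (- 1 / p)"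
    and MA: "16 * C * L * A * M powr (p - 1) \<le> 1" and fM: "C * Lcap_norm 1 r f \<le> M / 2"
  shows "small M (T f v)"
  unfolding small_def
proof (intro conjI allI impI)
  show "(\<lambda>(t, x). T f v t x) \<in> borel_measurable (borel \<Otimes>\<^sub>M borel)"
    using small_family[OF v] M by (intro T_measurable f) auto
  show "T f v t = (\<lambda>_. 0)" if "t < 0" for t using that by (auto simp: T_def)
  fix t :: real assume t: "t \<ge> 0"
  let ?e = "(1 + t) powr (- 1 / p)"
  let ?z = "\<lambda>_ _. 0 :: real"
  have "C * ?e * Lcap_norm 1 r f \<le> M / 2 * ?e" using mult_right_mono[OF fM, of ?e] by (simp add: mult_ac)
  then have 1: "Lbd p (U f t) (M / 2 * ?e)" using U_Lbd[OF f t] p by (auto elim!: Lbd_mono)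
  have "Lbd p (\<lambda>x. \<Phi> (Fc v) t x - \<Phi> (Fc ?z) t x) (M / 2 * ?e)"
    by (rule T_contraction[OF f v small_zero M M(1) A MA _ t]) (use v M in \<open>auto simp: small_def\<close>)
  then have 2: "Lbd p (\<lambda>x. U f t x + (\<Phi> (Fc v) t x - \<Phi> (Fc ?z) t x)) (M / 2 * ?e + M / 2 * ?e)"
    using p by (intro Lbd_add[OF 1]) auto
  have "AE x in lborel. \<Phi> (Fc ?z) t x = 0" by (rule \<Phi>_zero) (simp add: Fc_def F_0)
  then have 3: "AE x in lborel. T f v t x = U f t x + (\<Phi> (Fc v) t x - \<Phi> (Fc ?z) t x)"
    by eventually_elim (use t in \<open>simp add: T_def V_def\<close>)
  have "T f v t \<in> borel_measurable borel"
    by (rule measurable_slice(2)[OF T_measurable[OF f]]) (use small_family[OF v] M in auto)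
  from Lbd_AE_cong[OF 2 this 3] p show "Lbd p (T f v t) (M * ?e)" by simp
qed

lemma T_diff:
  assumes "t \<ge> 0"
  shows "T f v t x - T f w t x = \<Phi> (Fc v) t x - \<Phi> (Fc w) t x"
  using assms by (simp add: T_def V_def)

lemma Lbd_small_AE_0:
  assumes "\<And>k::nat. Lbd p w (B * (1 / 2) ^ k)"
  shows "AE x in lborel. w x = 0"
proof -
  have "AE x in lborel. \<forall>k::nat. \<bar>w x\<bar> \<le> B * (1 / 2) ^ k"
    using assms unfolding AE_all_countable Lbd_def by blast
  then show ?thesis
  proof eventually_elim
    case (elim x)
    have "(\<lambda>k. B * (1 / 2) ^ k) \<longlonglongrightarrow> B * 0" by (intro tendsto_intros LIMSEQ_power_zero) simp
    then have "\<bar>w x\<bar> \<le> B * 0" by (rule LIMSEQ_le_const) (use elim in auto)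
    then show ?case by simp
  qed
qed

text \<open>Picard iteration from 0. Successive differences are at most \<open>M / 2^k\<close> times
  the decay, so the iterates converge a.e. in \<open>x\<close> at each time
  \<open>t \<ge> 0\<close>. Taking \<open>lim\<close> as a function of \<open>(t, x)\<close> keeps
  the limit jointly measurable.\<close>

lemma fixed_point:
  assumes f: "in_Lcap 1 r f" and M: "0 < M" "M \<le> eps" "2 * M \<le> c0"
    and A: "A > 0" "\<forall>t\<ge>0. (LINT s:{0..t}|lborel. (1 + (t - s)) powr (- 1 / p) * wt c0 s) \<le> A * (1 + t) powr (- 1 / p)"
    and MA: "16 * C * L * A * M powr (p - 1) \<le> 1" and fM: "C * Lcap_norm 1 r f \<le> M / 2"
  obtains v where "small M v" "\<And>t. t \<ge> 0 \<Longrightarrow> AE x in lborel. v t x = V f (Fc v) t x"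
proof -
  define v where "v k = (T f ^^ k) (\<lambda>_ _. 0)" for k
  have v_Suc: "v (Suc k) = T f (v k)" for k by (simp add: v_def)
  have sm: "small M (v k)" for k
  proof (induction k)
    case 0
    show ?case using small_zero M by (simp add: v_def)
  next
    case (Suc k)
    show ?case unfolding v_Suc by (rule T_small[OF f Suc M A MA fM])
  qed
  let ?e = "\<lambda>t. (1 + t) powr (- 1 / p)"
  note contr = T_contraction[OF f _ _ M _ A MA]
  have step: "Lbd p (\<lambda>x. v (Suc k) t x - v k t x) (M * (1 / 2) ^ k * ?e t)" if t: "t \<ge> 0" for k t
    using t
  proof (induction k arbitrary: t)
    case 0
    have "v 0 t = (\<lambda>_. 0)" by (simp add: v_def)
    then show ?case using sm[of "Suc 0"] 0 by (simp add: small_def)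
  next
    case (Suc k)
    have "Lbd p (\<lambda>x. T f (v (Suc k)) t x - T f (v k) t x) (M * (1 / 2) ^ k / 2 * ?e t)"
      unfolding T_diff[OF Suc.prems] by (rule contr[OF sm sm _ _ Suc.prems]) (use M Suc.IH in auto)
    then show ?case by (simp add: v_Suc)
  qed
  \<comment> \<open>The geometric sum is kept in exact form so that the induction over
    \<open>j\<close> closes; \<open>cauchy'\<close> then drops the negative part.\<close>
  have cauchy: "Lbd p (\<lambda>x. v (k + j) t x - v k t x) (2 * M * ((1 / 2) ^ k - (1 / 2) ^ (k + j)) * ?e t)" if t: "t \<ge> 0" for k j t
  proof (induction j)
    case 0
    then show ?case by simp
  next
    case (Suc j)
    have "Lbd p (\<lambda>x. (v (Suc (k + j)) t x - v (k + j) t x) + (v (k + j) t x - v k t x))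
       (M * (1 / 2) ^ (k + j) * ?e t + 2 * M * ((1 / 2) ^ k - (1 / 2) ^ (k + j)) * ?e t)"
      using p by (intro Lbd_add step t Suc) auto
    moreover have "M * (1 / 2) ^ (k + j) * ?e t + 2 * M * ((1 / 2) ^ k - (1 / 2) ^ (k + j)) * ?e t =
       2 * M * ((1 / 2) ^ k - (1 / 2) ^ (k + Suc j)) * ?e t" by (simp add: algebra_simps)
    ultimately show ?case by simp
  qed
  have cauchy': "Lbd p (\<lambda>x. v (k + j) t x - v k t x) (2 * M * (1 / 2) ^ k * ?e t)" if t: "t \<ge> 0" for k j t
    by (rule Lbd_mono[OF cauchy[OF t]]) (use M p in \<open>auto intro!: mult_right_mono\<close>)
  define w where "w t x = (if t < 0 then 0 else lim (\<lambda>k. v k t x))" for t x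
  have wm: "(\<lambda>(t, x). w t x) \<in> borel_measurable (borel \<Otimes>\<^sub>M borel)"
  proof -
    have [measurable]: "(\<lambda>z. v k (fst z) (snd z)) \<in> borel_measurable (borel \<Otimes>\<^sub>M borel)" for k
      using sm[of k] by (simp add: small_def split_beta')
    have [measurable]: "(\<lambda>z. lim (\<lambda>k. v k (fst z) (snd z))) \<in> borel_measurable (borel \<Otimes>\<^sub>M borel)"
      by (rule borel_measurable_lim_metric) measurable
    show ?thesis unfolding w_def split_beta' by measurable
  qed
  have lim: "AE x in lborel. (\<lambda>k. v k t x) \<longlonglongrightarrow> w t x" if t: "t \<ge> 0" for t
  proof -
    have "AE x in lborel. \<forall>k. \<bar>v (Suc k) t x - v k t x\<bar> \<le> M * (1 / 2) ^ k * ?e t"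
      using step[OF t] unfolding AE_all_countable Lbd_def by blast
    then show ?thesis
    proof eventually_elim
      case (elim x)
      have "summable (\<lambda>k. M * (1 / 2) ^ k * ?e t)"
        by (intro summable_mult2 summable_mult summable_geometric) simp
      then have "summable (\<lambda>k. v (Suc k) t x - v k t x)"
        by (rule summable_comparison_test'[where N = 0]) (use elim in auto)
      then have "convergent (\<lambda>k. \<Sum>i<k. v (Suc i) t x - v i t x)" by (simp add: summable_iff_convergent)
      then have "convergent (\<lambda>k. v k t x - v 0 t x)"
        unfolding sum_lessThan_telescope[of "\<lambda>k. v k t x"] .
      then have "convergent (\<lambda>k. (v k t x - v 0 t x) + v 0 t x)" by (intro convergent_add convergent_const)
      then have "convergent (\<lambda>k. v k t x)" by simp
      then show ?case using t by (simp add: w_def convergent_LIMSEQ_iff)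
    qed
  qed
  have ws: "small M w"
    unfolding small_def
  proof (intro conjI allI impI wm)
    show "w t = (\<lambda>_. 0)" if "t < 0" for t using that by (simp add: w_def[abs_def])
    show "Lbd p (w t) (M * ?e t)" if t: "t \<ge> 0" for t
      by (rule Lbd_limit[OF _ measurable_slice(2)[OF wm] lim[OF t]]) (use sm t p in \<open>auto simp: small_def\<close>)
  qed
  have diff: "Lbd p (\<lambda>x. w t x - v k t x) (2 * M * (1 / 2) ^ k * ?e t)" if t: "t \<ge> 0" for t k
  proof (rule Lbd_limit[OF cauchy'[OF t, where k = k]])
    have [measurable]: "w t \<in> borel_measurable borel" "v k t \<in> borel_measurable borel"
      using measurable_slice(2)[OF wm] sm[of k] measurable_slice(2)[of "v k"] by (auto simp: small_def)
    show "(\<lambda>x. w t x - v k t x) \<in> borel_measurable borel" by simp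
    show "AE x in lborel. (\<lambda>j. v (k + j) t x - v k t x) \<longlonglongrightarrow> w t x - v k t x"
      using lim[OF t]
    proof eventually_elim
      case (elim x)
      then have "(\<lambda>j. v (j + k) t x) \<longlonglongrightarrow> w t x" by (rule LIMSEQ_ignore_initial_segment)
      then show ?case by (intro tendsto_diff tendsto_const) (simp add: add.commute)
    qed
  qed (use p in simp)
  have "AE x in lborel. w t x = V f (Fc w) t x" if t: "t \<ge> 0" for t
  proof -
    \<comment> \<open>The comparison goes through \<open>T f (v k) = v (Suc k)\<close>: the
      contraction controls one part and convergence the other, both of order
      \<open>M / 2^k\<close>.\<close>
    have "Lbd p (\<lambda>x. T f w t x - w t x) (2 * M * ?e t * (1 / 2) ^ k)" for k
    proof -
      have "Lbd p (\<lambda>x. T f w t x - T f (v k) t x) (2 * M * (1 / 2) ^ k / 2 * ?e t)"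
        unfolding T_diff[OF t] by (rule contr[OF ws sm _ _ t]) (use M diff in auto)
      then have "Lbd p (\<lambda>x. (T f w t x - T f (v k) t x) - (w t x - v (Suc k) t x)) (2 * M * (1 / 2) ^ k / 2 * ?e t + 2 * M * (1 / 2) ^ Suc k * ?e t)"
        using p by (intro Lbd_diff diff t) auto
      then show ?thesis by (simp add: v_Suc mult_ac)
    qed
    then have "AE x in lborel. T f w t x - w t x = 0" by (rule Lbd_small_AE_0)
    then show ?thesis by eventually_elim (use t in \<open>simp add: T_def\<close>)
  qed
  with ws show ?thesis by (rule that)
qed

text \<open>As \<open>v\<close> and \<open>w\<close> agree up to \<open>T0\<close>, only the last
  stretch of length at most \<open>\<delta>\<close> contributes to the integral.\<close>

lemma short_time_diff:
  assumes v: "family p v" and w: "family p w" and t: "t \<ge> 0" "t \<le> T0 + \<delta>" and \<delta>: "\<delta> > 0" and H: "H > 0" and T0: "T0 \<ge> 0"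
    and eq: "AE s in lborel. s \<in> {0..T0} \<longrightarrow> (AE x in lborel. v s x = w s x)"
    and d: "AE s in lborel. s \<in> {0..t} \<longrightarrow> Lbd 1 (\<lambda>x. Fc v s x - Fc w s x) H"
  shows "Lbd p (\<lambda>x. \<Phi> (Fc v) t x - \<Phi> (Fc w) t x) (4 * C * H * \<delta>)"
proof (rule \<Phi>_diff_Lbd)
  \<comment> \<open>On \<open>[0, T0]\<close> the sources agree, but \<open>\<Phi>_diff_Lbd\<close>
    needs a positive bound there; \<open>e\<close> is so small that it adds at most
    \<open>H * \<delta>\<close> over \<open>[0, t]\<close>. This doubles the constant from
    \<open>2 * C\<close> to \<open>4 * C\<close>.\<close>
  define e where "e = H * \<delta> / (t + 1)"
  have e: "e > 0" "e * t \<le> H * \<delta>" using H \<delta> t(1) by (auto simp: e_def field_simps)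
  define h where "h s = (if s \<le> T0 then e else H)" for s :: real
  note fv = Fc_family[OF v] and fw = Fc_family[OF w]
  show "family 1 (Fc v)" "family 1 (Fc w)" by (rule fv fw)+
  show "AE s in lborel. s \<in> {0..t} \<longrightarrow> Lbd 1 (\<lambda>x. Fc v s x - Fc w s x) (h s)"
    using eq d
  proof eventually_elim
    case (elim s)
    show ?case
    proof
      assume s: "s \<in> {0..t}"
      show "Lbd 1 (\<lambda>x. Fc v s x - Fc w s x) (h s)"
      proof (cases "s \<le> T0")
        case True
        then have "AE x in lborel. v s x = w s x" using elim s by auto
        then have ae: "AE x in lborel. Fc v s x - Fc w s x = 0" by eventually_elim (simp add: Fc_def)
        have [measurable]: "Fc v s \<in> borel_measurable borel" "Fc w s \<in> borel_measurable borel"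
          using measurable_slice(2)[OF family_measurable[OF fv]] measurable_slice(2)[OF family_measurable[OF fw]] by auto
        have "Lbd 1 (\<lambda>x. Fc v s x - Fc w s x) 0" by (rule Lbd_AE_cong[OF Lbd_zero _ ae]) auto
        then show ?thesis by (rule Lbd_mono) (use True e in \<open>auto simp: h_def\<close>)
      next
        case False
        then show ?thesis using elim s by (simp add: h_def)
      qed
    qed
  qed
  show "h s > 0" if "s \<in> {0..t}" for s using e H by (simp add: h_def)
  have [measurable]: "h \<in> borel_measurable borel" unfolding h_def by measurable
  let ?k = "\<lambda>s. 2 * C * (1 + (t - s)) powr (- 1 / p) * h s"
  have hb: "\<bar>?k s\<bar> \<le> 2 * C * max e H" if "s \<in> {0..t}" for s
  proof -
    have "\<bar>?k s\<bar> = 2 * C * ((1 + (t - s)) powr (- 1 / p) * h s)" using C_pos e H by (simp add: abs_mult h_def)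
    also have "\<dots> \<le> 2 * C * (1 * max e H)"
      using C_pos decay_le_1[of "t - s"] that e H by (intro mult_left_mono mult_mono) (auto simp: h_def)
    finally show ?thesis by simp
  qed
  show int: "set_integrable lborel {0..t} ?k"
    by (rule set_integrable_bounded[where B = "2 * C * max e H"]) (use hb in auto)
  let ?u = "\<lambda>s. 2 * C * (e + indicator {T0<..t} s * H)"
  have iu: "set_integrable lborel {0..t} ?u"
    using C_pos e H by (intro set_integrable_bounded[where B = "2 * C * (e + H)"]) (auto simp: indicator_def abs_mult)
  have "(LINT s:{0..t}|lborel. ?k s) \<le> (LINT s:{0..t}|lborel. ?u s)"
  proof (rule set_integral_mono[OF int iu])
    fix s assume s: "s \<in> {0..t}"
    have "(1 + (t - s)) powr (- 1 / p) * h s \<le> 1 * h s"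
      using decay_le_1[of "t - s"] s e H by (intro mult_right_mono) (auto simp: h_def)
    also have "\<dots> \<le> e + indicator {T0<..t} s * H" using e H s by (auto simp: h_def indicator_def)
    finally show "?k s \<le> ?u s" using C_pos by (simp add: mult.assoc)
  qed
  also have "(LINT s:{0..t}|lborel. ?u s) = 2 * C * (LINT s:{0..t}|lborel. e + indicator {T0<..t} s * H)"
    by (rule set_integral_mult_right)
  also have "(LINT s:{0..t}|lborel. e + indicator {T0<..t} s * H) = (LINT s:{0..t}|lborel. e) + (LINT s:{0..t}|lborel. indicator {T0<..t} s * H)"
    using H e by (intro set_integral_add set_integrable_bounded[where B = "e"] set_integrable_bounded[where B = "H"]) (auto simp: indicator_def)
  also have "(LINT s:{0..t}|lborel. e) = t * e" using t(1) by (simp add: set_lebesgue_integral_def)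
  also have "(LINT s:{0..t}|lborel. indicator {T0<..t} s * H) = (LINT s|lborel. indicator {T0<..t} s * H)"
    unfolding set_lebesgue_integral_def
    by (rule Bochner_Integration.integral_cong) (use T0 in \<open>auto simp: indicator_def\<close>)
  also have "\<dots> \<le> \<delta> * H"
  proof (cases "T0 \<le> t")
    case True
    then have "(LINT s|lborel. indicator {T0<..t} s * H) = (t - T0) * H" by simp
    also have "\<dots> \<le> \<delta> * H" using t H by (intro mult_right_mono) auto
    finally show ?thesis .
  next
    case False
    then show ?thesis using \<delta> H by simp
  qed
  finally have "(LINT s:{0..t}|lborel. ?k s) \<le> 2 * C * (t * e + \<delta> * H)" using C_pos by simp
  also have "\<dots> \<le> 2 * C * (H * \<delta> + \<delta> * H)" using e C_pos by (intro mult_left_mono) (auto simp: mult.commute)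
  finally show "(LINT s:{0..t}|lborel. ?k s) \<le> 4 * C * H * \<delta>" by (simp add: mult_ac)
  show "4 * C * H * \<delta> > 0" using C_pos H \<delta> by simp
qed

end

section \<open>Uniqueness\<close>

lemma loc_bdd_AE_Lbd:
  assumes u: "loc_bdd p u"
  shows "AE t in lborel. t \<in> {0..} \<longrightarrow> (\<exists>B. Lbd p (u t) B)"
proof -
  have "AE t in lborel. t \<in> {0..real k} \<longrightarrow> (\<exists>B. Lbd p (u t) B)" for k :: nat
  proof -
    obtain B where "AE t in lborel. t \<in> {0..real k} \<longrightarrow> Lbd p (u t) B" using u unfolding loc_bdd_def by blast
    then show ?thesis by eventually_elim blast
  qed
  then have "AE t in lborel. \<forall>k::nat. t \<in> {0..real k} \<longrightarrow> (\<exists>B. Lbd p (u t) B)"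
    unfolding AE_all_countable by blast
  then show ?thesis
  proof eventually_elim
    case (elim t)
    obtain k where "t \<le> real k" using real_arch_simple by blast
    then show ?case using elim by auto
  qed
qed

lemma Linf_loc_half_line_measurable:
  assumes "Linf_loc p u"
  shows "(\<lambda>(t, x). indicator {0..} t * u t x) \<in> borel_measurable (borel \<Otimes>\<^sub>M borel)"
proof -
  have "(\<lambda>z. indicator ({0..} \<times> UNIV) z *\<^sub>R (case z of (t, x) \<Rightarrow> u t x)) \<in> borel_measurable borel"
    using assms by (simp add: Linf_loc_def set_borel_measurable_def)
  also have "(\<lambda>z. indicator ({0..} \<times> UNIV) z *\<^sub>R (case z of (t, x) \<Rightarrow> u t x)) = (\<lambda>(t, x). indicator {0..} t * u t x)"
    by (auto simp: fun_eq_iff indicator_def)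
  finally show ?thesis by (simp add: borel_prod)
qed

lemma half_line_integral_cong:
  assumes u: "Linf_loc p u" and z: "(\<lambda>(t, x). z t x) \<in> borel_measurable (borel \<Otimes>\<^sub>M borel)"
    and eq: "AE t in lborel. 0 \<le> t \<longrightarrow> z t = u t" and h[measurable]: "h \<in> borel_measurable borel"
  shows "(LINT t:{0..}|lborel. h t * u t x) = (LINT t:{0..}|lborel. h t * z t x)"
  unfolding set_lebesgue_integral_def
proof (rule integral_cong_AE)
  have [measurable]: "(\<lambda>t. indicator {0..} t * u t x) \<in> borel_measurable borel" "(\<lambda>t. z t x) \<in> borel_measurable borel"
    using measurable_slice(1)[OF Linf_loc_half_line_measurable[OF u]] measurable_slice(1)[OF z] by auto
  have "(\<lambda>t. h t * (indicator {0..} t * u t x)) \<in> borel_measurable lborel" by measurable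
  then show "(\<lambda>t. indicat_real {0..} t *\<^sub>R (h t * u t x)) \<in> borel_measurable lborel" by (simp add: mult_ac)
  show "(\<lambda>t. indicat_real {0..} t *\<^sub>R (h t * z t x)) \<in> borel_measurable lborel" by measurable
  show "AE t in lborel. indicat_real {0..} t *\<^sub>R (h t * u t x) = indicat_real {0..} t *\<^sub>R (h t * z t x)"
    using eq by eventually_elim (auto simp: indicator_def)
qed

context semilinear
begin

lemma F_half_line_measurable:
  assumes u: "Linf_loc p u"
  shows "(\<lambda>(t, x). indicator {0..} t * F (u t x)) \<in> borel_measurable (borel \<Otimes>\<^sub>M borel)"
proof -
  have "(\<lambda>z. F (case z of (t, x) \<Rightarrow> indicator {0..} t * u t x)) \<in> borel_measurable (borel \<Otimes>\<^sub>M borel)"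
    by (rule measurable_compose[OF Linf_loc_half_line_measurable[OF u] F_measurable])
  \<comment> \<open>\<open>F 0 = 0\<close> lets the indicator move out of \<open>F\<close>.\<close>
  also have "(\<lambda>z. F (case z of (t, x) \<Rightarrow> indicator {0..} t * u t x)) = (\<lambda>(t, x). indicator {0..} t * F (u t x))"
    by (auto simp: fun_eq_iff indicator_def F_0)
  finally show ?thesis .
qed

text \<open>The competitor \<open>w\<close> need not be small, and \<open>F\<close> is Lipschitz near \<open>0\<close> only. Equality propagates in
  steps of a length \<open>\<delta>\<close> within which \<open>w\<close> cannot leave the region \<open>\<bar>w\<bar> \<le> eps\<close>.\<close>

lemma fixed_point_unique:
  assumes f: "in_Lcap 1 r f" and v: "small M v" and M: "0 < M" "M \<le> eps / 2"
    and vfix: "AE t in lborel. t \<in> {0..} \<longrightarrow> (AE x in lborel. v t x = V f (Fc v) t x)"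
    and w: "family p w" and wfix: "AE t in lborel. t \<in> {0..} \<longrightarrow> (AE x in lborel. w t x = V f (Fc w) t x)"
  shows "AE t in lborel. t \<in> {0..} \<longrightarrow> (AE x in lborel. w t x = v t x)"
proof -
  have fv: "family p v" using small_family[OF v] M by simp
  note wm = family_measurable[OF w] and vm = family_measurable[OF fv]
  have [measurable]: "w t \<in> borel_measurable borel" "v t \<in> borel_measurable borel" for t
    using measurable_slice(2)[OF wm] measurable_slice(2)[OF vm] by auto
  have dif: "AE t in lborel. t \<in> {0..} \<longrightarrow> (AE x in lborel. w t x - v t x = \<Phi> (Fc w) t x - \<Phi> (Fc v) t x)"
    using vfix wfix
  proof eventually_elim
    case (elim t)
    show ?case
    proof
      assume "t \<in> {0..}"
      then have "AE x in lborel. v t x = V f (Fc v) t x" "AE x in lborel. w t x = V f (Fc w) t x" using elim by auto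
      then show "AE x in lborel. w t x - v t x = \<Phi> (Fc w) t x - \<Phi> (Fc v) t x"
        by eventually_elim (simp add: V_def)
    qed
  qed
  have upto: "AE t in lborel. t \<in> {0..R} \<longrightarrow> (AE x in lborel. w t x = v t x)" if R: "R > 0" for R
  proof -
    obtain H1 where H1: "H1 > 0" "\<And>s. s \<le> R \<Longrightarrow> Lbd 1 (Fc w s) H1" using family_bound[OF Fc_family[OF w], of R] by auto
    obtain H2 where H2: "H2 > 0" "\<And>s. s \<le> R \<Longrightarrow> Lbd 1 (Fc v s) H2" using family_bound[OF Fc_family[OF fv], of R] by auto
    \<comment> \<open>A crude bound for the difference of the sources on \<open>[0, R]\<close>,
      without any smallness; it opens each time step.\<close>
    define H where "H = H1 + H2"
    have H: "H > 0" "\<And>s. s \<le> R \<Longrightarrow> Lbd 1 (\<lambda>x. Fc w s x - Fc v s x) H"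
      using H1 H2 by (auto simp: H_def intro!: Lbd_diff)
    define Q where "Q = 4 * L * eps powr (p - 1) * \<mu> (2 * eps) + 1"
    have "4 * L * eps powr (p - 1) * \<mu> (2 * eps) \<ge> 0" using L_pos mu_nonneg eps by simp
    then have Q: "Q > 0" by (simp add: Q_def)
    \<comment> \<open>The first entry keeps \<open>w - v\<close> below \<open>eps / 2\<close> during
      a step, so that \<open>w\<close> stays in the Lipschitz range as
      \<open>M \<le> eps / 2\<close>; the second makes each pass through the equation halve the
      difference. \<open>\<delta>\<close> depends on \<open>R\<close> but not on the step, so
      finitely many steps reach \<open>R\<close>.\<close>
    define \<delta> where "\<delta> = min (eps / (8 * C * H)) (1 / (8 * C * Q))"
    have \<delta>: "\<delta> > 0" using eps C_pos H(1) Q by (simp add: \<delta>_def)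
    have \<delta>1: "4 * C * H * \<delta> \<le> eps / 2"
    proof -
      have "4 * C * H * \<delta> \<le> 4 * C * H * (eps / (8 * C * H))"
        using C_pos H(1) by (intro mult_left_mono) (auto simp: \<delta>_def)
      also have "\<dots> = eps / 2" using C_pos H(1) by simp
      finally show ?thesis .
    qed
    have \<delta>2: "4 * C * Q * \<delta> \<le> 1 / 2"
    proof -
      have "4 * C * Q * \<delta> \<le> 4 * C * Q * (1 / (8 * C * Q))"
        using C_pos Q by (intro mult_left_mono) (auto simp: \<delta>_def)
      also have "\<dots> = 1 / 2" using C_pos Q by simp
      finally show ?thesis .
    qed
    have step: "AE t in lborel. t \<in> {0..min R (real k * \<delta>)} \<longrightarrow> (AE x in lborel. w t x = v t x)" for k
    proof (induction k)
      case 0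
      show ?case using AE_lborel_singleton[of "0::real"] by eventually_elim auto
    next
      case (Suc k)
      define T0 where "T0 = min R (real k * \<delta>)"
      define T1 where "T1 = min R (real (Suc k) * \<delta>)"
      have T: "T0 \<ge> 0" "T1 \<le> T0 + \<delta>" "T1 \<le> R" using \<delta> R by (auto simp: T0_def T1_def algebra_simps)
      have IH: "AE t in lborel. t \<in> {0..T0} \<longrightarrow> (AE x in lborel. w t x = v t x)" using Suc by (simp add: T0_def)
      \<comment> \<open>One pass through the fixed point equation: equality up to \<open>T0\<close>
        supplies the factor \<open>\<delta>\<close>.\<close>
      have gain: "AE t in lborel. t \<in> {0..T1} \<longrightarrow> Lbd p (\<lambda>x. w t x - v t x) (4 * C * G * \<delta>)"
        if G: "G > 0" and d: "AE s in lborel. s \<in> {0..T1} \<longrightarrow> Lbd 1 (\<lambda>x. Fc w s x - Fc v s x) G" for G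
        using dif
      proof eventually_elim
        case (elim t)
        show ?case
        proof
          assume t: "t \<in> {0..T1}"
          have "AE s in lborel. s \<in> {0..t} \<longrightarrow> Lbd 1 (\<lambda>x. Fc w s x - Fc v s x) G"
            using d by eventually_elim (use t in auto)
          then have 1: "Lbd p (\<lambda>x. \<Phi> (Fc w) t x - \<Phi> (Fc v) t x) (4 * C * G * \<delta>)"
            using t T by (intro short_time_diff[OF w fv _ _ \<delta> G T(1) IH]) auto
          have "AE x in lborel. w t x - v t x = \<Phi> (Fc w) t x - \<Phi> (Fc v) t x" using elim t by simp
          from Lbd_AE_cong[OF 1 _ this] p show "Lbd p (\<lambda>x. w t x - v t x) (4 * C * G * \<delta>)" by simp
        qed
      qed
      have base: "AE t in lborel. t \<in> {0..T1} \<longrightarrow> Lbd p (\<lambda>x. w t x - v t x) (4 * C * H * \<delta>)"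
        by (rule gain[OF H(1)]) (use H(2) T in auto)
      have "AE t in lborel. t \<in> {0..T1} \<longrightarrow> Lbd p (\<lambda>x. w t x - v t x) (4 * C * H * \<delta> * (1 / 2) ^ j)" for j
      proof (induction j)
        case 0
        then show ?case using base by simp
      next
        case (Suc j)
        let ?D = "4 * C * H * \<delta> * (1 / 2) ^ j"
        have D: "?D > 0" using C_pos H(1) \<delta> by simp
        \<comment> \<open>The base bound enters again at every stage, since it is what places
          \<open>w\<close> in the Lipschitz range.\<close>
        have "AE s in lborel. s \<in> {0..T1} \<longrightarrow> Lbd 1 (\<lambda>x. Fc w s x - Fc v s x) (Q * ?D)"
          using base Suc
        proof eventually_elim
          case (elim s)
          show ?case
          proof
            assume s: "s \<in> {0..T1}"
            have vs: "Lbd p (v s) M" using small_Lbd[OF v] M by simp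
            have vs': "Lbd p (v s) eps" by (rule Lbd_mono[OF vs]) (use M eps p in auto)
            have "Lbd p (\<lambda>x. (w s x - v s x) + v s x) (4 * C * H * \<delta> + M)"
              using elim s p by (intro Lbd_add vs) auto
            then have ws: "Lbd p (w s) eps" using \<delta>1 M p by (auto elim!: Lbd_mono)
            have 1: "Lbd 1 (\<lambda>x. Fc w s x - Fc v s x) (4 * L * ?D * eps powr (p - 1) * \<mu> (2 * eps))"
              unfolding Fc_def using elim s D eps by (intro F_diff_Lbd[OF ws vs']) auto
            have "4 * L * ?D * eps powr (p - 1) * \<mu> (2 * eps) = (Q - 1) * ?D" by (simp add: Q_def)
            also have "(Q - 1) * ?D \<le> Q * ?D" by (rule mult_right_mono) (use D in simp_all)
            finally show "Lbd 1 (\<lambda>x. Fc w s x - Fc v s x) (Q * ?D)" by (rule Lbd_mono[OF 1]) simp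
          qed
        qed
        from gain[OF _ this] have "AE t in lborel. t \<in> {0..T1} \<longrightarrow> Lbd p (\<lambda>x. w t x - v t x) (4 * C * (Q * ?D) * \<delta>)"
          using Q D by simp
        moreover have "4 * C * (Q * ?D) * \<delta> \<le> 4 * C * H * \<delta> * (1 / 2) ^ Suc j"
        proof -
          have "4 * C * (Q * ?D) * \<delta> = (4 * C * Q * \<delta>) * ?D" by simp
          also have "\<dots> \<le> 1 / 2 * ?D" by (rule mult_right_mono[OF \<delta>2]) (use D in linarith)
          finally show ?thesis by simp
        qed
        ultimately show ?case
          by (elim eventually_mono) (use p in \<open>auto elim!: Lbd_mono\<close>)
      qed
      then have "AE t in lborel. \<forall>j. t \<in> {0..T1} \<longrightarrow> Lbd p (\<lambda>x. w t x - v t x) (4 * C * H * \<delta> * (1 / 2) ^ j)"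
        unfolding AE_all_countable by blast
      then have "AE t in lborel. t \<in> {0..T1} \<longrightarrow> (AE x in lborel. w t x = v t x)"
      proof eventually_elim
        case (elim t)
        show ?case
        proof
          assume "t \<in> {0..T1}"
          then have "\<And>j. Lbd p (\<lambda>x. w t x - v t x) (4 * C * H * \<delta> * (1 / 2) ^ j)" using elim by blast
          then have "AE x in lborel. w t x - v t x = 0" by (rule Lbd_small_AE_0)
          then show "AE x in lborel. w t x = v t x" by eventually_elim simp
        qed
      qed
      then show ?case by (simp add: T1_def)
    qed
    obtain k where "R / \<delta> \<le> real k" using real_arch_simple by blast
    then have "R \<le> real k * \<delta>" using \<delta> by (simp add: field_simps)
    then have "min R (real k * \<delta>) = R" by simp
    with step[of k] show ?thesis by simp
  qed
  have "AE t in lborel. \<forall>k::nat. t \<in> {0..real (Suc k)} \<longrightarrow> (AE x in lborel. w t x = v t x)"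
    unfolding AE_all_countable by (intro allI upto) simp
  then show ?thesis
  proof eventually_elim
    case (elim t)
    obtain k where "t \<le> real k" using real_arch_simple by blast
    then have "t \<le> real (Suc k)" by simp
    then show ?case using elim by (metis atLeastAtMost_iff atLeast_iff)
  qed
qed

section \<open>Fixed points and solutions of the nonlinear problem\<close>

lemma nonlinear_solution_fixed_point:
  assumes f: "in_Lcap 1 r f" and v: "family p v"
    and vfix: "AE t in lborel. t \<in> {0..} \<longrightarrow> (AE x in lborel. v t x = V f (Fc v) t x)"
  shows "nonlinear_solution l p K F f ((primitive ^^ l) v)"
  unfolding nonlinear_solution_def
proof (intro conjI exI[of _ v])
  note lv = loc_bdd_family[OF v] and g = Fc_family[OF v]
  show "W_loc l p ((primitive ^^ l) v)" by (rule W_loc_primitive_iterate[OF p lv])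
  show Lv: "Linf_loc p v" by (rule loc_bdd_Linf_loc[OF p lv])
  show "weak_t_deriv l ((primitive ^^ l) v) v" by (rule weak_t_deriv_primitive_iterate[OF p lv])
  let ?P = "(primitive ^^ l) (V f (Fc v))"
  have lP: "loc_bdd p ?P" by (rule loc_bdd_primitive_iterate[OF p V_loc_bdd[OF f g]])
  have lu: "loc_bdd p ((primitive ^^ l) v)" by (rule loc_bdd_primitive_iterate[OF p lv])
  have "AE t in lborel. t \<in> {0..} \<longrightarrow> (AE x in lborel. (primitive ^^ l) v t x = ?P t x)"
    by (rule primitive_iterate_cong[OF family_measurable[OF v] V_measurable[OF f g] vfix])
  then show "AE t in lborel. 0 \<le> t \<longrightarrow> duhamel K F f ((primitive ^^ l) v) v t"
  proof eventually_elim
    case (elim t)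
    show ?case
    proof
      assume t: "0 \<le> t"
      have eq: "AE x in lborel. (primitive ^^ l) v t x = ?P t x" using elim t by simp
      have [measurable]: "(primitive ^^ l) v t \<in> borel_measurable borel" "?P t \<in> borel_measurable borel"
        using measurable_slice(2)[OF loc_bdd_measurable[OF lu]] measurable_slice(2)[OF loc_bdd_measurable[OF lP]] by auto
      have "dist_of ((primitive ^^ l) v t) \<phi> = dist_of (?P t) \<phi>" if "schwartz \<phi>" for \<phi>
      proof -
        have [measurable]: "\<phi> \<in> borel_measurable borel" by (rule schwartz_measurable[OF that])
        have "AE x in lborel. (primitive ^^ l) v t x * \<phi> x = ?P t x * \<phi> x" using eq by eventually_elim simp
        then show ?thesis unfolding dist_of_def by (intro integral_cong_AE) auto
      qed
      then show "duhamel K F f ((primitive ^^ l) v) v t"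
        using V_duhamel[where F = F and v = v and u = "(primitive ^^ l) v", OF f g t F_half_line_measurable[OF Lv]]
        by (simp add: Fc_def)
    qed
  qed
qed

text \<open>The Duhamel identity equates a competitor with the \<open>l\<close>-fold primitive of
  \<open>V f (Fc w)\<close>, where \<open>w\<close> is a version of its weak derivative. Weak
  derivatives being unique, \<open>w\<close> equals \<open>V f (Fc w)\<close> a.e., so
  \<open>fixed_point_unique\<close> identifies it with \<open>v\<close>; integrating
  \<open>l\<close> times returns to the competitor.\<close>

lemma nonlinear_solution_unique:
  assumes f: "in_Lcap 1 r f" and v: "small M v" and M: "0 < M" "M \<le> eps / 2"
    and vfix: "AE t in lborel. t \<in> {0..} \<longrightarrow> (AE x in lborel. v t x = V f (Fc v) t x)"
    and sol: "nonlinear_solution l p K F f u'"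
  shows "AE t in lborel. 0 \<le> t \<longrightarrow> (AE x in lborel. u' t x = (primitive ^^ l) v t x)"
proof -
  have fv: "family p v" using small_family[OF v] M by simp
  obtain v' where u': "Linf_loc p u'" and v': "Linf_loc p v'" "weak_t_deriv l u' v'"
    "AE t in lborel. 0 \<le> t \<longrightarrow> duhamel K F f u' v' t"
    using sol unfolding nonlinear_solution_def W_loc_def by blast
  obtain w where w: "family p w" "AE t in lborel. 0 \<le> t \<longrightarrow> w t = v' t" using Linf_loc_family[OF p v'(1)] by blast
  obtain z where z: "family p z" "AE t in lborel. 0 \<le> t \<longrightarrow> z t = u' t" using Linf_loc_family[OF p u'] by blast
  note g = Fc_family[OF w(1)] and zm = family_measurable[OF z(1)] and wm = family_measurable[OF w(1)]
  have lV: "loc_bdd p (V f (Fc w))" by (rule V_loc_bdd[OF f g])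
  define P where "P = (primitive ^^ l) (V f (Fc w))"
  have lP: "loc_bdd p P" unfolding P_def by (rule loc_bdd_primitive_iterate[OF p lV])
  have zP: "AE t in lborel. t \<in> {0..} \<longrightarrow> (AE x in lborel. z t x = P t x)"
    using v'(3) z(2) loc_bdd_AE_Lbd[OF lP] loc_bdd_AE_Lbd[OF loc_bdd_family[OF z(1)]]
  proof eventually_elim
    case (elim t)
    show ?case
    proof
      assume t: "t \<in> {0..}"
      then obtain B1 B2 where B: "Lbd p (P t) B1" "Lbd p (z t) B2" using elim by blast
      have "AE s in lborel. s \<in> {0..t} \<longrightarrow> (\<lambda>x. F (v' s x)) = Fc w s"
        using w(2) by eventually_elim (auto simp: Fc_def)
      from V_duhamel[where F = F and v = v' and u = u', OF f g _ F_half_line_measurable[OF v'(1)] this] elim(1,2) t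
      have "dist_of (z t) \<phi> = dist_of (P t) \<phi>" if "schwartz \<phi>" for \<phi> using that by (simp add: P_def)
      then show "AE x in lborel. z t x = P t x" by (rule AE_eq_if_dist_of_eq[OF B(2,1)])
    qed
  qed
  \<comment> \<open>Weak derivatives are tested at fixed \<open>x\<close>, so the equality is needed
    for almost every time at almost every \<open>x\<close>.\<close>
  have zP': "AE x in lborel. AE t in lborel. t \<in> {0..} \<longrightarrow> z t x = P t x"
    using zP AE_time_space_commute[OF zm loc_bdd_measurable[OF lP], of "{0..}"] by simp
  have wfix: "AE t in lborel. t \<in> {0..} \<longrightarrow> (AE x in lborel. w t x = V f (Fc w) t x)"
  proof (rule AE_eq_if_weak_eq[OF p loc_bdd_family[OF w(1)] lV])
    fix \<psi> assume \<psi>: "time_test \<psi>"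
    have [measurable]: "(deriv ^^ k) \<psi> \<in> borel_measurable borel" for k
      by (rule borel_measurable_continuous_onI[OF time_test_continuous[OF \<psi>]])
    have [measurable]: "\<psi> \<in> borel_measurable borel"
      using borel_measurable_continuous_onI[OF time_test_continuous[OF \<psi>, of 0]] by simp
    have "AE x in lborel. (LINT t:{0..}|lborel. (deriv ^^ l) \<psi> t * u' t x) = (- 1) ^ l * (LINT t:{0..}|lborel. \<psi> t * v' t x)"
      using v'(2) \<psi> unfolding weak_t_deriv_def by blast
    moreover have "AE x in lborel. (LINT t:{0..}|lborel. (deriv ^^ l) \<psi> t * P t x) = (- 1) ^ l * (LINT t:{0..}|lborel. \<psi> t * V f (Fc w) t x)"
      using weak_t_deriv_primitive_iterate[OF p lV, of l] \<psi> unfolding weak_t_deriv_def P_def by blast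
    ultimately show "AE x in lborel. (LINT t:{0..}|lborel. \<psi> t * w t x) = (LINT t:{0..}|lborel. \<psi> t * V f (Fc w) t x)"
      using zP'
    proof eventually_elim
      case (elim x)
      have [measurable]: "(\<lambda>t. z t x) \<in> borel_measurable borel" "(\<lambda>t. P t x) \<in> borel_measurable borel"
        using measurable_slice(1)[OF zm] measurable_slice(1)[OF loc_bdd_measurable[OF lP]] by auto
      have "(LINT t:{0..}|lborel. (deriv ^^ l) \<psi> t * z t x) = (LINT t:{0..}|lborel. (deriv ^^ l) \<psi> t * P t x)"
        unfolding set_lebesgue_integral_def
        by (rule integral_cong_AE) (use elim(3) in \<open>auto elim!: eventually_mono simp: indicator_def\<close>)
      moreover have "(LINT t:{0..}|lborel. (deriv ^^ l) \<psi> t * u' t x) = (LINT t:{0..}|lborel. (deriv ^^ l) \<psi> t * z t x)"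
        by (rule half_line_integral_cong[OF u' zm z(2)]) measurable
      moreover have "(LINT t:{0..}|lborel. \<psi> t * v' t x) = (LINT t:{0..}|lborel. \<psi> t * w t x)"
        by (rule half_line_integral_cong[OF v'(1) wm w(2)]) measurable
      ultimately have "(- 1) ^ l * (LINT t:{0..}|lborel. \<psi> t * w t x) = (- 1) ^ l * (LINT t:{0..}|lborel. \<psi> t * V f (Fc w) t x)"
        using elim(1,2) by simp
      then show ?case by simp
    qed
  qed
  have wv: "AE t in lborel. t \<in> {0..} \<longrightarrow> (AE x in lborel. w t x = v t x)"
    by (rule fixed_point_unique[OF f v M vfix w(1) wfix])
  have "AE t in lborel. t \<in> {0..} \<longrightarrow> (AE x in lborel. V f (Fc w) t x = v t x)"
    using wv wfix
  proof eventually_elim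
    case (elim t)
    show ?case
    proof
      assume "t \<in> {0..}"
      then have "AE x in lborel. w t x = v t x" "AE x in lborel. w t x = V f (Fc w) t x" using elim by auto
      then show "AE x in lborel. V f (Fc w) t x = v t x" by eventually_elim simp
    qed
  qed
  from primitive_iterate_cong[OF V_measurable[OF f g] family_measurable[OF fv] this, of l]
  have "AE t in lborel. t \<in> {0..} \<longrightarrow> (AE x in lborel. P t x = (primitive ^^ l) v t x)" unfolding P_def .
  then show ?thesis
    using zP z(2)
  proof eventually_elim
    case (elim t)
    show ?case
    proof
      assume t: "0 \<le> t"
      then have "AE x in lborel. P t x = (primitive ^^ l) v t x" "AE x in lborel. z t x = P t x" "z t = u' t" using elim by auto
      then show "AE x in lborel. u' t x = (primitive ^^ l) v t x" by (auto elim: eventually_elim2)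
    qed
  qed
qed

lemma small_data_well_posed:
  assumes dini: "c0 > 0" "set_integrable lborel {0<..c0} (\<lambda>\<tau>. \<mu> \<tau> / \<tau>)"
  shows "\<exists>eps0. 0 < eps0 \<and> eps0 < eps \<and>
    (\<forall>f. in_Lcap 1 r f \<and> Lcap_norm 1 r f \<le> eps0 \<longrightarrow>
      (\<exists>u. nonlinear_solution l p K F f u \<and>
        (\<forall>u'. nonlinear_solution l p K F f u' \<longrightarrow>
          (AE t in lborel. 0 \<le> t \<longrightarrow> (AE x in lborel. u' t x = u t x)))))"
proof -
  obtain A where A: "A > 0" "\<forall>t\<ge>0. (LINT s:{0..t}|lborel. (1 + (t - s)) powr (- 1 / p) * wt c0 s) \<le> A * (1 + t) powr (- 1 / p)"
    using decay_convolution[OF dini] by blast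
  let ?q = "16 * C * L * A"
  have q: "?q > 0" using C_pos L_pos A(1) by simp
  \<comment> \<open>The entries serve in turn the Lipschitz range with room for the uniqueness
    argument, the range of the Dini condition, and the contraction condition
    \<open>?q * M powr (p - 1) \<le> 1\<close>.\<close>
  define M where "M = min (eps / 2) (min (c0 / 2) ((1 / ?q) powr (1 / (p - 1))))"
  have M: "0 < M" "M \<le> eps / 2" "2 * M \<le> c0" using eps dini(1) q by (auto simp: M_def)
  have "M powr (p - 1) \<le> ((1 / ?q) powr (1 / (p - 1))) powr (p - 1)"
    using M(1) p by (intro powr_mono2) (auto simp: M_def)
  also have "\<dots> = 1 / ?q" using p q by (simp add: powr_powr)
  finally have MA: "?q * M powr (p - 1) \<le> 1" using q by (simp add: field_simps)
  \<comment> \<open>\<open>M / (2 * C)\<close> lets the linear flow of the datum fill at most half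
    of the ball; \<open>eps / 2\<close> makes \<open>eps0\<close> strictly smaller than
    \<open>eps\<close>.\<close>
  define eps0 where "eps0 = min (M / (2 * C)) (eps / 2)"
  have e: "0 < eps0" "eps0 < eps" using M(1) C_pos eps by (auto simp: eps0_def)
  have "\<exists>u. nonlinear_solution l p K F f u \<and> (\<forall>u'. nonlinear_solution l p K F f u' \<longrightarrow>
          (AE t in lborel. 0 \<le> t \<longrightarrow> (AE x in lborel. u' t x = u t x)))"
    if f: "in_Lcap 1 r f" "Lcap_norm 1 r f \<le> eps0" for f
  proof -
    have "C * Lcap_norm 1 r f \<le> C * (M / (2 * C))"
      using f(2) C_pos by (intro mult_left_mono) (auto simp: eps0_def)
    then have fM: "C * Lcap_norm 1 r f \<le> M / 2" using C_pos by simp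
    have "M \<le> eps" using M(2) eps by simp
    then obtain v where v: "small M v" "\<And>t. t \<ge> 0 \<Longrightarrow> AE x in lborel. v t x = V f (Fc v) t x"
      using fixed_point[OF f(1) M(1) _ M(3) A MA fM] by blast
    have vfix: "AE t in lborel. t \<in> {0..} \<longrightarrow> (AE x in lborel. v t x = V f (Fc v) t x)"
      by (intro AE_I2 impI v(2)) simp
    have fv: "family p v" using small_family[OF v(1)] M by simp
    show ?thesis
      using nonlinear_solution_fixed_point[OF f(1) fv vfix] nonlinear_solution_unique[OF f(1) v(1) M(1,2) vfix]
      by blast
  qed
  then show ?thesis using e by blast
qed

end

theorem theorem3p1:
  fixes m l :: nat
    and d :: "nat \<Rightarrow> nat"
    and c :: "nat \<Rightarrow> ('n::finite \<Rightarrow> nat) \<Rightarrow> real"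
    and K :: "real \<Rightarrow> 'n dist"
    and p eps_bar :: real
    and r :: ereal
    and \<mu> F :: "real \<Rightarrow> real"
  assumes m: "m \<ge> 1" and l: "l < m"
    and Pm: "d m = 0" "c m (\<lambda>_. 0) = 1"
    and p: "p_crit m d c l = ereal p" "p > 1"
    and K: "fundamental_solution m d c K"
    and r: "r \<ge> 1"
    and linear_solution:
      "\<And>f. in_Lcap 1 r f \<Longrightarrow>
         (\<forall>t\<ge>0. conv_exists (K t) f) \<and> linear_cauchy m d c (dist_of f) (\<lambda>t. conv (K t) f)"
    and linear_estimate:
      "\<And>q. q \<ge> ereal p \<Longrightarrow>
         \<exists>C>0. \<forall>f. in_Lcap 1 r f \<longrightarrow> (\<forall>t\<ge>0. \<exists>w. in_Lp q w \<and>
           (\<forall>\<phi>. schwartz \<phi> \<longrightarrow> t_deriv l (\<lambda>s. conv (K s) f) t \<phi> = dist_of w \<phi>) \<and>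
           Lp_norm q w \<le> C * (1 + t) powr (- 1 / p) * Lcap_norm 1 r f)"
    and mu_nonneg: "\<And>s. s \<ge> 0 \<Longrightarrow> \<mu> s \<ge> 0"
    and F: "\<And>s. F s = \<bar>s\<bar> powr p * \<mu> \<bar>s\<bar>"
    and eps_bar: "eps_bar > 0"
    and mu_mono: "mono_on {0..} \<mu>"
    and mu_bounded: "bounded (\<mu> ` {0..eps_bar})"
    and F_zero: "F 0 = 0"
    and F_lipschitz:
      "\<exists>C>0. \<forall>y z. \<bar>y\<bar> \<le> eps_bar \<longrightarrow> \<bar>z\<bar> \<le> eps_bar \<longrightarrow>
         \<bar>F y - F z\<bar> \<le> C * \<bar>y - z\<bar> * (\<bar>y\<bar> powr (p - 1) + \<bar>z\<bar> powr (p - 1)) * \<mu> (\<bar>y\<bar> + \<bar>z\<bar>)"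
    and mu_dini: "\<exists>c0>0. set_integrable lborel {0<..c0} (\<lambda>\<tau>. \<mu> \<tau> / \<tau>)"
  shows "\<exists>eps0. 0 < eps0 \<and> eps0 < eps_bar \<and>
    (\<forall>f. in_Lcap 1 r f \<and> Lcap_norm 1 r f \<le> eps0 \<longrightarrow>
      (\<exists>u. nonlinear_solution l p K F f u \<and>
        (\<forall>u'. nonlinear_solution l p K F f u' \<longrightarrow>
          (AE t in lborel. 0 \<le> t \<longrightarrow> (AE x in lborel. u' t x = u t x)))))"
proof -
  obtain L where L: "L > 0" "\<And>y z. \<bar>y\<bar> \<le> eps_bar \<Longrightarrow> \<bar>z\<bar> \<le> eps_bar \<Longrightarrow>
         \<bar>F y - F z\<bar> \<le> L * \<bar>y - z\<bar> * (\<bar>y\<bar> powr (p - 1) + \<bar>z\<bar> powr (p - 1)) * \<mu> (\<bar>y\<bar> + \<bar>z\<bar>)"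
    using F_lipschitz by blast
  interpret semilinear m l d c K p r \<mu> F eps_bar L
    by unfold_locales (fact l p(2) K r linear_solution linear_estimate mu_nonneg F mu_mono eps_bar L)+
  show ?thesis using mu_dini small_data_well_posed by blast
qed

end
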